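(* Let $\Psi$ and $\Phi$ be $\mathcal A$-localized frames in $\mathcal H$ satisfying $\Phi\sim_{\mathcal A}\Psi$, and let $1\le p\le\infty$. Let $w$ be an $\mathcal A$-admissible weight (and let the constant weight $1$ be $\mathcal A$-admissible), and let $O$ be a linear operator from $\mathcal H^{00}$ to $\mathcal H^\infty_w$. If $$\sup_k\sum_l|\langle O\psi_l,\phi_k\rangle|<\infty\quad\text{and}\quad\sup_l\sum_k|\langle O\psi_l,\phi_k\rangle|<\infty,$$ then $O\in\mathcal B(\mathcal H^p,\mathcal H^p)$.
   Context: $\mathcal H$ is a separable Hilbert space and $K\subseteq\mathbb R^d$ a countable separated index set; sequences and matrices are indexed by $K$. $\ell^{00}$ denotes the finitely supported sequences. A weight is a sequence $w=(w_k)$ with $w_k>0$; $\ell^p_w=\{c:(w_kc_k)\in\ell^p\}$ with $\|c\|_{\ell^p_w}=\|(w_kc_k)\|_{\ell^p}$. A frame $\Psi=(\psi_k)_{k\in K}$ satisfies $A\|f\|^2\le\sum_k|\langle f,\psi_k\rangle|^2\le B\|f\|^2$ for all $f\in\mathcal H$ with some $A,B>0$; $C_\Psi f=(\langle f,\psi_k\rangle)_k$, $D_\Psi c=\sum_kc_k\psi_k$, $S_\Psi=D_\Psi C_\Psi$; the canonical dual frame is $\tilde\Psi=(\tilde\psi_k)$, $\tilde\psi_k=S_\Psi^{-1}\psi_k$. Cross-Gram matrix: $(G_{\Psi,\Phi})_{k,l}=\langle\phi_l,\psi_k\rangle$, $G_\Psi=G_{\Psi,\Psi}$. $\mathcal A$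 is a fixed solid spectral matrix algebra: a Banach $*$-algebra of matrices over $K$ such that (i) $\mathcal A\subseteq\mathcal B(\ell^2)$; (ii) $A\in\mathcal A$ invertible on $\ell^2$ implies $A^{-1}\in\mathcal A$; (iii) $A\in\mathcal A$ and $|b_{k,l}|\le|a_{k,l}|$ for all $k,l$ imply $B=(b_{k,l})\in\mathcal A$ and $\|B\|_{\mathcal A}\le\|A\|_{\mathcal A}$. Write $\Psi\sim_{\mathcal A}\Phi$ if $G_{\Psi,\Phi}\in\mathcal A$; $\Psi$ is $\mathcal A$-localized if $\Psi\sim_{\mathcal A}\Psi$ (it is known that then $\Psi\sim_{\mathcal A}\tilde\Psi$ and $\tilde\Psi\sim_{\mathcal A}\tilde\Psi$). A weight $w$ is $\mathcal A$-admissible if every $A\in\mathcal A$ defines a bounded operator on $\ell^p_w$ for all $1\le p\le\infty$ (then $1/w$ is admissible too). Coorbit spaces: $\mathcal H^{00}=\{\sum_kc_k\psi_k:c\in\ell^{00}\}$. For $1\le p<\infty$, $\mathcal H^p_w$ is the completion of $\mathcal H^{00}$ in the norm $\|f\|_{\mathcal H^p_w}=\|C_{\tilde\Psi}f\|_{\ell^p_w}$. $\mathcal H^\infty_w$ is the set of equivalence classes $f=[f_n]$ of sequences $f_n\in\mathcal H$ such that $\alpha_k=\lim_n\langle f_n,\tilde\psi_k\rangle$ exists for all $k$ and $\sup_n\|C_{\tilde\Psi}f_n\|_{\ell^\infty_w}<\infty$, where $(f_n)\sim(g_n)$ iff $\langle f_n-g_n,\tilde\psi_k\rangle\to0$ for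 all $k$; $C_{\tilde\Psi}f=\alpha$, $\|f\|_{\mathcal H^\infty_w}=\|\alpha\|_{\ell^\infty_w}$. $\mathcal H^p=\mathcal H^p_w$ with $w\equiv1$. The bracket $\langle O\psi_l,\phi_k\rangle$ is the pairing $\langle f,h\rangle_{\mathcal H^\infty_w,\mathcal H^1_{1/w}}=\sum_k(C_{\tilde\Psi}f)_k\overline{(C_\Psi h)_k}$. $O\in\mathcal B(\mathcal H^p,\mathcal H^p)$ means that $O$ extends to a bounded linear operator on $\mathcal H^p$.
   Formalization: The formal theorem also assumes that O is continuous from H^00, normed by some H^q_v with 1≤q≤∞ and v admissible, to H^∞_w; for merely linear O the claim fails (redundant frames). The algebra is taken to contain the identity matrix. *)

theory Defs
  imports "HOL-Analysis.Analysis"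
begin

text \<open>Complex Hilbert spaces. The inner product is linear in its first argument.\<close>

class complex_hilbert = banach +
  fixes cscale :: "complex \<Rightarrow> 'a \<Rightarrow> 'a"
    and cinner :: "'a \<Rightarrow> 'a \<Rightarrow> complex"
  assumes cscale_add_right: "cscale a (x + y) = cscale a x + cscale a y"
    and cscale_add_left: "cscale (a + b) x = cscale a x + cscale b x"
    and cscale_cscale: "cscale a (cscale b x) = cscale (a * b) x"
    and cscale_of_real: "cscale (complex_of_real r) x = r *\<^sub>R x"
    and cinner_commute: "cinner x y = cnj (cinner y x)"
    and cinner_add_left: "cinner (x + y) z = cinner x z + cinner y z"
    and cinner_cscale_left: "cinner (cscale a x) y = a * cinner x y"
    and norm_eq_sqrt_cinner: "norm x = sqrt (Re (cinner x x))"

instantiation complex :: complex_hilbert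
begin

definition cscale_complex :: "complex \<Rightarrow> complex \<Rightarrow> complex" where
  "cscale_complex a x = a * x"

definition cinner_complex :: "complex \<Rightarrow> complex \<Rightarrow> complex" where
  "cinner_complex x y = x * cnj y"

instance
  by standard
    (auto simp: cscale_complex_def cinner_complex_def algebra_simps scaleR_conv_of_real
      norm_complex_def power2_eq_square)

end


text \<open>
  Sequences over \<open>K\<close> are functions that vanish off \<open>K\<close>, and matrices over \<open>K\<close> are functions
  that vanish off \<open>K \<times> K\<close>, so that equality of sequences and matrices is equality in HOL.
\<close>

definition lp :: "'k set \<Rightarrow> ennreal \<Rightarrow> ('k \<Rightarrow> real) \<Rightarrow> ('k \<Rightarrow> complex) set" where
  "lp K p w = {c. (\<forall>k. k \<notin> K \<longrightarrow> c k = 0) \<and>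
     (if p = \<infinity> then bdd_above ((\<lambda>k. w k * cmod (c k)) ` K)
      else (\<lambda>k. (w k * cmod (c k)) powr enn2real p) summable_on K)}"

text \<open>Only meaningful on \<^term>\<open>lp K p w\<close>. Inserting \<open>0\<close> makes the supremum \<open>0\<close> if \<open>K\<close> is empty.\<close>

definition lp_norm :: "'k set \<Rightarrow> ennreal \<Rightarrow> ('k \<Rightarrow> real) \<Rightarrow> ('k \<Rightarrow> complex) \<Rightarrow> real" where
  "lp_norm K p w c =
     (if p = \<infinity> then Sup (insert 0 ((\<lambda>k. w k * cmod (c k)) ` K))
      else (\<Sum>\<^sub>\<infinity>k\<in>K. (w k * cmod (c k)) powr enn2real p) powr (1 / enn2real p))"

definition fin_seqs :: "'k set \<Rightarrow> ('k \<Rightarrow> complex) set" where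
  "fin_seqs K = {c. finite {k. c k \<noteq> 0} \<and> {k. c k \<noteq> 0} \<subseteq> K}"

type_synonym 'k matrix = "'k \<Rightarrow> 'k \<Rightarrow> complex"

definition matrices :: "'k set \<Rightarrow> 'k matrix set" where
  "matrices K = {A. \<forall>k l. k \<notin> K \<or> l \<notin> K \<longrightarrow> A k l = 0}"

definition mat_one :: "'k set \<Rightarrow> 'k matrix" where
  "mat_one K = (\<lambda>k l. if k = l \<and> k \<in> K then 1 else 0)"

definition mat_mult :: "'k set \<Rightarrow> 'k matrix \<Rightarrow> 'k matrix \<Rightarrow> 'k matrix" where
  "mat_mult K A B = (\<lambda>k l. \<Sum>\<^sub>\<infinity>j\<in>K. A k j * B j l)"

definition mat_adj :: "'k matrix \<Rightarrow> 'k matrix" where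
  "mat_adj A = (\<lambda>k l. cnj (A l k))"

definition mat_vec :: "'k set \<Rightarrow> 'k matrix \<Rightarrow> ('k \<Rightarrow> complex) \<Rightarrow> 'k \<Rightarrow> complex" where
  "mat_vec K A c = (\<lambda>k. \<Sum>\<^sub>\<infinity>l\<in>K. A k l * c l)"

definition bounded_on_lp :: "'k set \<Rightarrow> ennreal \<Rightarrow> ('k \<Rightarrow> real) \<Rightarrow> 'k matrix \<Rightarrow> bool" where
  "bounded_on_lp K p w A \<longleftrightarrow>
     (\<exists>C. \<forall>c\<in>lp K p w. (\<forall>k\<in>K. (\<lambda>l. A k l * c l) summable_on K) \<and>
        mat_vec K A c \<in> lp K p w \<and> lp_norm K p w (mat_vec K A c) \<le> C * lp_norm K p w c)"


text \<open>
  \<open>\<A>\<close> is the algebra and \<open>N\<close> its norm. Inverse-closedness in the bounded operators on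
  \<open>\<ell>\<^sup>2\<close> presupposes that \<open>\<A>\<close> contains the identity matrix.
\<close>

definition banach_star_algebra :: "'k set \<Rightarrow> 'k matrix set \<Rightarrow> ('k matrix \<Rightarrow> real) \<Rightarrow> bool" where
  "banach_star_algebra K \<A> N \<longleftrightarrow>
     \<A> \<subseteq> matrices K \<and> mat_one K \<in> \<A> \<and>
     (\<forall>A\<in>\<A>. \<forall>B\<in>\<A>. (\<lambda>k l. A k l + B k l) \<in> \<A> \<and> N (\<lambda>k l. A k l + B k l) \<le> N A + N B) \<and>
     (\<forall>a. \<forall>A\<in>\<A>. (\<lambda>k l. a * A k l) \<in> \<A> \<and> N (\<lambda>k l. a * A k l) = cmod a * N A) \<and>
     (\<forall>A\<in>\<A>. \<forall>B\<in>\<A>. mat_mult K A B \<in> \<A> \<and> N (mat_mult K A B) \<le> N A * N B) \<and>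
     (\<forall>A\<in>\<A>. mat_adj A \<in> \<A> \<and> N (mat_adj A) = N A) \<and>
     (\<forall>A\<in>\<A>. N A \<ge> 0 \<and> (N A = 0 \<longleftrightarrow> A = (\<lambda>k l. 0))) \<and>
     (\<forall>X :: nat \<Rightarrow> 'k matrix. (\<forall>n. X n \<in> \<A>) \<and>
        (\<forall>e>0. \<exists>M. \<forall>m\<ge>M. \<forall>n\<ge>M. N (\<lambda>k l. X m k l - X n k l) < e) \<longrightarrow>
        (\<exists>A\<in>\<A>. (\<lambda>n. N (\<lambda>k l. X n k l - A k l)) \<longlonglongrightarrow> 0))"

definition solid_spectral_algebra :: "'k set \<Rightarrow> 'k matrix set \<Rightarrow> ('k matrix \<Rightarrow> real) \<Rightarrow> bool" where
  "solid_spectral_algebra K \<A> N \<longleftrightarrow>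
     banach_star_algebra K \<A> N \<and>
     (\<forall>A\<in>\<A>. bounded_on_lp K 2 (\<lambda>_. 1) A) \<and>
     (\<forall>A\<in>\<A>. bij_betw (mat_vec K A) (lp K 2 (\<lambda>_. 1)) (lp K 2 (\<lambda>_. 1)) \<longrightarrow>
        (\<exists>B\<in>\<A>. \<forall>c\<in>lp K 2 (\<lambda>_. 1). mat_vec K B (mat_vec K A c) = c)) \<and>
     (\<forall>A\<in>\<A>. \<forall>B\<in>matrices K. (\<forall>k l. cmod (B k l) \<le> cmod (A k l)) \<longrightarrow> B \<in> \<A> \<and> N B \<le> N A)"

definition admissible :: "'k set \<Rightarrow> 'k matrix set \<Rightarrow> ('k \<Rightarrow> real) \<Rightarrow> bool" where
  "admissible K \<A> w \<longleftrightarrow> (\<forall>k\<in>K. w k > 0) \<and> (\<forall>A\<in>\<A>. \<forall>p\<ge>1. bounded_on_lp K p w A)"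


definition is_frame :: "'k set \<Rightarrow> ('k \<Rightarrow> 'h::complex_hilbert) \<Rightarrow> bool" where
  "is_frame K \<psi> \<longleftrightarrow> (\<exists>A>0. \<exists>B>0. \<forall>f.
     (\<lambda>k. (cmod (cinner f (\<psi> k)))\<^sup>2) summable_on K \<and>
     A * (norm f)\<^sup>2 \<le> (\<Sum>\<^sub>\<infinity>k\<in>K. (cmod (cinner f (\<psi> k)))\<^sup>2) \<and>
     (\<Sum>\<^sub>\<infinity>k\<in>K. (cmod (cinner f (\<psi> k)))\<^sup>2) \<le> B * (norm f)\<^sup>2)"

definition analysis :: "'k set \<Rightarrow> ('k \<Rightarrow> 'h::complex_hilbert) \<Rightarrow> 'h \<Rightarrow> 'k \<Rightarrow> complex" where
  "analysis K \<psi> f = (\<lambda>k. if k \<in> K then cinner f (\<psi> k) else 0)"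

definition synthesis :: "'k set \<Rightarrow> ('k \<Rightarrow> 'h::complex_hilbert) \<Rightarrow> ('k \<Rightarrow> complex) \<Rightarrow> 'h" where
  "synthesis K \<psi> c = (\<Sum>\<^sub>\<infinity>k\<in>K. cscale (c k) (\<psi> k))"

definition frame_op :: "'k set \<Rightarrow> ('k \<Rightarrow> 'h::complex_hilbert) \<Rightarrow> 'h \<Rightarrow> 'h" where
  "frame_op K \<psi> f = synthesis K \<psi> (analysis K \<psi> f)"

definition dual_frame :: "'k set \<Rightarrow> ('k \<Rightarrow> 'h::complex_hilbert) \<Rightarrow> 'k \<Rightarrow> 'h" where
  "dual_frame K \<psi> k = inv (frame_op K \<psi>) (\<psi> k)"

definition cross_gram ::
  "'k set \<Rightarrow> ('k \<Rightarrow> 'h::complex_hilbert) \<Rightarrow> ('k \<Rightarrow> 'h) \<Rightarrow> 'k matrix" where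
  "cross_gram K \<psi> \<phi> = (\<lambda>k l. if k \<in> K \<and> l \<in> K then cinner (\<phi> l) (\<psi> k) else 0)"

definition loc_rel ::
  "'k set \<Rightarrow> 'k matrix set \<Rightarrow> ('k \<Rightarrow> 'h::complex_hilbert) \<Rightarrow> ('k \<Rightarrow> 'h) \<Rightarrow> bool" where
  "loc_rel K \<A> \<psi> \<phi> \<longleftrightarrow> cross_gram K \<psi> \<phi> \<in> \<A>"

definition localized :: "'k set \<Rightarrow> 'k matrix set \<Rightarrow> ('k \<Rightarrow> 'h::complex_hilbert) \<Rightarrow> bool" where
  "localized K \<A> \<psi> \<longleftrightarrow> loc_rel K \<A> \<psi> \<psi>"


definition H00 :: "'k set \<Rightarrow> ('k \<Rightarrow> 'h::complex_hilbert) \<Rightarrow> 'h set" where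
  "H00 K \<psi> = synthesis K \<psi> ` fin_seqs K"

definition pre_norm ::
  "'k set \<Rightarrow> ('k \<Rightarrow> 'h::complex_hilbert) \<Rightarrow> ennreal \<Rightarrow> ('k \<Rightarrow> real) \<Rightarrow> 'h \<Rightarrow> real" where
  "pre_norm K \<psi> p w f = lp_norm K p w (analysis K (dual_frame K \<psi>) f)"

text \<open>
  Every coorbit space is a quotient of a space of sequences in the Hilbert space: for
  \<open>p < \<infinity>\<close> it is the completion of \<^const>\<open>H00\<close>, that is, Cauchy sequences for
  \<^const>\<open>pre_norm\<close> modulo null sequences; for \<open>p = \<infinity>\<close> the sequences have uniformly bounded
  and pointwise convergent coefficients.
\<close>

definition coorbit_seqs ::
  "'k set \<Rightarrow> ('k \<Rightarrow> 'h::complex_hilbert) \<Rightarrow> ennreal \<Rightarrow> ('k \<Rightarrow> real) \<Rightarrow> (nat \<Rightarrow> 'h) set" where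
  "coorbit_seqs K \<psi> p w =
     (if p = \<infinity> then
        {f. (\<forall>k\<in>K. convergent (\<lambda>n. cinner (f n) (dual_frame K \<psi> k))) \<and>
            (\<exists>C. \<forall>n. analysis K (dual_frame K \<psi>) (f n) \<in> lp K \<infinity> w \<and> pre_norm K \<psi> \<infinity> w (f n) \<le> C)}
      else
        {f. (\<forall>n. f n \<in> H00 K \<psi>) \<and>
            (\<forall>e>0. \<exists>M. \<forall>m\<ge>M. \<forall>n\<ge>M. pre_norm K \<psi> p w (f m - f n) < e)})"

definition coorbit_rel ::
  "'k set \<Rightarrow> ('k \<Rightarrow> 'h::complex_hilbert) \<Rightarrow> ennreal \<Rightarrow> ('k \<Rightarrow> real) \<Rightarrow>
     ((nat \<Rightarrow> 'h) \<times> (nat \<Rightarrow> 'h)) set" where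
  "coorbit_rel K \<psi> p w = {(f, g). f \<in> coorbit_seqs K \<psi> p w \<and> g \<in> coorbit_seqs K \<psi> p w \<and>
     (if p = \<infinity> then \<forall>k\<in>K. (\<lambda>n. cinner (f n - g n) (dual_frame K \<psi> k)) \<longlonglongrightarrow> 0
      else (\<lambda>n. pre_norm K \<psi> p w (f n - g n)) \<longlonglongrightarrow> 0)}"

definition coorbit ::
  "'k set \<Rightarrow> ('k \<Rightarrow> 'h::complex_hilbert) \<Rightarrow> ennreal \<Rightarrow> ('k \<Rightarrow> real) \<Rightarrow> (nat \<Rightarrow> 'h) set set" where
  "coorbit K \<psi> p w = coorbit_seqs K \<psi> p w // coorbit_rel K \<psi> p w"

definition coorbit_add ::
  "'k set \<Rightarrow> ('k \<Rightarrow> 'h::complex_hilbert) \<Rightarrow> ennreal \<Rightarrow> ('k \<Rightarrow> real) \<Rightarrow>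
     (nat \<Rightarrow> 'h) set \<Rightarrow> (nat \<Rightarrow> 'h) set \<Rightarrow> (nat \<Rightarrow> 'h) set" where
  "coorbit_add K \<psi> p w X Y = (\<Union>f\<in>X. \<Union>g\<in>Y. coorbit_rel K \<psi> p w `` {\<lambda>n. f n + g n})"

definition coorbit_scale ::
  "'k set \<Rightarrow> ('k \<Rightarrow> 'h::complex_hilbert) \<Rightarrow> ennreal \<Rightarrow> ('k \<Rightarrow> real) \<Rightarrow>
     complex \<Rightarrow> (nat \<Rightarrow> 'h) set \<Rightarrow> (nat \<Rightarrow> 'h) set" where
  "coorbit_scale K \<psi> p w a X = (\<Union>f\<in>X. coorbit_rel K \<psi> p w `` {\<lambda>n. cscale a (f n)})"

text \<open>The coefficient sequence, extended from \<^const>\<open>H00\<close> by continuity if \<open>p < \<infinity>\<close>.\<close>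

definition coorbit_coeff ::
  "'k set \<Rightarrow> ('k \<Rightarrow> 'h::complex_hilbert) \<Rightarrow> (nat \<Rightarrow> 'h) set \<Rightarrow> 'k \<Rightarrow> complex" where
  "coorbit_coeff K \<psi> X =
     (\<lambda>k. if k \<in> K then lim (\<lambda>n. cinner ((SOME f. f \<in> X) n) (dual_frame K \<psi> k)) else 0)"

definition coorbit_norm ::
  "'k set \<Rightarrow> ('k \<Rightarrow> 'h::complex_hilbert) \<Rightarrow> ennreal \<Rightarrow> ('k \<Rightarrow> real) \<Rightarrow> (nat \<Rightarrow> 'h) set \<Rightarrow> real" where
  "coorbit_norm K \<psi> p w X =
     (if p = \<infinity> then lp_norm K \<infinity> w (coorbit_coeff K \<psi> X)
      else lim (\<lambda>n. pre_norm K \<psi> p w ((SOME f. f \<in> X) n)))"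

definition coorbit_embed ::
  "'k set \<Rightarrow> ('k \<Rightarrow> 'h::complex_hilbert) \<Rightarrow> ennreal \<Rightarrow> ('k \<Rightarrow> real) \<Rightarrow> 'h \<Rightarrow> (nat \<Rightarrow> 'h) set" where
  "coorbit_embed K \<psi> p w f = coorbit_rel K \<psi> p w `` {\<lambda>_. f}"

text \<open>
  The pairing of \<open>X\<close> in the weighted space with \<open>p = \<infinity>\<close> and a vector \<open>h\<close> of the Hilbert space
  that belongs to the coorbit space with \<open>p = 1\<close> and the reciprocal weight.
\<close>

definition coorbit_pairing ::
  "'k set \<Rightarrow> ('k \<Rightarrow> 'h::complex_hilbert) \<Rightarrow> (nat \<Rightarrow> 'h) set \<Rightarrow> 'h \<Rightarrow> complex" where
  "coorbit_pairing K \<psi> X h = (\<Sum>\<^sub>\<infinity>k\<in>K. coorbit_coeff K \<psi> X k * cnj (analysis K \<psi> h k))"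


definition linear_H00_Hinf ::
  "'k set \<Rightarrow> ('k \<Rightarrow> 'h::complex_hilbert) \<Rightarrow> ('k \<Rightarrow> real) \<Rightarrow> ('h \<Rightarrow> (nat \<Rightarrow> 'h) set) \<Rightarrow> bool" where
  "linear_H00_Hinf K \<psi> w T \<longleftrightarrow>
     (\<forall>f\<in>H00 K \<psi>. T f \<in> coorbit K \<psi> \<infinity> w) \<and>
     (\<forall>f\<in>H00 K \<psi>. \<forall>g\<in>H00 K \<psi>. T (f + g) = coorbit_add K \<psi> \<infinity> w (T f) (T g)) \<and>
     (\<forall>a. \<forall>f\<in>H00 K \<psi>. T (cscale a f) = coorbit_scale K \<psi> \<infinity> w a (T f))"

text \<open>
  Continuity for at least one of the coorbit norms on \<^const>\<open>H00\<close> with admissible weight.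
\<close>

definition continuous_H00_Hinf ::
  "'k set \<Rightarrow> 'k matrix set \<Rightarrow> ('k \<Rightarrow> 'h::complex_hilbert) \<Rightarrow> ('k \<Rightarrow> real) \<Rightarrow>
     ('h \<Rightarrow> (nat \<Rightarrow> 'h) set) \<Rightarrow> bool" where
  "continuous_H00_Hinf K \<A> \<psi> w T \<longleftrightarrow>
     (\<exists>q\<ge>1. \<exists>v. admissible K \<A> v \<and>
        (\<exists>C. \<forall>f\<in>H00 K \<psi>. coorbit_norm K \<psi> \<infinity> w (T f) \<le> C * pre_norm K \<psi> q v f))"

definition bounded_operator_Hp ::
  "'k set \<Rightarrow> ('k \<Rightarrow> 'h::complex_hilbert) \<Rightarrow> ennreal \<Rightarrow> ('k \<Rightarrow> real) \<Rightarrow>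
     ((nat \<Rightarrow> 'h) set \<Rightarrow> (nat \<Rightarrow> 'h) set) \<Rightarrow> bool" where
  "bounded_operator_Hp K \<psi> p w T \<longleftrightarrow>
     (\<forall>X\<in>coorbit K \<psi> p w. T X \<in> coorbit K \<psi> p w) \<and>
     (\<forall>X\<in>coorbit K \<psi> p w. \<forall>Y\<in>coorbit K \<psi> p w.
        T (coorbit_add K \<psi> p w X Y) = coorbit_add K \<psi> p w (T X) (T Y)) \<and>
     (\<forall>a. \<forall>X\<in>coorbit K \<psi> p w. T (coorbit_scale K \<psi> p w a X) = coorbit_scale K \<psi> p w a (T X)) \<and>
     (\<exists>C. \<forall>X\<in>coorbit K \<psi> p w. coorbit_norm K \<psi> p w (T X) \<le> C * coorbit_norm K \<psi> p w X)"

text \<open>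
  The values of \<open>T\<close> lie in the space for \<open>p = \<infinity>\<close> and weight \<open>w\<close>, those of its extension \<open>S\<close>
  in the unweighted space for \<open>p\<close>. Elements of different coorbit spaces are identified when
  their coefficient sequences agree; on each single space the coefficients determine the element.
\<close>

definition extends_to_bounded_Hp ::
  "'k set \<Rightarrow> ('k \<Rightarrow> 'h::complex_hilbert) \<Rightarrow> ennreal \<Rightarrow> ('h \<Rightarrow> (nat \<Rightarrow> 'h) set) \<Rightarrow> bool" where
  "extends_to_bounded_Hp K \<psi> p T \<longleftrightarrow>
     (\<exists>S. bounded_operator_Hp K \<psi> p (\<lambda>_. 1) S \<and>
        (\<forall>f\<in>H00 K \<psi>. coorbit_coeff K \<psi> (S (coorbit_embed K \<psi> p (\<lambda>_. 1) f)) =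
                        coorbit_coeff K \<psi> (T f)))"

end

theory Submission
  imports Defs
begin

text \<open>
  Let \<open>M\<close> be the matrix of the brackets of the statement. By Schur's test it is bounded on every
  \<open>\<ell>\<^sup>p\<close>. If \<open>f\<close> is the synthesis of a finite sequence \<open>c\<close>, then \<open>M c\<close> is the cross-Gram matrix of \<open>\<phi>\<close> and
  \<open>\<psi>\<close> applied to the coefficients of \<open>T f\<close>, so multiplying by the cross-Gram matrix \<open>R\<close> of the two dual
  frames recovers them: the coefficients of \<open>T f\<close> are \<open>R M c\<close>. As \<open>R\<close> belongs to the algebra,
  \<open>R M\<close> is bounded on \<open>\<ell>\<^sup>p\<close>, and on the range of the coefficient map it is the extension.

  That \<open>R\<close> belongs to the algebra rests on the localization of the dual frame. The Gram
  matrix \<open>G\<close> has a spectral gap above \<open>0\<close>, so its range projection \<open>P\<close> is a contour integral of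
  resolvents, which belong to the algebra because it is inverse-closed. The integral converges in the
  algebra as a limit of Riemann sums, and the Gram matrix of the dual frame is
  \<open>(G + 1 - P)\<close> inverted, minus \<open>1 - P\<close>.
\<close>

section \<open>Weighted sequence spaces\<close>

text \<open>Two obstacles shape the proof. A redundant frame has a Gram matrix with a kernel, so
  inverse-closedness cannot be applied to \<open>G\<close> itself, and where it applies it gives an
  inverse without any norm bound. Hence the affine change to \<open>Ym\<close>, which multiplies the
  kernel of synthesis by a number above 1 and acts on the range of analysis like a contraction of
  the Hilbert space. The means of its resolvents over the \<open>2^n\<close>-th roots of unity are
  \<open>(1 - Y^(2^n))^-1\<close>; the power blows up on the kernel and dies out on the range, which
  is why the limit is the projection.

  The second obstacle is that \<open>f\<close> does not determine \<open>c\<close>. The extension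
  sees only the coefficients \<open>P c\<close> of \<open>f\<close>, whereas \<open>T f\<close> is
  computed from \<open>c\<close>. The difference \<open>c - P c\<close> is killed by synthesis but
  need not be finitely supported, so linearity of \<open>T\<close> on \<open>H00\<close> says
  nothing about it; continuity of \<open>T\<close> does. The weights \<open>w\<close> and
  \<open>1\<close> need not be comparable, so the two values are compared coordinate by
  coordinate.\<close>

lemma ennreal_ge1_cases:
  fixes p :: ennreal
  assumes "1 \<le> p"
  obtains "p = \<infinity>" | "p \<noteq> \<infinity>" "enn2real p \<ge> 1"
proof (cases "p = \<infinity>")
  case False
  then have "p < top" by (simp add: less_top)
  then have "enn2real 1 \<le> enn2real p" using assms by (intro enn2real_mono)
  with False that show ?thesis by simp
qed

text \<open>At the endpoint 0 convexity degenerates to \<open>(s z)^p <= s z^p\<close> for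
  \<open>0 < s < 1\<close>, that is, to \<open>s^p <= s\<close>.\<close>

lemma convex_powr_nonneg:
  fixes p :: real
  assumes "1 \<le> p"
  shows "convex_on {0..} (\<lambda>x::real. x powr p)"
proof (rule convex_onI)
  fix t x y :: real
  assume t: "0 < t" "t < 1" and xy: "x \<in> {0..}" "y \<in> {0..}"
  have small: "(s * z) powr p \<le> s * z powr p" if "0 < s" "s < 1" "0 \<le> z" for s z :: real
  proof -
    have "s powr p \<le> s powr 1" using that assms by (intro powr_mono') auto
    then show ?thesis using that by (simp add: powr_mult mult_right_mono)
  qed
  show "((1 - t) *\<^sub>R x + t *\<^sub>R y) powr p \<le> (1 - t) * x powr p + t * y powr p"
  proof (cases "x = 0 \<or> y = 0")
    case True
    then show ?thesis using small[of t y] small[of "1 - t" x] t xy assms by auto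
  next
    case False
    then show ?thesis
      using convex_onD[OF powr_convex[OF assms], of t x y] t xy by auto
  qed
qed simp

text \<open>Jensen's inequality for the weights divided by their sum \<open>s\<close> costs the
  factor \<open>s^(p-1)\<close>, which may be enlarged to \<open>D^(p-1)\<close> because
  \<open>p - 1 >= 0\<close>. It replaces Hoelder's inequality in Schur's test, so that no conjugate
  exponent appears.\<close>

lemma powr_weighted_sum_le:
  fixes p :: real and a x :: "'k \<Rightarrow> real"
  assumes p: "1 \<le> p" and F: "finite F" and a: "\<And>i. i \<in> F \<Longrightarrow> 0 \<le> a i"
    and x: "\<And>i. i \<in> F \<Longrightarrow> 0 \<le> x i" and D: "sum a F \<le> D"
  shows "(\<Sum>i\<in>F. a i * x i) powr p \<le> D powr (p - 1) * (\<Sum>i\<in>F. a i * x i powr p)"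
proof (cases "sum a F = 0")
  case True
  then have "\<And>i. i \<in> F \<Longrightarrow> a i = 0" using a F by (simp add: sum_nonneg_eq_0_iff)
  then show ?thesis using p by simp
next
  case False
  define s where "s = sum a F"
  have s: "s > 0" using False a unfolding s_def by (simp add: sum_nonneg less_le)
  have ne: "F \<noteq> {}" using False by auto
  have cv: "(\<Sum>i\<in>F. (a i / s) *\<^sub>R x i) powr p \<le> (\<Sum>i\<in>F. (a i / s) * x i powr p)"
    using s a x F ne
    by (intro convex_on_sum[OF F ne convex_powr_nonneg[OF p]])
      (auto simp: s_def simp flip: sum_divide_distrib)
  have "(\<Sum>i\<in>F. a i * x i) = s * (\<Sum>i\<in>F. (a i / s) *\<^sub>R x i)"
    using s by (simp add: sum_distrib_left)
  then have "(\<Sum>i\<in>F. a i * x i) powr p = s powr p * (\<Sum>i\<in>F. (a i / s) *\<^sub>R x i) powr p"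
    using s a x by (simp add: powr_mult sum_nonneg)
  also have "\<dots> \<le> s powr p * (\<Sum>i\<in>F. (a i / s) * x i powr p)"
    by (intro mult_left_mono cv) simp
  also have "\<dots> = s powr (p - 1) * (\<Sum>i\<in>F. a i * x i powr p)"
    using s by (simp add: powr_diff sum_divide_distrib[symmetric])
  also have "\<dots> \<le> D powr (p - 1) * (\<Sum>i\<in>F. a i * x i powr p)"
    using s D p a x unfolding s_def
    by (intro mult_right_mono powr_mono2 sum_nonneg mult_nonneg_nonneg) auto
  finally show ?thesis .
qed

text \<open>All estimates in the sequence spaces are reduced to finite sections.\<close>

definition lp_le :: "ennreal \<Rightarrow> 'k set \<Rightarrow> ('k \<Rightarrow> real) \<Rightarrow> real \<Rightarrow> bool" where
  "lp_le p F x C \<longleftrightarrow> (if p = \<infinity> then \<forall>k\<in>F. x k \<le> C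
     else (\<Sum>k\<in>F. x k powr enn2real p) \<le> C powr enn2real p)"

lemma lp_le_mono:
  assumes "lp_le p F y C" "1 \<le> p" "\<And>k. k \<in> F \<Longrightarrow> 0 \<le> x k" "\<And>k. k \<in> F \<Longrightarrow> x k \<le> y k"
    "0 \<le> C" "C \<le> D"
  shows "lp_le p F x D"
  using assms(2)
proof (cases rule: ennreal_ge1_cases)
  case 1
  then show ?thesis using assms by (force simp: lp_le_def)
next
  case 2
  have "(\<Sum>k\<in>F. x k powr enn2real p) \<le> (\<Sum>k\<in>F. y k powr enn2real p)"
    using 2 assms by (intro sum_mono powr_mono2) auto
  also have "\<dots> \<le> C powr enn2real p" using 2 assms(1) by (simp add: lp_le_def)
  also have "\<dots> \<le> D powr enn2real p" using 2 assms by (intro powr_mono2) auto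
  finally show ?thesis using 2 by (simp add: lp_le_def)
qed

lemma lp_le_coord:
  assumes "lp_le p F x C" "1 \<le> p" "finite F" "k \<in> F" "0 \<le> x k" "0 \<le> C"
  shows "x k \<le> C"
  using assms(2)
proof (cases rule: ennreal_ge1_cases)
  case 1
  then show ?thesis using assms by (simp add: lp_le_def)
next
  case 2
  have "x k powr enn2real p \<le> (\<Sum>k\<in>F. x k powr enn2real p)"
    using assms by (intro member_le_sum) auto
  also have "\<dots> \<le> C powr enn2real p" using 2 assms(1) by (simp add: lp_le_def)
  finally have le: "x k powr enn2real p \<le> C powr enn2real p" .
  show ?thesis
  proof (rule ccontr)
    assume "\<not> x k \<le> C"
    then have "C powr enn2real p < x k powr enn2real p"
      using 2 assms by (intro powr_less_mono2) auto
    with le show False by simp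
  qed
qed

lemma lp_le_scale:
  assumes "lp_le p F x C" "1 \<le> p" "\<And>k. k \<in> F \<Longrightarrow> 0 \<le> x k" "0 \<le> C" "0 \<le> a"
  shows "lp_le p F (\<lambda>k. a * x k) (a * C)"
  using assms by (auto simp: lp_le_def powr_mult mult_left_mono simp flip: sum_distrib_left)

text \<open>Minkowski's inequality with upper bounds in place of norms:
  \<open>(x + y) / (a + b)\<close> is the convex combination of \<open>x / a\<close> and
  \<open>y / b\<close> with weights \<open>a / (a + b)\<close> and \<open>b / (a + b)\<close>. A
  bound equal to 0 forces its sequence to vanish and is treated apart.\<close>

lemma lp_le_add:
  assumes x: "lp_le p F x a" and y: "lp_le p F y b" and p: "1 \<le> p" and F: "finite F"
    and x0: "\<And>k. k \<in> F \<Longrightarrow> 0 \<le> x k" and y0: "\<And>k. k \<in> F \<Longrightarrow> 0 \<le> y k" and ab: "0 \<le> a" "0 \<le> b"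
  shows "lp_le p F (\<lambda>k. x k + y k) (a + b)"
  using p
proof (cases rule: ennreal_ge1_cases)
  case 1
  then show ?thesis using x y by (force simp: lp_le_def)
next
  case 2
  define q where "q = enn2real p"
  have q: "1 \<le> q" using 2 by (simp add: q_def)
  have sx: "(\<Sum>k\<in>F. x k powr q) \<le> a powr q" and sy: "(\<Sum>k\<in>F. y k powr q) \<le> b powr q"
    using 2 x y by (auto simp: lp_le_def q_def)
  show ?thesis
  proof (cases "a = 0 \<or> b = 0")
    case True
    then show ?thesis
    proof
      assume a: "a = 0"
      have "x k = 0" if "k \<in> F" for k using lp_le_coord[OF x p F that] x0 that a by force
      then show ?thesis using y a by (simp add: lp_le_def cong: sum.cong)
    next
      assume b: "b = 0"
      have "y k = 0" if "k \<in> F" for k using lp_le_coord[OF y p F that] y0 that b by force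
      then show ?thesis using x b by (simp add: lp_le_def cong: sum.cong)
    qed
  next
    case False
    then have a: "a > 0" and b: "b > 0" using ab by auto
    define t where "t = b / (a + b)"
    have t: "0 \<le> t" "t \<le> 1" "1 - t = a / (a + b)" using a b by (auto simp: t_def field_simps)
    have pt: "(x k + y k) powr q \<le> (a + b) powr q * ((1 - t) * (x k / a) powr q + t * (y k / b) powr q)"
      if "k \<in> F" for k
    proof -
      have "x k + y k = (a + b) * ((1 - t) * (x k / a) + t * (y k / b))"
        unfolding t(3) using a b by (simp add: t_def distrib_left)
      moreover have "0 \<le> (1 - t) * (x k / a) + t * (y k / b)"
        using t a b x0 y0 that by simp
      ultimately have "(x k + y k) powr q = (a + b) powr q * ((1 - t) * (x k / a) + t * (y k / b)) powr q"
        using a b by (simp add: powr_mult)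
      moreover have "((1 - t) * (x k / a) + t * (y k / b)) powr q
          \<le> (1 - t) * (x k / a) powr q + t * (y k / b) powr q"
        using convex_onD[OF convex_powr_nonneg[OF q] t(1,2), of "x k / a" "y k / b"] x0 y0 that a b
        by simp
      ultimately show ?thesis by (simp add: mult_left_mono)
    qed
    have "(\<Sum>k\<in>F. (x k + y k) powr q)
        \<le> (\<Sum>k\<in>F. (a + b) powr q * ((1 - t) * (x k / a) powr q + t * (y k / b) powr q))"
      by (intro sum_mono pt)
    also have "\<dots> = (a + b) powr q * ((1 - t) * ((\<Sum>k\<in>F. x k powr q) / a powr q)
        + t * ((\<Sum>k\<in>F. y k powr q) / b powr q))"
      using a b x0 y0
      by (simp add: powr_divide sum.distrib sum_distrib_left sum_divide_distrib distrib_left)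
    also have "\<dots> \<le> (a + b) powr q * ((1 - t) * 1 + t * 1)"
      using t a b sx sy by (intro mult_left_mono add_mono) (auto simp: divide_le_eq)
    finally show ?thesis using 2 by (simp add: lp_le_def q_def)
  qed
qed

text \<open>A form of Fatou's lemma: a finite section depends continuously on finitely many
  coordinates. The filter is arbitrary because both sequences and nets of finite subsets
  occur.\<close>

lemma lp_le_limit:
  assumes lim: "\<And>k. k \<in> F \<Longrightarrow> ((\<lambda>i. x i k) \<longlongrightarrow> y k) I" and I: "I \<noteq> bot"
    and le: "eventually (\<lambda>i. lp_le p F (x i) C) I" and p: "1 \<le> p" and F: "finite F"
    and nn: "\<And>i k. k \<in> F \<Longrightarrow> 0 \<le> x i k"
  shows "lp_le p F y C"
  using p
proof (cases rule: ennreal_ge1_cases)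
  case 1
  have "y k \<le> C" if "k \<in> F" for k
    by (rule tendsto_upperbound[OF lim[OF that] _ I])
      (use le 1 that in \<open>auto simp: lp_le_def elim: eventually_mono\<close>)
  then show ?thesis using 1 by (simp add: lp_le_def)
next
  case 2
  have "((\<lambda>i. \<Sum>k\<in>F. x i k powr enn2real p) \<longlongrightarrow> (\<Sum>k\<in>F. y k powr enn2real p)) I"
    using 2 nn by (intro tendsto_sum tendsto_powr' lim) auto
  then have "(\<Sum>k\<in>F. y k powr enn2real p) \<le> C powr enn2real p"
    by (rule tendsto_upperbound[OF _ _ I])
      (use le 2 in \<open>auto simp: lp_le_def elim: eventually_mono\<close>)
  then show ?thesis using 2 by (simp add: lp_le_def)
qed

text \<open>Every coordinate is at most \<open>C\<close>, hence \<open>x^p <= C^(p-1) x\<close>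
  coordinatewise.\<close>

lemma lp_le_of_l1:
  assumes x: "lp_le 1 F x C" and p: "1 \<le> p" and F: "finite F"
    and x0: "\<And>k. k \<in> F \<Longrightarrow> 0 \<le> x k" and C: "0 \<le> C"
  shows "lp_le p F x C"
  using p
proof (cases rule: ennreal_ge1_cases)
  case 1
  then show ?thesis using lp_le_coord[OF x _ F] x0 C by (auto simp: lp_le_def)
next
  case 2
  have "\<And>k. k \<in> F \<Longrightarrow> x k powr enn2real p \<le> C powr (enn2real p - 1) * x k"
  proof -
    fix k assume k: "k \<in> F"
    have "x k powr enn2real p = x k powr (enn2real p - 1) * x k"
      using x0[OF k] by (cases "x k = 0") (auto simp: powr_diff)
    also have "\<dots> \<le> C powr (enn2real p - 1) * x k"
      using 2 x0[OF k] lp_le_coord[OF x _ F k] C by (intro mult_right_mono powr_mono2) auto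
    finally show "x k powr enn2real p \<le> C powr (enn2real p - 1) * x k" .
  qed
  then have "(\<Sum>k\<in>F. x k powr enn2real p) \<le> C powr (enn2real p - 1) * (\<Sum>k\<in>F. x k)"
    by (simp add: sum_distrib_left sum_mono)
  also have "\<dots> \<le> C powr (enn2real p - 1) * C"
    using x x0 C by (intro mult_left_mono) (auto simp: lp_le_def cong: sum.cong)
  also have "\<dots> = C powr enn2real p" using C by (cases "C = 0") (auto simp: powr_diff)
  finally show ?thesis using 2 by (simp add: lp_le_def)
qed

section \<open>Weighted spaces described through their finite sections\<close>

lemma lp_norm_nonneg: "0 \<le> lp_norm K p w c"
  if "c \<in> lp K p w"
proof (cases "p = \<infinity>")
  case True
  then show ?thesis using that by (auto simp: lp_def lp_norm_def intro!: cSup_upper)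
next
  case False
  then show ?thesis by (simp add: lp_norm_def)
qed

lemma lp_supp: "c \<in> lp K p w \<Longrightarrow> k \<notin> K \<Longrightarrow> c k = 0"
  by (simp add: lp_def)

lemma lp_le_lp_norm:
  assumes c: "c \<in> lp K p w" and p: "1 \<le> p" and F: "finite F" "F \<subseteq> K"
  shows "lp_le p F (\<lambda>k. w k * cmod (c k)) (lp_norm K p w c)"
  using p
proof (cases rule: ennreal_ge1_cases)
  case 1
  then show ?thesis using c F by (auto simp: lp_le_def lp_def lp_norm_def intro!: cSup_upper)
next
  case 2
  have "(\<Sum>k\<in>F. (w k * cmod (c k)) powr enn2real p) \<le> (\<Sum>\<^sub>\<infinity>k\<in>K. (w k * cmod (c k)) powr enn2real p)"
    using 2 c F by (intro finite_sum_le_infsum) (auto simp: lp_def)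
  also have "\<dots> = lp_norm K p w c powr enn2real p"
    using 2 by (simp add: lp_norm_def powr_powr infsum_nonneg)
  finally show ?thesis using 2 by (simp add: lp_le_def)
qed

text \<open>Converse of \<open>lp_le_lp_norm\<close>: suprema and sums of nonnegative terms are
  determined by finite sections. For \<open>p = \<infinity>\<close> the \<open>0\<close> inserted
  into the supremum asks for \<open>0 <= C\<close>.\<close>

lemma lpI:
  assumes supp: "\<And>k. k \<notin> K \<Longrightarrow> c k = 0" and p: "1 \<le> p" and C: "0 \<le> C"
    and le: "\<And>F. finite F \<Longrightarrow> F \<subseteq> K \<Longrightarrow> lp_le p F (\<lambda>k. w k * cmod (c k)) C"
  shows "c \<in> lp K p w" "lp_norm K p w c \<le> C"
proof -
  have "c \<in> lp K p w \<and> lp_norm K p w c \<le> C"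
    using p
  proof (cases rule: ennreal_ge1_cases)
    case 1
    have "w k * cmod (c k) \<le> C" if "k \<in> K" for k using le[of "{k}"] that 1 by (simp add: lp_le_def)
    then show ?thesis using 1 supp C
      by (auto simp: lp_def lp_norm_def bdd_above_def intro!: cSup_least)
  next
    case 2
    have fin: "(\<Sum>k\<in>F. (w k * cmod (c k)) powr enn2real p) \<le> C powr enn2real p"
      if "finite F" "F \<subseteq> K" for F using le[OF that] 2 by (simp add: lp_le_def)
    have s: "(\<lambda>k. (w k * cmod (c k)) powr enn2real p) summable_on K"
      by (rule nonneg_bdd_above_summable_on) (use fin in \<open>auto simp: bdd_above_def\<close>)
    then have "(\<Sum>\<^sub>\<infinity>k\<in>K. (w k * cmod (c k)) powr enn2real p) \<le> C powr enn2real p"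
      by (intro infsum_le_finite_sums fin)
    then have "(\<Sum>\<^sub>\<infinity>k\<in>K. (w k * cmod (c k)) powr enn2real p) powr (1 / enn2real p)
        \<le> (C powr enn2real p) powr (1 / enn2real p)"
      using 2 by (intro powr_mono2 infsum_nonneg) auto
    also have "\<dots> = C" using 2 C by (simp add: powr_powr)
    finally show ?thesis using 2 supp s by (auto simp: lp_def lp_norm_def)
  qed
  then show "c \<in> lp K p w" "lp_norm K p w c \<le> C" by auto
qed

locale weighted =
  fixes K :: "'k set" and p :: ennreal and w :: "'k \<Rightarrow> real"
  assumes p: "1 \<le> p" and w: "\<And>k. k \<in> K \<Longrightarrow> 0 < w k"
begin

lemma wnn: "F \<subseteq> K \<Longrightarrow> k \<in> F \<Longrightarrow> 0 \<le> w k * cmod z"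
  using w by (meson less_imp_le mult_nonneg_nonneg norm_ge_zero subsetD)

lemma lp_solid:
  assumes c: "c \<in> lp K p w" and d: "\<And>k. cmod (d k) \<le> cmod (c k)"
  shows "d \<in> lp K p w" "lp_norm K p w d \<le> lp_norm K p w c"
proof -
  have supp: "d k = 0" if "k \<notin> K" for k using d[of k] lp_supp[OF c that] by simp
  have le: "lp_le p F (\<lambda>k. w k * cmod (d k)) (lp_norm K p w c)" if "finite F" "F \<subseteq> K" for F
  proof (rule lp_le_mono[OF lp_le_lp_norm[OF c p that] p])
    show "w k * cmod (d k) \<le> w k * cmod (c k)" if "k \<in> F" for k
      using that \<open>F \<subseteq> K\<close> by (intro mult_left_mono d less_imp_le[OF w]) auto
  qed (use wnn[OF that(2)] lp_norm_nonneg[OF c] in auto)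
  show "d \<in> lp K p w" "lp_norm K p w d \<le> lp_norm K p w c"
    using lpI[OF supp p lp_norm_nonneg[OF c] le] by blast+
qed

lemma lp_add:
  assumes c: "c \<in> lp K p w" and d: "d \<in> lp K p w"
  shows "(\<lambda>k. c k + d k) \<in> lp K p w"
    "lp_norm K p w (\<lambda>k. c k + d k) \<le> lp_norm K p w c + lp_norm K p w d"
proof -
  have le: "lp_le p F (\<lambda>k. w k * cmod (c k + d k)) (lp_norm K p w c + lp_norm K p w d)"
    if F: "finite F" "F \<subseteq> K" for F
  proof (rule lp_le_mono)
    show "lp_le p F (\<lambda>k. w k * cmod (c k) + w k * cmod (d k)) (lp_norm K p w c + lp_norm K p w d)"
      using F wnn[OF F(2)]
      by (intro lp_le_add lp_le_lp_norm c d p lp_norm_nonneg) auto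
    show "w k * cmod (c k + d k) \<le> w k * cmod (c k) + w k * cmod (d k)" if "k \<in> F" for k
      using w[of k] that F by (auto simp: norm_triangle_ineq simp flip: distrib_left)
  qed (use p wnn[OF F(2)] lp_norm_nonneg[OF c] lp_norm_nonneg[OF d] in auto)
  show "(\<lambda>k. c k + d k) \<in> lp K p w"
    "lp_norm K p w (\<lambda>k. c k + d k) \<le> lp_norm K p w c + lp_norm K p w d"
    using lpI[OF _ p _ le] lp_supp[OF c] lp_supp[OF d] lp_norm_nonneg[OF c] lp_norm_nonneg[OF d]
    by auto
qed

lemma lp_scale:
  assumes c: "c \<in> lp K p w"
  shows "(\<lambda>k. a * c k) \<in> lp K p w" "lp_norm K p w (\<lambda>k. a * c k) \<le> cmod a * lp_norm K p w c"
proof -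
  have le: "lp_le p F (\<lambda>k. w k * cmod (a * c k)) (cmod a * lp_norm K p w c)"
    if F: "finite F" "F \<subseteq> K" for F
    using lp_le_scale[OF lp_le_lp_norm[OF c p F] p wnn[OF F(2)] lp_norm_nonneg[OF c], of "cmod a"]
    by (simp add: norm_mult mult_ac)
  show "(\<lambda>k. a * c k) \<in> lp K p w" "lp_norm K p w (\<lambda>k. a * c k) \<le> cmod a * lp_norm K p w c"
    using lpI[OF _ p _ le] lp_supp[OF c] lp_norm_nonneg[OF c] by auto
qed

lemma lp_diff:
  assumes c: "c \<in> lp K p w" and d: "d \<in> lp K p w"
  shows "(\<lambda>k. c k - d k) \<in> lp K p w"
    "lp_norm K p w (\<lambda>k. c k - d k) \<le> lp_norm K p w c + lp_norm K p w d"
  using lp_add[OF c lp_scale(1)[OF d, of "-1"]] lp_scale(2)[OF d, of "-1"] by auto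

lemma lp_norm_diff_sym: "lp_norm K p w (\<lambda>k. d k - c k) = lp_norm K p w (\<lambda>k. c k - d k)"
  by (simp add: lp_norm_def norm_minus_commute)

lemma lp_norm_diff_ge:
  assumes c: "c \<in> lp K p w" and d: "d \<in> lp K p w"
  shows "\<bar>lp_norm K p w c - lp_norm K p w d\<bar> \<le> lp_norm K p w (\<lambda>k. c k - d k)"
  using lp_add(2)[OF d lp_diff(1)[OF c d]] lp_add(2)[OF c lp_diff(1)[OF d c]]
    lp_norm_diff_sym[of d c] by auto

lemma lp_coord:
  assumes c: "c \<in> lp K p w" and k: "k \<in> K"
  shows "w k * cmod (c k) \<le> lp_norm K p w c"
  using lp_le_coord[OF lp_le_lp_norm[OF c p, of "{k}"] p] k wnn[of "{k}"] lp_norm_nonneg[OF c]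
  by auto

lemma lp_zero [simp]: "(\<lambda>_. 0) \<in> lp K p w" "lp_norm K p w (\<lambda>_. 0) = 0"
proof -
  have "lp_le p F (\<lambda>k. w k * cmod 0) 0" for F using p by (auto simp: lp_le_def)
  from lpI[of K "\<lambda>_. 0", OF _ p _ this] show z: "(\<lambda>_. 0) \<in> lp K p w" and "lp_norm K p w (\<lambda>_. 0) = 0"
    using lp_norm_nonneg[of "\<lambda>_. 0" K p w] by auto
qed

text \<open>Norm bounds survive pointwise limits. Applied to differences, this turns Cauchy
  estimates into estimates against the limit.\<close>

lemma lp_limit:
  assumes lim: "\<And>k. k \<in> K \<Longrightarrow> ((\<lambda>i. c i k) \<longlongrightarrow> d k) I" and I: "I \<noteq> bot"
    and c: "eventually (\<lambda>i. c i \<in> lp K p w \<and> lp_norm K p w (c i) \<le> C) I"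
    and supp: "\<And>k. k \<notin> K \<Longrightarrow> d k = 0"
  shows "d \<in> lp K p w" "lp_norm K p w d \<le> C"
proof -
  obtain i where "c i \<in> lp K p w \<and> lp_norm K p w (c i) \<le> C"
    using eventually_happens'[OF I c] by blast
  then have C: "0 \<le> C" using lp_norm_nonneg[of "c i" K p w] by linarith
  have le: "lp_le p F (\<lambda>k. w k * cmod (d k)) C" if F: "finite F" "F \<subseteq> K" for F
  proof (rule lp_le_limit[OF _ I _ p F(1)])
    show "((\<lambda>i. w k * cmod (c i k)) \<longlongrightarrow> w k * cmod (d k)) I" if "k \<in> F" for k
      using that F by (intro tendsto_intros lim) auto
    show "eventually (\<lambda>i. lp_le p F (\<lambda>k. w k * cmod (c i k)) C) I"
      using c
    proof eventually_elim
      case (elim i)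
      then have "lp_le p F (\<lambda>k. w k * cmod (c i k)) (lp_norm K p w (c i))"
        by (intro lp_le_lp_norm p F) auto
      then show ?case
        by (rule lp_le_mono[OF _ p]) (use elim wnn[OF F(2)] in \<open>auto intro: lp_norm_nonneg\<close>)
    qed
  qed (use wnn[OF F(2)] in auto)
  show "d \<in> lp K p w" "lp_norm K p w d \<le> C" using lpI[of K d, OF supp p C le] by auto
qed

lemma lp_of_l1:
  assumes c: "c \<in> lp K 1 w"
  shows "c \<in> lp K p w" "lp_norm K p w c \<le> lp_norm K 1 w c"
proof -
  have "lp_le p F (\<lambda>k. w k * cmod (c k)) (lp_norm K 1 w c)" if F: "finite F" "F \<subseteq> K" for F
    using lp_le_of_l1[OF lp_le_lp_norm[OF c _ F] p F(1) wnn[OF F(2)] lp_norm_nonneg[OF c]] by simp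
  then show "c \<in> lp K p w" "lp_norm K p w c \<le> lp_norm K 1 w c"
    using lpI[of K c, OF lp_supp[OF c] p lp_norm_nonneg[OF c]] by auto
qed

lemma fin_seqs_lp: "fin_seqs K \<subseteq> lp K p w"
proof
  fix c assume "c \<in> fin_seqs K"
  then have fin: "finite {k. c k \<noteq> 0}" and sub: "{k. c k \<noteq> 0} \<subseteq> K" by (auto simp: fin_seqs_def)
  have "(\<lambda>k. w k * cmod (c k)) ` K \<subseteq> insert 0 ((\<lambda>k. w k * cmod (c k)) ` {k. c k \<noteq> 0})" by auto
  then have "finite ((\<lambda>k. w k * cmod (c k)) ` K)" using fin finite_subset by blast
  moreover have "(\<lambda>k. (w k * cmod (c k)) powr enn2real p) summable_on K"
    by (rule finite_nonzero_values_imp_summable_on) (auto intro: finite_subset[OF _ fin])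
  ultimately show "c \<in> lp K p w" using sub by (auto simp: lp_def)
qed

text \<open>For a finite exponent the norm is a convergent series, whose tails are small; for
  \<open>p = \<infinity>\<close> finite sections need not be dense.\<close>

lemma lp_section_tail:
  assumes c: "c \<in> lp K p w" and fin: "p \<noteq> \<infinity>" and e: "0 < e"
  obtains F0 where "finite F0" "F0 \<subseteq> K"
    "\<And>F. finite F \<Longrightarrow> F0 \<subseteq> F \<Longrightarrow> F \<subseteq> K \<Longrightarrow>
       lp_norm K p w (\<lambda>k. c k - (if k \<in> F then c k else 0)) \<le> e"
proof -
  define q where "q = enn2real p"
  define x where "x k = w k * cmod (c k)" for k
  have q: "1 \<le> q" using fin ennreal_ge1_cases[OF p] q_def by blast
  have s: "(\<lambda>k. x k powr q) summable_on K" using c fin by (simp add: lp_def x_def q_def)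
  obtain F0 where F0: "finite F0" "F0 \<subseteq> K" and ap: "dist (\<Sum>k\<in>F0. x k powr q) (\<Sum>\<^sub>\<infinity>k\<in>K. x k powr q) \<le> e powr q"
    using infsum_finite_approximation[OF s, of "e powr q"] e by auto
  have "lp_norm K p w (\<lambda>k. c k - (if k \<in> F then c k else 0)) \<le> e"
    if F: "finite F" "F0 \<subseteq> F" "F \<subseteq> K" for F
  proof (rule lpI(2)[OF _ p])
    fix E assume E: "finite E" "E \<subseteq> K"
    have "(\<Sum>k\<in>E. (w k * cmod (c k - (if k \<in> F then c k else 0))) powr q)
        = (\<Sum>k\<in>E - F. x k powr q)"
      using E by (intro sum.mono_neutral_cong_right) (auto simp: x_def)
    \<comment> \<open>As \<open>F\<close> contains \<open>F0\<close>, the set \<open>E - F\<close>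
      is disjoint from \<open>F0\<close>. Adjoining \<open>F0\<close> makes the tail a partial sum
      minus one that is already close to the total.\<close>
    also have "\<dots> = (\<Sum>k\<in>(E - F) \<union> F0. x k powr q) - (\<Sum>k\<in>F0. x k powr q)"
      using E F F0 by (subst sum.union_disjoint) auto
    also have "\<dots> \<le> (\<Sum>\<^sub>\<infinity>k\<in>K. x k powr q) - (\<Sum>k\<in>F0. x k powr q)"
      using E F F0 s by (intro diff_mono finite_sum_le_infsum) auto
    also have "\<dots> \<le> e powr q" using ap by (auto simp: dist_real_def)
    finally show "lp_le p E (\<lambda>k. w k * cmod (c k - (if k \<in> F then c k else 0))) e"
      using fin by (simp add: lp_le_def q_def)
  qed (use e lp_supp[OF c] in auto)
  with that F0 show ?thesis by blast
qed

end

text \<open>Jensen's inequality along the rows, with the entries as weights, contributes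
  \<open>D^(q-1)\<close>, and summation along the columns contributes one more factor
  \<open>D\<close>, so \<open>D\<close> bounds the norm for every exponent. The estimate is made on
  finite blocks, where sums may be swapped freely, and then passed to the limit.\<close>

lemma schur_test:
  fixes M :: "'k matrix"
  assumes D: "0 < D"
    and rows: "\<And>k F. k \<in> K \<Longrightarrow> finite F \<Longrightarrow> F \<subseteq> K \<Longrightarrow> (\<Sum>l\<in>F. cmod (M k l)) \<le> D"
    and cols: "\<And>l F. l \<in> K \<Longrightarrow> finite F \<Longrightarrow> F \<subseteq> K \<Longrightarrow> (\<Sum>k\<in>F. cmod (M k l)) \<le> D"
    and M: "M \<in> matrices K" and p: "1 \<le> p"
  shows "bounded_on_lp K p (\<lambda>_. 1) M"
proof -
  interpret weighted K p "\<lambda>_. 1" using p by unfold_locales auto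
  show ?thesis unfolding bounded_on_lp_def
  proof (intro exI[of _ D] ballI conjI)
    fix c assume c: "c \<in> lp K p (\<lambda>_. 1)"
    let ?n = "lp_norm K p (\<lambda>_. 1) c"
    have n0: "0 \<le> ?n" by (rule lp_norm_nonneg[OF c])
    have ck: "cmod (c k) \<le> ?n" if "k \<in> K" for k using lp_coord[OF c that] by simp
    have sM: "(\<lambda>l. cmod (M k l)) summable_on K" if "k \<in> K" for k
      by (rule nonneg_bdd_above_summable_on) (use rows[OF that] in \<open>auto simp: bdd_above_def\<close>)
    show sc: "(\<lambda>l. M k l * c l) summable_on K" if "k \<in> K" for k
    proof (rule abs_summable_summable, rule summable_on_comparison_test)
      show "(\<lambda>l. ?n * cmod (M k l)) summable_on K"
        by (rule summable_on_cmult_right[OF sM[OF that]])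
      show "norm (M k l * c l) \<le> ?n * cmod (M k l)" if "l \<in> K" for l
        using ck[OF that] by (simp add: norm_mult mult.commute[of _ "cmod (M k l)"] mult_left_mono)
    qed auto
    have part: "lp_le p F (\<lambda>k. 1 * cmod (\<Sum>l\<in>E. M k l * c l)) (D * ?n)"
      if F: "finite F" "F \<subseteq> K" and E: "finite E" "E \<subseteq> K" for E F
    proof (rule lp_le_mono[OF _ p])
      show "1 * cmod (\<Sum>l\<in>E. M k l * c l) \<le> (\<Sum>l\<in>E. cmod (M k l) * cmod (c l))" for k
        using norm_sum[of "\<lambda>l. M k l * c l" E] by (simp add: norm_mult)
      show "lp_le p F (\<lambda>k. \<Sum>l\<in>E. cmod (M k l) * cmod (c l)) (D * ?n)"
        using p
      proof (cases rule: ennreal_ge1_cases)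
        case 1
        have "(\<Sum>l\<in>E. cmod (M k l) * cmod (c l)) \<le> D * ?n" if "k \<in> F" for k
        proof -
          have "(\<Sum>l\<in>E. cmod (M k l) * cmod (c l)) \<le> (\<Sum>l\<in>E. cmod (M k l) * ?n)"
            using ck E by (intro sum_mono mult_left_mono) auto
          also have "\<dots> \<le> D * ?n"
            using rows[OF _ E, of k] that F n0 by (auto simp: mult_right_mono simp flip: sum_distrib_right)
          finally show ?thesis .
        qed
        then show ?thesis using 1 by (simp add: lp_le_def)
      next
        case 2
        define q where "q = enn2real p"
        have q: "1 \<le> q" using 2 by (simp add: q_def)
        have "(\<Sum>k\<in>F. (\<Sum>l\<in>E. cmod (M k l) * cmod (c l)) powr q)
            \<le> (\<Sum>k\<in>F. D powr (q - 1) * (\<Sum>l\<in>E. cmod (M k l) * cmod (c l) powr q))"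
          using F E rows q by (intro sum_mono powr_weighted_sum_le) auto
        also have "\<dots> = D powr (q - 1) * (\<Sum>l\<in>E. (\<Sum>k\<in>F. cmod (M k l)) * cmod (c l) powr q)"
          by (simp add: sum_distrib_left[symmetric] sum_distrib_right sum.swap[of _ F E])
        also have "\<dots> \<le> D powr (q - 1) * (\<Sum>l\<in>E. D * cmod (c l) powr q)"
          using F E cols by (intro mult_left_mono sum_mono mult_right_mono) auto
        also have "\<dots> = D powr q * (\<Sum>l\<in>E. cmod (c l) powr q)"
          using D by (simp add: powr_diff sum_distrib_left[symmetric])
        also have "\<dots> \<le> D powr q * ?n powr q"
          using lp_le_lp_norm[OF c p E] 2 by (intro mult_left_mono) (auto simp: lp_le_def q_def)
        finally show ?thesis using 2 D n0 by (simp add: lp_le_def q_def powr_mult)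
      qed
    qed (use D n0 in auto)
    have supp: "mat_vec K M c k = 0" if "k \<notin> K" for k
      using M that by (simp add: mat_vec_def matrices_def)
    have le: "lp_le p F (\<lambda>k. 1 * cmod (mat_vec K M c k)) (D * ?n)"
      if F: "finite F" "F \<subseteq> K" for F
    proof (rule lp_le_limit[OF _ finite_subsets_at_top_neq_bot _ p F(1)])
      show "((\<lambda>E. 1 * cmod (\<Sum>l\<in>E. M k l * c l)) \<longlongrightarrow> 1 * cmod (mat_vec K M c k)) (finite_subsets_at_top K)"
        if "k \<in> F" for k
        using infsum_tendsto[OF sc[of k]] that F unfolding mat_vec_def by (intro tendsto_intros) auto
      show "\<forall>\<^sub>F E in finite_subsets_at_top K. lp_le p F (\<lambda>k. 1 * cmod (\<Sum>l\<in>E. M k l * c l)) (D * ?n)"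
        using part[OF F] by (auto simp: eventually_finite_subsets_at_top intro!: exI[of _ "{}"])
    qed auto
    show "mat_vec K M c \<in> lp K p (\<lambda>_. 1)" "lp_norm K p (\<lambda>_. 1) (mat_vec K M c) \<le> D * ?n"
      using lpI[OF supp p _ le] D n0 by auto
  qed
qed

section \<open>Bessel sequences and frames\<close>

lemma cinner_add_right: "cinner x (y + z) = cinner x y + cinner x z"
  for x y z :: "'h::complex_hilbert"
  by (metis cinner_add_left cinner_commute complex_cnj_add)

lemma cinner_cscale_right: "cinner x (cscale a y) = cnj a * cinner x y"
  for x y :: "'h::complex_hilbert"
  by (metis cinner_commute cinner_cscale_left complex_cnj_mult)

lemma cscale_one [simp]: "cscale 1 x = x" for x :: "'h::complex_hilbert"
  using cscale_of_real[of 1 x] by simp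

lemma cscale_zero_left [simp]: "cscale 0 x = 0" for x :: "'h::complex_hilbert"
  using cscale_of_real[of 0 x] by simp

lemma cscale_zero_right [simp]: "cscale a 0 = 0" for a :: complex
  using cscale_add_right[of a 0 0] by simp

lemma cinner_zero_left [simp]: "cinner 0 x = 0" for x :: "'h::complex_hilbert"
  using cinner_add_left[of 0 0 x] by simp

lemma cinner_zero_right [simp]: "cinner x 0 = 0" for x :: "'h::complex_hilbert"
  using cinner_add_right[of x 0 0] by simp

lemma cscale_minus_one: "cscale (-1) x = - x" for x :: "'h::complex_hilbert"
  using cscale_of_real[of "-1" x] by simp

lemma cinner_minus_left: "cinner (- x) y = - cinner x y" for x y :: "'h::complex_hilbert"
  using cinner_cscale_left[of "-1" x y] by (simp add: cscale_minus_one)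

lemma cinner_diff_left: "cinner (x - y) z = cinner x z - cinner y z" for x y z :: "'h::complex_hilbert"
  using cinner_add_left[of x "- y" z] by (simp add: cinner_minus_left)

lemma cinner_diff_right: "cinner x (y - z) = cinner x y - cinner x z" for x y z :: "'h::complex_hilbert"
  by (metis cinner_diff_left cinner_commute complex_cnj_diff)

lemma cscale_diff_right: "cscale a (x - y) = cscale a x - cscale a y" for x y :: "'h::complex_hilbert"
  using cscale_add_right[of a "x - y" y] by (simp add: algebra_simps)

lemma cinner_self: "cinner x x = complex_of_real ((norm x)\<^sup>2)" for x :: "'h::complex_hilbert"
proof -
  have "Im (cinner x x) = 0" using cinner_commute[of x x] by (metis Reals_cnj_iff complex_is_Real_iff)
  moreover have "0 \<le> Re (cinner x x)"
    using norm_eq_sqrt_cinner[of x] by (metis norm_ge_zero real_sqrt_ge_0_iff)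
  ultimately show ?thesis by (simp add: norm_eq_sqrt_cinner complex_eq_iff)
qed

lemma cinner_scaleR_left: "cinner (r *\<^sub>R x) y = r *\<^sub>R cinner x y" for x y :: "'h::complex_hilbert"
  by (metis cinner_cscale_left cscale_of_real scaleR_conv_of_real)

lemma cinner_scaleR_right: "cinner x (r *\<^sub>R y) = r *\<^sub>R cinner x y" for x y :: "'h::complex_hilbert"
  by (metis cinner_cscale_right cscale_of_real scaleR_conv_of_real complex_cnj_complex_of_real)

lemma cinner_sum_left: "cinner (\<Sum>i\<in>F. f i) y = (\<Sum>i\<in>F. cinner (f i) y)"
  for y :: "'h::complex_hilbert"
  by (induction F rule: infinite_finite_induct) (auto simp: cinner_add_left)

lemma norm_cscale: "norm (cscale a x) = cmod a * norm x" for x :: "'h::complex_hilbert"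
proof -
  have "complex_of_real ((norm (cscale a x))\<^sup>2) = (a * cnj a) * complex_of_real ((norm x)\<^sup>2)"
    unfolding cinner_self[symmetric] cinner_cscale_left cinner_cscale_right by simp
  also have "\<dots> = complex_of_real ((cmod a * norm x)\<^sup>2)"
    by (simp only: complex_norm_square[symmetric] of_real_mult[symmetric] power_mult_distrib)
  finally have "complex_of_real ((norm (cscale a x))\<^sup>2) = complex_of_real ((cmod a * norm x)\<^sup>2)" .
  then have "(norm (cscale a x))\<^sup>2 = (cmod a * norm x)\<^sup>2" using of_real_eq_iff by blast
  then show ?thesis by (rule power2_eq_imp_eq) auto
qed

lemma cmod_cinner_le: "cmod (cinner x y) \<le> norm x * norm y" for x y :: "'h::complex_hilbert"
proof (cases "y = 0")
  case False
  \<comment> \<open>\<open>cscale a y\<close> is the orthogonal projection of \<open>x\<close> on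
    the line through \<open>y\<close>; the Cauchy-Schwarz inequality says that the squared residual
    is nonnegative.\<close>
  define a where "a = cinner x y / (norm y)\<^sup>2"
  have ny: "(norm y)\<^sup>2 > 0" using False by simp
  have "complex_of_real ((norm (x - cscale a y))\<^sup>2) =
      cinner x x - cnj a * cinner x y - a * cnj (cinner x y) + a * cnj a * cinner y y"
    unfolding cinner_self[symmetric, of "x - cscale a y"]
    by (simp add: cinner_diff_left cinner_diff_right cinner_cscale_left cinner_cscale_right
        cinner_commute[of y x] algebra_simps)
  also have "\<dots> = complex_of_real ((norm x)\<^sup>2 - (cmod (cinner x y))\<^sup>2 / (norm y)\<^sup>2)"
  proof -
    have "cinner x y * cnj (cinner x y) = complex_of_real ((cmod (cinner x y))\<^sup>2)"
      by (simp only: complex_norm_square)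
    then show ?thesis using ny by (simp add: a_def cinner_self field_simps power2_eq_square)
  qed
  finally have "(norm (x - cscale a y))\<^sup>2 = (norm x)\<^sup>2 - (cmod (cinner x y))\<^sup>2 / (norm y)\<^sup>2"
    using of_real_eq_iff by blast
  then have "0 \<le> (norm x)\<^sup>2 - (cmod (cinner x y))\<^sup>2 / (norm y)\<^sup>2" by (metis zero_le_power2)
  then have "(cmod (cinner x y))\<^sup>2 \<le> (norm x * norm y)\<^sup>2"
    using ny by (simp add: field_simps power_mult_distrib)
  then show ?thesis by (rule power2_le_imp_le) simp
qed simp

lemma bounded_linear_cinner_left: "bounded_linear (\<lambda>x. cinner x (y::'h::complex_hilbert))"
  by (rule bounded_linear_intro[of _ "norm y"])
    (auto simp: cinner_add_left cinner_scaleR_left cmod_cinner_le)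

text \<open>Banach's fixed point theorem for \<open>x \<mapsto> b + u x\<close>; it takes the place
  of a Neumann series.\<close>

lemma contraction_solve:
  fixes u :: "'h::complex_hilbert \<Rightarrow> 'h"
  assumes add: "\<And>x y. u (x - y) = u x - u y" and r: "0 \<le> r" "r < 1"
    and le: "\<And>x. norm (u x) \<le> r * norm x"
  obtains x where "x - u x = b" "norm x \<le> norm b / (1 - r)"
proof -
  have "\<exists>!x. b + u x = x"
    by (rule banach_fix_type[OF r])
      (use le add in \<open>auto simp: dist_norm simp flip: add\<close>)
  then obtain x where x: "b + u x = x" by blast
  have "norm x \<le> norm b + r * norm x" using le[of x] x norm_triangle_ineq[of b "u x"] by simp
  then have "norm x \<le> norm b / (1 - r)" using r by (simp add: field_simps)
  with that x show ?thesis by (metis add_diff_cancel_right')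
qed

section \<open>The space ell^2 and Bessel sequences\<close>

abbreviation ell2 :: "'k set \<Rightarrow> ('k \<Rightarrow> complex) set" where
  "ell2 K \<equiv> lp K 2 (\<lambda>_. 1)"

lemma ell2_iff: "c \<in> ell2 K \<longleftrightarrow> (\<forall>k. k \<notin> K \<longrightarrow> c k = 0) \<and> (\<lambda>k. (cmod (c k))\<^sup>2) summable_on K"
proof -
  have "(\<lambda>k. (1 * cmod (c k)) powr enn2real 2) = (\<lambda>k. (cmod (c k))\<^sup>2)"
    by (auto simp: powr_numeral fun_eq_iff)
  then show ?thesis by (auto simp: lp_def)
qed

lemma ell2_add: "c \<in> ell2 K \<Longrightarrow> d \<in> ell2 K \<Longrightarrow> (\<lambda>k. c k + d k) \<in> ell2 K"
  and ell2_diff: "c \<in> ell2 K \<Longrightarrow> d \<in> ell2 K \<Longrightarrow> (\<lambda>k. c k - d k) \<in> ell2 K"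
  and ell2_scale: "c \<in> ell2 K \<Longrightarrow> (\<lambda>k. a * c k) \<in> ell2 K"
proof -
  have "1 \<le> (2::ennreal)" using one_le_numeral by blast
  then interpret weighted K 2 "\<lambda>_. 1" by unfold_locales auto
  show "c \<in> ell2 K \<Longrightarrow> d \<in> ell2 K \<Longrightarrow> (\<lambda>k. c k + d k) \<in> ell2 K"
    "c \<in> ell2 K \<Longrightarrow> d \<in> ell2 K \<Longrightarrow> (\<lambda>k. c k - d k) \<in> ell2 K"
    "c \<in> ell2 K \<Longrightarrow> (\<lambda>k. a * c k) \<in> ell2 K"
    using lp_add(1) lp_diff(1) lp_scale(1) by blast+
qed

lemma fin_seqs_ell2: "c \<in> fin_seqs K \<Longrightarrow> c \<in> ell2 K"
proof -
  have "1 \<le> (2::ennreal)" using one_le_numeral by blast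
  then interpret weighted K 2 "\<lambda>_. 1" by unfold_locales auto
  show "c \<in> fin_seqs K \<Longrightarrow> c \<in> ell2 K" using fin_seqs_lp by blast
qed

lemma bounded_linear_cscale: "bounded_linear (\<lambda>x::'h::complex_hilbert. cscale a x)"
proof (rule bounded_linear_intro[of _ "cmod a"])
  show "cscale a (r *\<^sub>R x) = r *\<^sub>R cscale a x" for r and x :: 'h
    by (metis cscale_of_real cscale_cscale mult.commute)
qed (auto simp: cscale_add_right norm_cscale)

locale bessel =
  fixes K :: "'k set" and \<psi> :: "'k \<Rightarrow> 'h::complex_hilbert" and B :: real
  assumes B: "0 < B"
    and bes_sum: "\<And>f. (\<lambda>k. (cmod (cinner f (\<psi> k)))\<^sup>2) summable_on K"
    and bes_le: "\<And>f. (\<Sum>\<^sub>\<infinity>k\<in>K. (cmod (cinner f (\<psi> k)))\<^sup>2) \<le> B * (norm f)\<^sup>2"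
begin

abbreviation "\<C> \<equiv> analysis K \<psi>"
abbreviation "\<D> \<equiv> synthesis K \<psi>"

lemma analysis_ell2: "\<C> f \<in> ell2 K"
  using bes_sum[of f] by (auto simp: ell2_iff analysis_def cong: summable_on_cong)

text \<open>With \<open>h\<close> the finite sum itself, \<open>(norm h)^2\<close> is the pairing of
  \<open>c\<close> with the coefficients of \<open>h\<close>. The Cauchy-Schwarz inequality and the
  Bessel bound leave a factor \<open>norm h\<close> on the right, which cancels.\<close>

lemma norm_fin_synth_le:
  assumes F: "finite F" "F \<subseteq> K"
  shows "(norm (\<Sum>k\<in>F. cscale (c k) (\<psi> k)))\<^sup>2 \<le> B * (\<Sum>k\<in>F. (cmod (c k))\<^sup>2)"
proof -
  define h where "h = (\<Sum>k\<in>F. cscale (c k) (\<psi> k))"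
  have "complex_of_real ((norm h)\<^sup>2) = (\<Sum>k\<in>F. c k * cinner (\<psi> k) h)"
    unfolding cinner_self[symmetric] by (subst (1) h_def) (simp add: cinner_sum_left cinner_cscale_left)
  then have "(norm h)\<^sup>2 \<le> (\<Sum>k\<in>F. cmod (c k) * cmod (cinner h (\<psi> k)))"
    by (metis (no_types, lifting) norm_of_real abs_of_nonneg zero_le_power2 norm_sum norm_mult
        cinner_commute complex_mod_cnj sum.cong)
  also have "\<dots> \<le> L2_set (\<lambda>k. cmod (c k)) F * L2_set (\<lambda>k. cmod (cinner h (\<psi> k))) F"
    using L2_set_mult_ineq[of "\<lambda>k. cmod (c k)" "\<lambda>k. cmod (cinner h (\<psi> k))" F] by simp
  also have "L2_set (\<lambda>k. cmod (cinner h (\<psi> k))) F \<le> sqrt (B * (norm h)\<^sup>2)"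
    unfolding L2_set_def
    using finite_sum_le_infsum[OF bes_sum[of h] F] bes_le[of h] by (intro real_sqrt_le_mono) auto
  finally have "(norm h)\<^sup>2 \<le> L2_set (\<lambda>k. cmod (c k)) F * (sqrt B * norm h)"
    by (simp add: L2_set_nonneg mult_left_mono real_sqrt_mult)
  then have "norm h \<le> L2_set (\<lambda>k. cmod (c k)) F * sqrt B"
    using B by (cases "h = 0") (auto simp: power2_eq_square L2_set_nonneg)
  then have "(norm h)\<^sup>2 \<le> (L2_set (\<lambda>k. cmod (c k)) F * sqrt B)\<^sup>2" by (intro power_mono) auto
  also have "\<dots> = B * (\<Sum>k\<in>F. (cmod (c k))\<^sup>2)"
    using B by (simp add: power_mult_distrib L2_set_def sum_nonneg)
  finally show ?thesis by (simp add: h_def)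
qed

text \<open>The partial sums form a Cauchy net, because \<open>norm_fin_synth_le\<close> bounds each
  block by a tail of the square sum.\<close>

lemma synth_summable:
  assumes c: "c \<in> ell2 K"
  shows "(\<lambda>k. cscale (c k) (\<psi> k)) summable_on K"
proof -
  have s: "(\<lambda>k. (cmod (c k))\<^sup>2) summable_on K" using c by (simp add: ell2_iff)
  let ?S = "\<lambda>F. \<Sum>k\<in>F. cscale (c k) (\<psi> k)"
  have "\<exists>P. eventually P (finite_subsets_at_top K) \<and> (\<forall>F F'. P F \<and> P F' \<longrightarrow> dist (?S F) (?S F') < e)"
    if e: "e > 0" for e
  proof -
    \<comment> \<open>Then \<open>B * d = e^2 / 8\<close> lies below
      \<open>(e / 2)^2\<close>.\<close>
    define d where "d = e\<^sup>2 / (8 * B)"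
    have d: "d > 0" using e B by (simp add: d_def)
    obtain F0 where F0: "finite F0" "F0 \<subseteq> K"
      and ap: "dist (\<Sum>k\<in>F0. (cmod (c k))\<^sup>2) (\<Sum>\<^sub>\<infinity>k\<in>K. (cmod (c k))\<^sup>2) \<le> d"
      using infsum_finite_approximation[OF s d] by blast
    define P where "P F \<longleftrightarrow> finite F \<and> F0 \<subseteq> F \<and> F \<subseteq> K" for F
    have "norm (?S F - ?S F0) < e / 2" if "P F" for F
    proof -
      have F: "finite F" "F0 \<subseteq> F" "F \<subseteq> K" using that by (auto simp: P_def)
      have eq: "?S F - ?S F0 = ?S (F - F0)" using F by (simp add: sum_diff)
      have "(norm (?S (F - F0)))\<^sup>2 \<le> B * (\<Sum>k\<in>F - F0. (cmod (c k))\<^sup>2)"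
        using F by (intro norm_fin_synth_le) auto
      also have "\<dots> \<le> B * d"
      proof (rule mult_left_mono)
        show "(\<Sum>k\<in>F - F0. (cmod (c k))\<^sup>2) \<le> d"
          using finite_sum_le_infsum[OF s F(1,3)] F ap by (simp add: sum_diff dist_real_def)
      qed (use B in simp)
      also have "\<dots> < (e / 2)\<^sup>2" using B e by (simp add: d_def power2_eq_square)
      finally show ?thesis unfolding eq by (rule power2_less_imp_less) (use e in simp)
    qed
    note half = this
    have "dist (?S F) (?S F') < e" if "P F" "P F'" for F F'
      by (rule dist_triangle_half_l[of _ "?S F0"]) (use half that in \<open>simp_all add: dist_norm\<close>)
    moreover have "eventually P (finite_subsets_at_top K)"
      unfolding eventually_finite_subsets_at_top P_def using F0 by blast
    ultimately show ?thesis by blast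
  qed
  then have "cauchy_filter (filtermap ?S (finite_subsets_at_top K))"
    unfolding cauchy_filter_metric_filtermap by blast
  moreover have "complete (UNIV :: 'h set)"
    by (meson Cauchy_convergent UNIV_I complete_def convergent_def)
  ultimately obtain L where "(?S \<longlongrightarrow> L) (finite_subsets_at_top K)"
    using complete_uniform[where S = UNIV] by (force simp add: filterlim_def)
  then show ?thesis unfolding summable_on_def has_sum_def by blast
qed

lemma synth_has_sum: "c \<in> ell2 K \<Longrightarrow> ((\<lambda>k. cscale (c k) (\<psi> k)) has_sum \<D> c) K"
  using synth_summable[of c] by (simp add: synthesis_def)

lemma synth_add: "c \<in> ell2 K \<Longrightarrow> d \<in> ell2 K \<Longrightarrow> \<D> (\<lambda>k. c k + d k) = \<D> c + \<D> d"
  by (rule has_sum_unique[OF synth_has_sum[OF ell2_add]])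
    (use has_sum_add[OF synth_has_sum synth_has_sum] in \<open>auto simp: cscale_add_left\<close>)

lemma synth_scale: "c \<in> ell2 K \<Longrightarrow> \<D> (\<lambda>k. a * c k) = cscale a (\<D> c)"
  by (rule has_sum_unique[OF synth_has_sum[OF ell2_scale]])
    (use has_sum_bounded_linear[OF bounded_linear_cscale synth_has_sum] in \<open>auto simp: cscale_cscale o_def\<close>)

lemma synth_diff: "c \<in> ell2 K \<Longrightarrow> d \<in> ell2 K \<Longrightarrow> \<D> (\<lambda>k. c k - d k) = \<D> c - \<D> d"
  using synth_add[OF _ ell2_scale[of d K "-1"], of c] synth_scale[of d "-1"]
  by (simp add: cscale_minus_one)

lemma cinner_synth:
  assumes "c \<in> ell2 K"
  shows "((\<lambda>k. c k * cinner (\<psi> k) h) has_sum cinner (\<D> c) h) K"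
  using has_sum_bounded_linear[OF bounded_linear_cinner_left synth_has_sum[OF assms], of h]
  by (simp add: o_def cinner_cscale_left)

lemma synth_fin:
  assumes "c \<in> fin_seqs K"
  shows "\<D> c = (\<Sum>k | c k \<noteq> 0. cscale (c k) (\<psi> k))"
proof -
  have "\<D> c = (\<Sum>\<^sub>\<infinity>k | c k \<noteq> 0. cscale (c k) (\<psi> k))"
    unfolding synthesis_def using assms by (intro infsum_cong_neutral) (auto simp: fin_seqs_def)
  then show ?thesis using assms by (simp add: fin_seqs_def)
qed

end

lemma analysis_diff: "analysis K \<psi> (f - g) = (\<lambda>k. analysis K \<psi> f k - analysis K \<psi> g k)"
  by (auto simp: analysis_def cinner_diff_left)

lemma analysis_add: "analysis K \<psi> (f + g) = (\<lambda>k. analysis K \<psi> f k + analysis K \<psi> g k)"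
  by (auto simp: analysis_def cinner_add_left)

lemma analysis_cscale: "analysis K \<psi> (cscale a f) = (\<lambda>k. a * analysis K \<psi> f k)"
  by (auto simp: analysis_def cinner_cscale_left)

section \<open>The frame operator and the canonical dual frame\<close>

locale frame = bessel K \<psi> B for K :: "'k set" and \<psi> :: "'k \<Rightarrow> 'h::complex_hilbert" and B :: real +
  fixes A :: real
  assumes A: "0 < A"
    and low: "\<And>f. A * (norm f)\<^sup>2 \<le> (\<Sum>\<^sub>\<infinity>k\<in>K. (cmod (cinner f (\<psi> k)))\<^sup>2)"
begin

abbreviation "\<S> \<equiv> frame_op K \<psi>"

lemma S_def: "\<S> f = \<D> (\<C> f)"
  by (simp add: frame_op_def)

lemma S_diff: "\<S> (f - g) = \<S> f - \<S> g"
  by (simp add: S_def analysis_diff synth_diff analysis_ell2)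

lemma S_cscale: "\<S> (cscale a f) = cscale a (\<S> f)"
  by (simp add: S_def analysis_cscale synth_scale analysis_ell2)

lemma S_has_sum: "((\<lambda>k. cinner f (\<psi> k) * cinner (\<psi> k) g) has_sum cinner (\<S> f) g) K"
  unfolding S_def using cinner_synth[OF analysis_ell2[of f], of g]
  by (simp add: analysis_def cong: has_sum_cong)

lemma S_adj: "cinner (\<S> f) g = cinner f (\<S> g)"
proof -
  have "((\<lambda>k. cnj (cinner g (\<psi> k) * cinner (\<psi> k) f)) has_sum cnj (cinner (\<S> g) f)) K"
    using S_has_sum[of g f] by (subst has_sum_cnj_iff)
  moreover have "cnj (cinner g (\<psi> k) * cinner (\<psi> k) f) = cinner f (\<psi> k) * cinner (\<psi> k) g" for k
    by (metis cinner_commute complex_cnj_mult mult.commute)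
  ultimately have "cnj (cinner (\<S> g) f) = cinner (\<S> f) g"
    using has_sum_unique[OF S_has_sum[of f g]] by simp
  then show ?thesis by (metis cinner_commute)
qed

lemma S_pos: "Re (cinner (\<S> f) f) = (\<Sum>\<^sub>\<infinity>k\<in>K. (cmod (cinner f (\<psi> k)))\<^sup>2)"
proof -
  have "((\<lambda>k. Re (cinner f (\<psi> k) * cinner (\<psi> k) f)) has_sum Re (cinner (\<S> f) f)) K"
    by (rule has_sum_Re[OF S_has_sum])
  moreover have "Re (cinner f (\<psi> k) * cinner (\<psi> k) f) = (cmod (cinner f (\<psi> k)))\<^sup>2" for k
    using complex_norm_square[of "cinner f (\<psi> k)"] cinner_commute[of "\<psi> k" f]
    by (metis Re_complex_of_real of_real_power)
  ultimately show ?thesis using infsumI by force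
qed

text \<open>Its quadratic form lies between \<open>0\<close> and \<open>\<rho>\<close> times the
  squared norm, so that \<open>S = B (1 - V)\<close> is a multiple of a contractive perturbation of
  the identity.\<close>

definition V :: "'h \<Rightarrow> 'h" where "V f = f - cscale (complex_of_real (1 / B)) (\<S> f)"

text \<open>If the Hilbert space is trivial, nothing forces \<open>A <= B\<close>; the maximum keeps
  the contraction factor nonnegative.\<close>

definition \<rho> :: real where "\<rho> = max 0 (1 - A / B)"

lemma \<rho>: "0 \<le> \<rho>" "\<rho> < 1"
  using A B by (auto simp: \<rho>_def)

lemma V_diff: "V (f - g) = V f - V g"
  by (simp add: V_def S_diff cscale_diff_right)

lemma V_form: "0 \<le> Re (cinner (V f) f)" "Re (cinner (V f) f) \<le> \<rho> * (norm f)\<^sup>2"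
proof -
  have eq: "Re (cinner (V f) f) = (norm f)\<^sup>2 - (\<Sum>\<^sub>\<infinity>k\<in>K. (cmod (cinner f (\<psi> k)))\<^sup>2) / B"
    by (simp add: V_def cinner_diff_left cinner_cscale_left cinner_self S_pos[symmetric]
        flip: of_real_power of_real_inverse)
  show "0 \<le> Re (cinner (V f) f)" using bes_le[of f] B by (simp add: eq field_simps)
  have "Re (cinner (V f) f) \<le> (1 - A / B) * (norm f)\<^sup>2"
    using low[of f] B by (simp add: eq field_simps)
  also have "\<dots> \<le> \<rho> * (norm f)\<^sup>2" by (intro mult_right_mono) (auto simp: \<rho>_def)
  finally show "Re (cinner (V f) f) \<le> \<rho> * (norm f)\<^sup>2" .
qed

lemma V_adj: "cinner (V f) g = cinner f (V g)"
  by (simp add: V_def cinner_diff_left cinner_diff_right cinner_cscale_left cinner_cscale_right S_adj)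

text \<open>Cauchy's inequality for the semi-inner product \<open>(f, g) \<mapsto> (V f, g)\<close>, applied to \<open>f\<close> and \<open>V f\<close>.\<close>

lemma V_norm: "norm (V f) \<le> \<rho> * norm f"
proof -
  define a where "a = (norm (V f))\<^sup>2"
  define q where "q x = Re (cinner (V x) x)" for x
  have ex: "q (f - r *\<^sub>R V f) = q f - 2 * r * a + r\<^sup>2 * q (V f)" for r
  proof -
    have "V (f - r *\<^sub>R V f) = V f - r *\<^sub>R V (V f)"
    proof -
      have "V (cscale (complex_of_real r) g) = cscale (complex_of_real r) (V g)" for g
        by (simp add: V_def S_cscale cscale_diff_right cscale_cscale mult.commute)
      then show ?thesis by (simp add: V_diff cscale_of_real)
    qed
    then have "q (f - r *\<^sub>R V f) = Re (cinner (V f) f) - r * Re (cinner (V f) (V f))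
        - r * Re (cinner (V (V f)) f) + r\<^sup>2 * Re (cinner (V (V f)) (V f))"
      unfolding q_def by (simp add: cinner_diff_left cinner_diff_right cinner_scaleR_left
          cinner_scaleR_right power2_eq_square right_diff_distrib)
    moreover have "cinner (V (V f)) f = cinner (V f) (V f)" by (simp add: V_adj)
    ultimately show ?thesis by (simp add: q_def a_def cinner_self flip: of_real_power)
  qed
  have le: "2 * r * a \<le> \<rho> * (norm f)\<^sup>2 + r\<^sup>2 * (\<rho> * a)" for r
  proof -
    have "0 \<le> q f - 2 * r * a + r\<^sup>2 * q (V f)" using V_form(1) ex unfolding q_def by metis
    moreover have "q f \<le> \<rho> * (norm f)\<^sup>2" "q (V f) \<le> \<rho> * a" using V_form(2) by (auto simp: q_def a_def)
    moreover have "r\<^sup>2 * q (V f) \<le> r\<^sup>2 * (\<rho> * a)" using calculation(3) by (intro mult_left_mono) auto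
    ultimately show ?thesis by linarith
  qed
  show ?thesis
  proof (cases "\<rho> = 0")
    case True
    then show ?thesis using le[of 1] by (simp add: a_def)
  next
    case False
    then have r0: "\<rho> > 0" using \<rho> by simp
    \<comment> \<open>\<open>r = 1 / \<rho>\<close> is the minimizer of the quadratic polynomial in
      \<open>r\<close> behind \<open>le\<close>.\<close>
    then have "a \<le> \<rho>\<^sup>2 * (norm f)\<^sup>2" using le[of "1 / \<rho>"] by (simp add: field_simps power2_eq_square)
    then have "(norm (V f))\<^sup>2 \<le> (\<rho> * norm f)\<^sup>2" by (simp add: a_def power_mult_distrib)
    then show ?thesis by (rule power2_le_imp_le) (use r0 in simp)
  qed
qed

lemma S_V: "\<S> f = cscale (complex_of_real B) (f - V f)"
  using B by (simp add: V_def cscale_cscale)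

lemma S_inj: "\<S> f = \<S> g \<Longrightarrow> f = g"
proof -
  assume "\<S> f = \<S> g"
  then have "\<S> (f - g) = 0" by (simp add: S_diff)
  then have "A * (norm (f - g))\<^sup>2 \<le> 0" using low[of "f - g"] S_pos[of "f - g"] by simp
  then show "f = g" using A by (auto simp: mult_le_0_iff)
qed

lemma S_surj: "\<exists>f. \<S> f = g"
proof -
  obtain x where "x - V x = cscale (complex_of_real (1 / B)) g"
    using contraction_solve[of V \<rho>] V_diff \<rho> V_norm by metis
  then have "\<S> x = g" using B by (simp add: S_V cscale_cscale)
  then show ?thesis by blast
qed

abbreviation "\<S>i \<equiv> inv \<S>"

lemma S_Si [simp]: "\<S> (\<S>i f) = f"
  using S_surj by (metis surj_def surj_f_inv_f)

lemma Si_S [simp]: "\<S>i (\<S> f) = f"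
  using S_inj by (metis injI inv_f_f)

lemma Si_adj: "cinner (\<S>i f) g = cinner f (\<S>i g)"
  by (metis S_Si S_adj)

lemma Si_diff: "\<S>i (f - g) = \<S>i f - \<S>i g"
  by (metis S_Si Si_S S_diff)

lemma Si_zero: "\<S>i 0 = 0"
  using Si_diff[of 0 0] by simp

abbreviation "\<psi>d \<equiv> dual_frame K \<psi>"

lemma cinner_dual: "cinner f (\<psi>d k) = cinner (\<S>i f) (\<psi> k)"
  by (simp add: dual_frame_def Si_adj)

lemma analysis_dual: "analysis K \<psi>d f = \<C> (\<S>i f)"
  by (auto simp: analysis_def cinner_dual)

lemma analysis_dual_ell2: "analysis K \<psi>d f \<in> ell2 K"
  by (simp add: analysis_dual analysis_ell2)

lemma dual_recon: "((\<lambda>j. cinner f (\<psi>d j) * cinner (\<psi> j) g) has_sum cinner f g) K"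
  using S_has_sum[of "\<S>i f" g] by (simp add: cinner_dual)

lemma dual_recon': "((\<lambda>j. cinner f (\<psi> j) * cinner (\<psi>d j) g) has_sum cinner f g) K"
  using S_has_sum[of f "\<S>i g"] by (simp add: dual_frame_def Si_adj S_adj)

lemma mat_vec_gram_synth: "c \<in> ell2 K \<Longrightarrow> mat_vec K (cross_gram K \<xi> \<psi>) c = analysis K \<xi> (\<D> c)"
  using cinner_synth[of c]
  by (auto simp: mat_vec_def cross_gram_def analysis_def fun_eq_iff infsumI mult.commute
      cong: infsum_cong)

lemma mat_vec_gram_dual: "mat_vec K (cross_gram K \<xi> \<psi>) (analysis K \<psi>d f) = analysis K \<xi> f"
  using mat_vec_gram_synth[OF analysis_dual_ell2] by (simp add: analysis_dual flip: S_def)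

text \<open>Each entry of the product is the frame expansion of \<open>\<eta> l\<close> in
  \<open>\<psi>\<close>, with dual coefficients, paired with \<open>\<xi> k\<close>. Adjacent
  \<open>\<psi>\<close> and \<open>\<psi>d\<close> thus cancel; the next lemma has them in the other
  order.\<close>

lemma mat_mult_gram_dual:
  "mat_mult K (cross_gram K \<xi> \<psi>) (cross_gram K \<psi>d \<eta>) = cross_gram K \<xi> \<eta>"
  using dual_recon
  by (auto simp: mat_mult_def cross_gram_def fun_eq_iff infsumI mult.commute cong: infsum_cong)

lemma mat_mult_gram_dual':
  "mat_mult K (cross_gram K \<xi> \<psi>d) (cross_gram K \<psi> \<eta>) = cross_gram K \<xi> \<eta>"
  using dual_recon'
  by (auto simp: mat_mult_def cross_gram_def fun_eq_iff infsumI mult.commute cong: infsum_cong)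

end

lemma is_frameE:
  assumes "is_frame K \<psi>"
  obtains B A where "frame K \<psi> B A"
  using assms unfolding is_frame_def frame_def bessel_def frame_axioms_def by blast

section \<open>Solid spectral algebras and their action on sequences\<close>

definition unit_seq :: "'k \<Rightarrow> 'k \<Rightarrow> complex" where
  "unit_seq l = (\<lambda>k. if k = l then 1 else 0)"

lemma unit_seq_fin: "l \<in> K \<Longrightarrow> unit_seq l \<in> fin_seqs K"
  by (auto simp: fin_seqs_def unit_seq_def)

lemma mat_vec_unit_seq: "l \<in> K \<Longrightarrow> mat_vec K A (unit_seq l) k = A k l"
proof -
  assume l: "l \<in> K"
  have "mat_vec K A (unit_seq l) k = (\<Sum>\<^sub>\<infinity>j\<in>{l}. A k j * unit_seq l j)"
    unfolding mat_vec_def using l by (intro infsum_cong_neutral) (auto simp: unit_seq_def)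
  then show ?thesis by (simp add: unit_seq_def)
qed

lemma bounded_on_lpD:
  assumes "bounded_on_lp K p w A" and "c \<in> lp K p w"
  shows "mat_vec K A c \<in> lp K p w" "k \<in> K \<Longrightarrow> (\<lambda>l. A k l * c l) summable_on K"
  using assms by (auto simp: bounded_on_lp_def)

lemma bounded_on_lpE:
  assumes "bounded_on_lp K p w A"
  obtains C where "0 \<le> C" "\<And>c. c \<in> lp K p w \<Longrightarrow> lp_norm K p w (mat_vec K A c) \<le> C * lp_norm K p w c"
proof -
  obtain C where C: "\<forall>c\<in>lp K p w. (\<forall>k\<in>K. (\<lambda>l. A k l * c l) summable_on K) \<and>
      mat_vec K A c \<in> lp K p w \<and> lp_norm K p w (mat_vec K A c) \<le> C * lp_norm K p w c"
    using assms unfolding bounded_on_lp_def by (elim exE)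
  have "lp_norm K p w (mat_vec K A c) \<le> \<bar>C\<bar> * lp_norm K p w c" if "c \<in> lp K p w" for c
  proof -
    have "lp_norm K p w (mat_vec K A c) \<le> C * lp_norm K p w c" using C that by simp
    also have "\<dots> \<le> \<bar>C\<bar> * lp_norm K p w c" by (intro mult_right_mono lp_norm_nonneg that) simp
    finally show ?thesis .
  qed
  then show ?thesis using that[of "\<bar>C\<bar>"] by simp
qed

lemma bounded_mat_vec_add:
  assumes "bounded_on_lp K p w A" "A \<in> matrices K" "c \<in> lp K p w" "d \<in> lp K p w"
  shows "mat_vec K A (\<lambda>k. c k + d k) = (\<lambda>k. mat_vec K A c k + mat_vec K A d k)"
proof
  fix k
  show "mat_vec K A (\<lambda>k. c k + d k) k = mat_vec K A c k + mat_vec K A d k"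
  proof (cases "k \<in> K")
    case True
    then show ?thesis
      using bounded_on_lpD(2)[OF assms(1,3) True] bounded_on_lpD(2)[OF assms(1,4) True]
      by (simp add: mat_vec_def distrib_left infsum_add)
  next
    case False
    then show ?thesis using assms(2) by (simp add: mat_vec_def matrices_def)
  qed
qed

lemma mat_vec_scale: "mat_vec K A (\<lambda>k. a * c k) = (\<lambda>k. a * mat_vec K A c k)"
  by (auto simp: mat_vec_def mult.left_commute infsum_cmult_right')

lemma mat_scale_vec: "mat_vec K (\<lambda>k l. a * A k l) c = (\<lambda>k. a * mat_vec K A c k)"
  by (auto simp: mat_vec_def mult.assoc infsum_cmult_right')

locale spectral_algebra =
  fixes K :: "'k set" and \<A> :: "'k matrix set" and N :: "'k matrix \<Rightarrow> real"
  assumes ssa: "solid_spectral_algebra K \<A> N"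
begin

lemma bsa: "banach_star_algebra K \<A> N" using ssa by (simp add: solid_spectral_algebra_def)

lemma alg_matrices: "A \<in> \<A> \<Longrightarrow> A \<in> matrices K" using bsa by (auto simp: banach_star_algebra_def)
lemma alg_outside: "A \<in> \<A> \<Longrightarrow> k \<notin> K \<or> l \<notin> K \<Longrightarrow> A k l = 0"
  using alg_matrices by (force simp: matrices_def)
lemma alg_one: "mat_one K \<in> \<A>" using bsa by (auto simp: banach_star_algebra_def)
lemma alg_add: "A \<in> \<A> \<Longrightarrow> B \<in> \<A> \<Longrightarrow> (\<lambda>k l. A k l + B k l) \<in> \<A>"
  and N_add: "A \<in> \<A> \<Longrightarrow> B \<in> \<A> \<Longrightarrow> N (\<lambda>k l. A k l + B k l) \<le> N A + N B"
  using bsa by (simp_all add: banach_star_algebra_def)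
lemma alg_scale: "A \<in> \<A> \<Longrightarrow> (\<lambda>k l. a * A k l) \<in> \<A>"
  and N_scale: "A \<in> \<A> \<Longrightarrow> N (\<lambda>k l. a * A k l) = cmod a * N A"
  using bsa by (simp_all add: banach_star_algebra_def)
lemma alg_mult: "A \<in> \<A> \<Longrightarrow> B \<in> \<A> \<Longrightarrow> mat_mult K A B \<in> \<A>"
  and N_mult: "A \<in> \<A> \<Longrightarrow> B \<in> \<A> \<Longrightarrow> N (mat_mult K A B) \<le> N A * N B"
  using bsa by (simp_all add: banach_star_algebra_def)
lemma alg_adj: "A \<in> \<A> \<Longrightarrow> mat_adj A \<in> \<A>"
  using bsa by (simp add: banach_star_algebra_def)
lemma N_nonneg: "A \<in> \<A> \<Longrightarrow> 0 \<le> N A" and N_zero: "A \<in> \<A> \<Longrightarrow> N A = 0 \<longleftrightarrow> A = (\<lambda>k l. 0)"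
  using bsa by (simp_all add: banach_star_algebra_def)
lemma alg_complete:
  fixes X :: "nat \<Rightarrow> 'k matrix"
  assumes "\<And>n. X n \<in> \<A>" "\<And>e. 0 < e \<Longrightarrow> \<exists>M. \<forall>m\<ge>M. \<forall>n\<ge>M. N (\<lambda>k l. X m k l - X n k l) < e"
  obtains A where "A \<in> \<A>" "(\<lambda>n. N (\<lambda>k l. X n k l - A k l)) \<longlonglongrightarrow> 0"
proof -
  have "(\<forall>n. X n \<in> \<A>) \<and> (\<forall>e>0. \<exists>M. \<forall>m\<ge>M. \<forall>n\<ge>M. N (\<lambda>k l. X m k l - X n k l) < e) \<longrightarrow>
      (\<exists>A\<in>\<A>. (\<lambda>n. N (\<lambda>k l. X n k l - A k l)) \<longlonglongrightarrow> 0)"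
    using bsa unfolding banach_star_algebra_def by (elim conjE) (erule spec)
  with assms that show ?thesis by blast
qed
lemma alg_solid: "A \<in> \<A> \<Longrightarrow> B \<in> matrices K \<Longrightarrow> (\<And>k l. cmod (B k l) \<le> cmod (A k l)) \<Longrightarrow> B \<in> \<A>"
  and N_solid: "A \<in> \<A> \<Longrightarrow> B \<in> matrices K \<Longrightarrow> (\<And>k l. cmod (B k l) \<le> cmod (A k l)) \<Longrightarrow> N B \<le> N A"
  using ssa by (simp_all add: solid_spectral_algebra_def)
lemma alg_inverse:
  assumes "A \<in> \<A>" "bij_betw (mat_vec K A) (ell2 K) (ell2 K)"
  obtains B where "B \<in> \<A>" "\<And>c. c \<in> ell2 K \<Longrightarrow> mat_vec K B (mat_vec K A c) = c"
proof -
  have "\<forall>A\<in>\<A>. bij_betw (mat_vec K A) (ell2 K) (ell2 K) \<longrightarrow>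
      (\<exists>B\<in>\<A>. \<forall>c\<in>ell2 K. mat_vec K B (mat_vec K A c) = c)"
    using ssa unfolding solid_spectral_algebra_def by (elim conjE)
  then have "\<exists>B\<in>\<A>. \<forall>c\<in>ell2 K. mat_vec K B (mat_vec K A c) = c" using assms by simp
  then show ?thesis using that by auto
qed
lemma alg_bounded_ell2: "A \<in> \<A> \<Longrightarrow> bounded_on_lp K 2 (\<lambda>_. 1) A"
  using ssa by (simp add: solid_spectral_algebra_def)

lemma alg_diff: "A \<in> \<A> \<Longrightarrow> B \<in> \<A> \<Longrightarrow> (\<lambda>k l. A k l - B k l) \<in> \<A>"
  using alg_add[OF _ alg_scale[of B "-1"], of A] by simp

lemma N_diff_sym: "A \<in> \<A> \<Longrightarrow> B \<in> \<A> \<Longrightarrow> N (\<lambda>k l. A k l - B k l) = N (\<lambda>k l. B k l - A k l)"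
  using N_scale[OF alg_diff[of B A], of "-1"] by simp

lemma N_diff_triangle:
  "A \<in> \<A> \<Longrightarrow> B \<in> \<A> \<Longrightarrow> C \<in> \<A> \<Longrightarrow>
    N (\<lambda>k l. A k l - C k l) \<le> N (\<lambda>k l. A k l - B k l) + N (\<lambda>k l. B k l - C k l)"
  using N_add[OF alg_diff[of A B] alg_diff[of B C]] by simp

lemma N_diff_lower: "A \<in> \<A> \<Longrightarrow> B \<in> \<A> \<Longrightarrow> N A \<le> N B + N (\<lambda>k l. A k l - B k l)"
  using N_add[of B "\<lambda>k l. A k l - B k l"] alg_diff[of A B] by simp

text \<open>By solidity it stays in the algebra and so acts boundedly too; this is the source of
  absolute convergence in everything that follows.\<close>

definition mat_abs :: "'k matrix \<Rightarrow> 'k matrix" where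
  "mat_abs A = (\<lambda>k l. complex_of_real (cmod (A k l)))"

lemma alg_abs: "A \<in> \<A> \<Longrightarrow> mat_abs A \<in> \<A>"
  by (rule alg_solid[of A]) (auto simp: mat_abs_def matrices_def alg_outside)

text \<open>If an entry of a matrix is non-zero then, by solidity, the algebra contains the matrix unit at this place.\<close>

lemma alg_entry_tendsto:
  assumes X: "\<And>n. X n \<in> \<A>" and A: "A \<in> \<A>" and lim: "(\<lambda>n. N (\<lambda>k l. X n k l - A k l)) \<longlonglongrightarrow> 0"
  shows "(\<lambda>n. X n i j) \<longlonglongrightarrow> A i j"
proof (cases "\<exists>n. X n i j \<noteq> A i j")
  case False
  then show ?thesis by simp
next
  case True
  define Y where "Y n = (\<lambda>k l. X n k l - A k l)" for n
  have Y: "Y n \<in> \<A>" for n unfolding Y_def by (rule alg_diff[OF X A])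
  define E :: "'k matrix" where "E = (\<lambda>k l. if k = i \<and> l = j then 1 else 0)"
  obtain m where m: "Y m i j \<noteq> 0" using True by (auto simp: Y_def)
  have ij: "i \<in> K" "j \<in> K" using m alg_outside[OF Y[of m]] by blast+
  have "E \<in> \<A>"
    by (rule alg_solid[OF alg_scale[OF Y[of m], of "1 / Y m i j"]])
      (use m ij in \<open>auto simp: E_def matrices_def norm_mult\<close>)
  moreover have "E \<noteq> (\<lambda>k l. 0)" by (auto simp: E_def fun_eq_iff)
  ultimately have E: "E \<in> \<A>" "N E > 0" using N_zero[of E] N_nonneg[of E] by auto
  \<comment> \<open>The multiple \<open>Y n i j * E\<close> of the matrix unit is dominated
    entrywise by \<open>Y n\<close>, so the norm controls this entry.\<close>
  have "cmod (Y n i j) * N E \<le> N (Y n)" for n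
    using N_solid[OF Y[of n], of "\<lambda>k l. Y n i j * E k l"] N_scale[OF E(1), of "Y n i j"] ij
    by (auto simp: E_def matrices_def)
  then have "cmod (Y n i j) \<le> N (Y n) / N E" for n using E by (simp add: field_simps)
  moreover have "(\<lambda>n. N (Y n) / N E) \<longlonglongrightarrow> 0" using tendsto_divide_zero[OF lim] by (simp add: Y_def)
  ultimately have "(\<lambda>n. Y n i j) \<longlonglongrightarrow> 0"
    by (intro Lim_null_comparison[of "\<lambda>n. Y n i j" "\<lambda>n. N (Y n) / N E"]) auto
  then show ?thesis by (simp add: Y_def LIM_zero_iff)
qed

end

text \<open>\<open>bdd\<close> abstracts the two ways in which the algebra acts: on \<open>\<ell>\<^sup>2\<close> and on an admissible weighted space.\<close>

locale action = spectral_algebra K \<A> N + weighted K p w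
  for K :: "'k set" and \<A> N and p :: ennreal and w :: "'k \<Rightarrow> real" +
  assumes bdd: "\<And>A. A \<in> \<A> \<Longrightarrow> bounded_on_lp K p w A"
begin

lemma mv_summable:
  "A \<in> \<A> \<Longrightarrow> c \<in> lp K p w \<Longrightarrow> k \<in> K \<Longrightarrow> (\<lambda>l. A k l * c l) summable_on K"
  by (rule bounded_on_lpD(2)[OF bdd])

lemma mv_summable':
  "A \<in> \<A> \<Longrightarrow> c \<in> lp K p w \<Longrightarrow> (\<lambda>l. A k l * c l) summable_on K"
  using mv_summable[of A c k] alg_outside[of A k] by (cases "k \<in> K") auto

lemma mv_lp: "A \<in> \<A> \<Longrightarrow> c \<in> lp K p w \<Longrightarrow> mat_vec K A c \<in> lp K p w"
  by (rule bounded_on_lpD(1)[OF bdd])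

lemma mv_bound:
  assumes "A \<in> \<A>"
  obtains C where "0 \<le> C" "\<And>c. c \<in> lp K p w \<Longrightarrow> lp_norm K p w (mat_vec K A c) \<le> C * lp_norm K p w c"
  by (rule bounded_on_lpE[OF bdd[OF assms]]) (rule that)

lemma lp_abs: "c \<in> lp K p w \<Longrightarrow> (\<lambda>k. complex_of_real (cmod (c k))) \<in> lp K p w"
  by (rule lp_solid) auto

lemma mv_abs_summable:
  assumes "A \<in> \<A>" "c \<in> lp K p w"
  shows "(\<lambda>l. cmod (A k l) * cmod (c l)) summable_on K"
  using summable_on_Re[OF mv_summable'[OF alg_abs[OF assms(1)] lp_abs[OF assms(2)], of k]]
  by (simp add: mat_abs_def)

lemma mv_mat_add:
  assumes "A \<in> \<A>" "B \<in> \<A>" "c \<in> lp K p w"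
  shows "mat_vec K (\<lambda>k l. A k l + B k l) c = (\<lambda>k. mat_vec K A c k + mat_vec K B c k)"
  using mv_summable'[OF assms(1,3)] mv_summable'[OF assms(2,3)]
  by (simp add: mat_vec_def distrib_right infsum_add)

lemma mv_mat_diff:
  assumes "A \<in> \<A>" "B \<in> \<A>" "c \<in> lp K p w"
  shows "mat_vec K (\<lambda>k l. A k l - B k l) c = (\<lambda>k. mat_vec K A c k - mat_vec K B c k)"
  using mv_mat_add[OF assms(1) alg_scale[OF assms(2), of "-1"] assms(3)] mat_scale_vec[of K "-1" B c]
  by simp

lemma mv_add:
  assumes "A \<in> \<A>" "c \<in> lp K p w" "d \<in> lp K p w"
  shows "mat_vec K A (\<lambda>k. c k + d k) = (\<lambda>k. mat_vec K A c k + mat_vec K A d k)"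
  by (rule bounded_mat_vec_add[OF bdd alg_matrices]) (use assms in simp_all)

lemma mv_diff:
  assumes "A \<in> \<A>" "c \<in> lp K p w" "d \<in> lp K p w"
  shows "mat_vec K A (\<lambda>k. c k - d k) = (\<lambda>k. mat_vec K A c k - mat_vec K A d k)"
  using mv_add[OF assms(1,2) lp_scale(1)[OF assms(3), of "-1"]] mat_vec_scale[of K A "-1" d] by simp

lemma mv_one: "c \<in> lp K p w \<Longrightarrow> mat_vec K (mat_one K) c = c"
proof
  fix k assume c: "c \<in> lp K p w"
  have "mat_vec K (mat_one K) c k = (\<Sum>\<^sub>\<infinity>l\<in>{k} \<inter> K. mat_one K k l * c l)"
    unfolding mat_vec_def by (intro infsum_cong_neutral) (auto simp: mat_one_def)
  then show "mat_vec K (mat_one K) c k = c k"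
    using lp_supp[OF c, of k] by (cases "k \<in> K") (auto simp: mat_one_def)
qed

text \<open>Fubini applies because by solidity the absolute values of the matrices act as well.\<close>

lemma mv_mult:
  assumes A: "A \<in> \<A>" and B: "B \<in> \<A>" and c: "c \<in> lp K p w"
  shows "mat_vec K (mat_mult K A B) c = mat_vec K A (mat_vec K B c)"
proof
  fix k
  let ?f = "\<lambda>(j, l). A k j * (B j l * c l)"
  have absBc: "mat_vec K (mat_abs B) (\<lambda>l. complex_of_real (cmod (c l))) j
      = complex_of_real (\<Sum>\<^sub>\<infinity>l\<in>K. cmod (B j l) * cmod (c l))" for j
  proof -
    have "((\<lambda>l. complex_of_real (cmod (B j l) * cmod (c l))) has_sum
        complex_of_real (\<Sum>\<^sub>\<infinity>l\<in>K. cmod (B j l) * cmod (c l))) K"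
      by (intro has_sum_of_real has_sum_infsum mv_abs_summable B c)
    then show ?thesis by (simp add: mat_vec_def mat_abs_def infsumI)
  qed
  have s1: "(\<lambda>j. cmod (A k j) * (\<Sum>\<^sub>\<infinity>l\<in>K. cmod (B j l) * cmod (c l))) summable_on K"
    using mv_abs_summable[OF A mv_lp[OF alg_abs[OF B] lp_abs[OF c]], of k]
    by (simp add: absBc infsum_nonneg)
  have "(\<lambda>x. norm (?f x)) summable_on (K \<times> K)"
    unfolding Infinite_Sum.abs_summable_on_Sigma_iff
  proof (intro conjI ballI)
    fix j
    show "(\<lambda>l. norm (?f (j, l))) summable_on K"
      using summable_on_cmult_right[OF mv_abs_summable[OF B c, of j], of "cmod (A k j)"]
      by (simp add: norm_mult)
  next
    show "(\<lambda>j. norm (\<Sum>\<^sub>\<infinity>l\<in>K. norm (?f (j, l)))) summable_on K"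
      using s1 by (simp add: norm_mult infsum_cmult_right' infsum_nonneg)
  qed
  then have f: "?f summable_on (K \<times> K)" by (rule abs_summable_summable)
  have "mat_vec K A (mat_vec K B c) k = (\<Sum>\<^sub>\<infinity>j\<in>K. \<Sum>\<^sub>\<infinity>l\<in>K. A k j * (B j l * c l))"
    by (simp add: mat_vec_def infsum_cmult_right')
  also have "\<dots> = (\<Sum>\<^sub>\<infinity>l\<in>K. \<Sum>\<^sub>\<infinity>j\<in>K. A k j * (B j l * c l))"
    by (rule infsum_swap_banach[OF f])
  also have "\<dots> = mat_vec K (mat_mult K A B) c k"
    by (simp add: mat_vec_def mat_mult_def mult.assoc[symmetric] infsum_cmult_left')
  finally show "mat_vec K (mat_mult K A B) c k = mat_vec K A (mat_vec K B c) k" by simp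
qed

text \<open>Dominated convergence: the rows of a matrix of the algebra are summable against the reciprocal weight.\<close>

lemma mv_pointwise_limit:
  assumes A: "A \<in> \<A>" and inf: "bounded_on_lp K \<infinity> w (mat_abs A)"
    and c: "\<And>n. c n \<in> lp K p w" "\<And>n. lp_norm K p w (c n) \<le> C"
    and lim: "\<And>k. (\<lambda>n. c n k) \<longlonglongrightarrow> d k"
  shows "(\<lambda>n. mat_vec K A (c n) k) \<longlonglongrightarrow> mat_vec K A d k"
proof (cases "k \<in> K")
  case False
  then show ?thesis using alg_outside[OF A] by (simp add: mat_vec_def)
next
  case k: True
  have C: "0 \<le> C" using lp_norm_nonneg[OF c(1)] c(2) order_trans by blast
  \<comment> \<open>The reciprocal weight lies in the weighted ell^\<infinity>. Applying
    \<open>mat_abs A\<close> to it shows that row \<open>k\<close> is summable against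
    \<open>1 / w\<close>, and \<open>C / w\<close> dominates all \<open>c n\<close>.\<close>
  define v where "v l = (if l \<in> K then complex_of_real (1 / w l) else 0)" for l
  have "w l * cmod (v l) \<le> 1" if "l \<in> K" for l
    using w[OF that] that by (simp add: v_def norm_divide)
  then have "v \<in> lp K \<infinity> w" by (auto simp: lp_def v_def bdd_above_def)
  then have s: "(\<lambda>l. mat_abs A k l * v l) summable_on K" using bounded_on_lpD(2)[OF inf _ k] by simp
  have "(\<lambda>l. cmod (A k l) * (C / w l)) summable_on K"
    using summable_on_cmult_left[OF summable_on_Re[OF s], of C]
    by (rule summable_on_cong[THEN iffD1, rotated]) (auto simp: v_def mat_abs_def)
  note sb = this
  have bound: "norm (A k l * c n l) \<le> cmod (A k l) * (C / w l)" if "l \<in> K" for l n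
  proof -
    have "w l * cmod (c n l) \<le> C" using lp_coord[OF c(1) that, of n] c(2)[of n] by linarith
    then have "cmod (c n l) \<le> C / w l" using w[OF that] by (simp add: field_simps)
    then show ?thesis unfolding norm_mult by (intro mult_left_mono) auto
  qed
  have bound': "norm (A k l * d l) \<le> cmod (A k l) * (C / w l)" if "l \<in> K" for l
    by (rule tendsto_upperbound[OF tendsto_norm[OF tendsto_mult[OF tendsto_const lim[of l]]] _ sequentially_bot])
      (use bound[OF that] in auto)
  have sn: "(\<lambda>l. A k l * c n l) summable_on K" for n
    by (rule mv_summable[OF A c(1) k])
  have sd: "(\<lambda>l. A k l * d l) summable_on K"
    by (rule abs_summable_summable, rule summable_on_comparison_test[OF sb bound']) auto
  show ?thesis
  proof (rule LIMSEQ_I)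
    fix e :: real assume e: "0 < e"
    obtain F where F: "finite F" "F \<subseteq> K"
      and ap: "dist (\<Sum>l\<in>F. cmod (A k l) * (C / w l)) (\<Sum>\<^sub>\<infinity>l\<in>K. cmod (A k l) * (C / w l)) \<le> e / 4"
      using infsum_finite_approximation[OF sb, of "e / 4"] e by auto
    have tail: "norm ((\<Sum>\<^sub>\<infinity>l\<in>K. A k l * x l) - (\<Sum>l\<in>F. A k l * x l)) \<le> e / 4"
      if sx: "(\<lambda>l. A k l * x l) summable_on K"
        and bx: "\<And>l. l \<in> K \<Longrightarrow> norm (A k l * x l) \<le> cmod (A k l) * (C / w l)" for x
    proof -
      have eq: "(\<Sum>\<^sub>\<infinity>l\<in>K. A k l * x l) - (\<Sum>l\<in>F. A k l * x l) = (\<Sum>\<^sub>\<infinity>l\<in>K - F. A k l * x l)"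
        using infsum_Diff[OF sx, of F] F by simp
      have "norm (\<Sum>\<^sub>\<infinity>l\<in>K - F. A k l * x l) \<le> (\<Sum>\<^sub>\<infinity>l\<in>K - F. cmod (A k l) * (C / w l))"
        by (rule norm_infsum_le[OF has_sum_infsum has_sum_infsum])
          (use bx sx sb in \<open>auto intro: summable_on_subset_banach\<close>)
      moreover have "(\<Sum>\<^sub>\<infinity>l\<in>K - F. cmod (A k l) * (C / w l))
          = (\<Sum>\<^sub>\<infinity>l\<in>K. cmod (A k l) * (C / w l)) - (\<Sum>l\<in>F. cmod (A k l) * (C / w l))"
        using infsum_Diff[OF sb, of F] F by simp
      ultimately show ?thesis unfolding eq using ap unfolding dist_real_def by linarith
    qed
    have lF: "(\<lambda>n. \<Sum>l\<in>F. A k l * c n l) \<longlonglongrightarrow> (\<Sum>l\<in>F. A k l * d l)"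
      by (intro tendsto_intros lim)
    obtain n0 where n0: "\<And>n. n \<ge> n0 \<Longrightarrow> norm ((\<Sum>l\<in>F. A k l * c n l) - (\<Sum>l\<in>F. A k l * d l)) < e / 4"
      using LIMSEQ_D[OF lF, of "e / 4"] e by auto
    have "norm (mat_vec K A (c n) k - mat_vec K A d k) < e" if "n \<ge> n0" for n
    proof -
      let ?a = "\<Sum>\<^sub>\<infinity>l\<in>K. A k l * c n l" and ?b = "\<Sum>l\<in>F. A k l * c n l"
      let ?a' = "\<Sum>\<^sub>\<infinity>l\<in>K. A k l * d l" and ?b' = "\<Sum>l\<in>F. A k l * d l"
      have "?a - ?a' = (?a - ?b) + (?b - ?b') - (?a' - ?b')" by simp
      then have "norm (?a - ?a') \<le> norm (?a - ?b) + norm (?b - ?b') + norm (?a' - ?b')"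
        using norm_triangle_ineq4[of "(?a - ?b) + (?b - ?b')" "?a' - ?b'"]
          norm_triangle_ineq[of "?a - ?b" "?b - ?b'"] by simp
      then show ?thesis
        using tail[OF sn[of n] bound] tail[OF sd bound'] n0[OF that] e
        unfolding mat_vec_def by linarith
    qed
    then show "\<exists>n0. \<forall>n\<ge>n0. norm (mat_vec K A (c n) k - mat_vec K A d k) < e" by blast
  qed
qed

end

section \<open>Localization of the canonical dual frame\<close>

text \<open>A chord is no longer than its arc: its length is
  \<open>2 |sin ((a - b) / 2)|\<close>.\<close>

lemma norm_cis_diff_le: "cmod (cis a - cis b) \<le> \<bar>a - b\<bar>"
proof -
  define x where "x = (a - b) / 2"
  have ab: "a - b = 2 * x" by (simp add: x_def)
  have "(cmod (cis a - cis b))\<^sup>2 = 2 - 2 * cos (a - b)"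
    unfolding cmod_power2 using sin_cos_squared_add[of a] sin_cos_squared_add[of b]
    by (simp add: cos_diff power2_eq_square algebra_simps)
  also have "\<dots> = \<bar>2 * sin x\<bar>\<^sup>2"
    unfolding ab cos_double_sin by (simp add: power2_eq_square)
  finally have "cmod (cis a - cis b) = \<bar>2 * sin x\<bar>" by (rule power2_eq_imp_eq) auto
  then show ?thesis using abs_sin_x_le_abs_x[of x] unfolding ab by simp
qed

locale localized_frame = spectral_algebra K \<A> N + frame K \<psi> B A
  for K :: "'k set" and \<A> N and \<psi> :: "'k \<Rightarrow> 'h::complex_hilbert" and B A +
  assumes loc: "localized K \<A> \<psi>"
begin

sublocale two: action K \<A> N 2 "\<lambda>_. 1"
  by unfold_locales (auto intro: alg_bounded_ell2)

abbreviation "Gm \<equiv> cross_gram K \<psi> \<psi>"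

lemma Gm: "Gm \<in> \<A>" using loc by (simp add: localized_def loc_rel_def)

text \<open>Unit sequences lie in ell^2 and recover the columns, so identities in the algebra may be
  checked for operators on ell^2.\<close>

lemma mat_eqI:
  assumes "X \<in> \<A>" "Y \<in> matrices K" "\<And>c. c \<in> ell2 K \<Longrightarrow> mat_vec K X c = mat_vec K Y c"
  shows "X = Y"
proof (intro ext)
  fix k l
  show "X k l = Y k l"
  proof (cases "l \<in> K")
    case True
    then show ?thesis
      using assms(3)[OF fin_seqs_ell2[OF unit_seq_fin[OF True]]] mat_vec_unit_seq[OF True] by metis
  next
    case False
    then show ?thesis using alg_outside[OF assms(1)] assms(2) by (auto simp: matrices_def)
  qed
qed

text \<open>
  The spectrum of \<open>Y = t (1 - G / B)\<close> consists of \<open>t > 1\<close>, on the kernel of synthesis, and of points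
  of modulus at most \<open>t \<rho> < 1\<close>, on the range of analysis, so the unit circle separates the two.
\<close>

definition t :: real where "t = 2 / (1 + \<rho>)"

text \<open>\<open>1 / t\<close> is the midpoint of \<open>\<rho>\<close> and \<open>1\<close>,
  hence strictly inside the spectral gap of \<open>1 - G / B\<close>.\<close>

lemma t: "1 < t" "t * \<rho> < 1" "0 \<le> t * \<rho>"
  using \<rho> by (auto simp: t_def field_simps)

definition bi :: complex where "bi = complex_of_real (1 / B)"

lemma V_bi: "V f = f - cscale bi (\<S> f)"
  by (simp add: V_def bi_def)

definition Ym :: "'k matrix" where
  "Ym = (\<lambda>k l. complex_of_real t * (mat_one K k l - bi * Gm k l))"

lemma Ym: "Ym \<in> \<A>"
  unfolding Ym_def by (intro alg_scale alg_diff alg_one Gm)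

abbreviation yv :: "('k \<Rightarrow> complex) \<Rightarrow> 'k \<Rightarrow> complex" where "yv \<equiv> mat_vec K Ym"

lemma yv: "c \<in> ell2 K \<Longrightarrow>
    yv c = (\<lambda>k. complex_of_real t * (c k - bi * \<C> (\<D> c) k))"
  unfolding Ym_def mat_scale_vec
  by (subst two.mv_mat_diff[OF alg_one alg_scale[OF Gm]])
    (auto simp: two.mv_one mat_scale_vec mat_vec_gram_synth)

lemma yv_ell2: "c \<in> ell2 K \<Longrightarrow> yv c \<in> ell2 K"
  by (rule two.mv_lp[OF Ym])

text \<open>The counterpart of \<open>Ym\<close> on the Hilbert space: analysis and synthesis
  intertwine the two, and here contractivity is at hand.\<close>

definition U :: "'h \<Rightarrow> 'h" where "U f = cscale (complex_of_real t) (V f)"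

lemma U_diff: "U (f - g) = U f - U g"
  by (simp add: U_def V_diff cscale_diff_right)

lemma U_norm: "norm (U f) \<le> (t * \<rho>) * norm f"
  using V_norm[of f] t by (simp add: U_def norm_cscale mult.assoc mult_left_mono)

lemma yv_analysis: "yv (\<C> f) = \<C> (U f)"
  by (simp add: yv analysis_ell2 U_def V_bi analysis_diff analysis_cscale flip: S_def)

lemma synth_yv: "c \<in> ell2 K \<Longrightarrow> \<D> (yv c) = U (\<D> c)"
  by (simp add: yv synth_scale synth_diff ell2_diff ell2_scale analysis_ell2 U_def V_bi flip: S_def)

lemma yv_ker: "c \<in> ell2 K \<Longrightarrow> \<D> c = 0 \<Longrightarrow> yv c = (\<lambda>k. complex_of_real t * c k)"
  by (auto simp: yv analysis_def)

lemma scaled_U_solve: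
  assumes "cmod \<zeta> \<le> 1"
  obtains g where "g - cscale \<zeta> (U g) = f"
proof -
  have "norm (cscale \<zeta> (U g)) \<le> (t * \<rho>) * norm g" for g
  proof -
    have "norm (cscale \<zeta> (U g)) \<le> norm (U g)"
      using assms by (simp add: norm_cscale mult_left_le_one_le)
    then show ?thesis using U_norm[of g] by linarith
  qed
  then show ?thesis
    using contraction_solve[of "\<lambda>g. cscale \<zeta> (U g)" "t * \<rho>" f] t that
    by (simp add: U_diff cscale_diff_right) blast
qed

section \<open>Resolvents on the unit circle\<close>

definition Wm :: "complex \<Rightarrow> 'k matrix" where
  "Wm \<zeta> = (\<lambda>k l. mat_one K k l - \<zeta> * Ym k l)"

lemma Wm: "Wm \<zeta> \<in> \<A>"
  unfolding Wm_def by (intro alg_diff alg_scale alg_one Ym)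

lemma Wm_vec: "c \<in> ell2 K \<Longrightarrow> mat_vec K (Wm \<zeta>) c = (\<lambda>k. c k - \<zeta> * yv c k)"
  unfolding Wm_def
  by (subst two.mv_mat_diff[OF alg_one alg_scale[OF Ym]]) (auto simp: two.mv_one mat_scale_vec)

text \<open>The component of \<open>c\<close> in the kernel of synthesis. What is removed is the
  projection \<open>C S^-1 D\<close> of \<open>c\<close> to the range of analysis.\<close>

definition ker_part :: "('k \<Rightarrow> complex) \<Rightarrow> 'k \<Rightarrow> complex" where
  "ker_part c = (\<lambda>k. c k - \<C> (\<S>i (\<D> c)) k)"

lemma ker_part: "c \<in> ell2 K \<Longrightarrow> ker_part c \<in> ell2 K" "c \<in> ell2 K \<Longrightarrow> \<D> (ker_part c) = 0"
  by (auto simp: ker_part_def ell2_diff analysis_ell2 synth_diff simp flip: S_def)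

text \<open>On the kernel of synthesis the operator is a non-zero scalar; on the range of analysis
  it corresponds to \<open>1 - \<zeta> U\<close>, which is invertible because \<open>U\<close> is a
  contraction. These two subspaces together span ell^2.\<close>

lemma Wm_bij:
  assumes l: "cmod \<zeta> = 1"
  shows "bij_betw (mat_vec K (Wm \<zeta>)) (ell2 K) (ell2 K)"
proof -
  \<comment> \<open>This is the scalar by which the operator acts on the kernel of synthesis;
    \<open>\<zeta> t\<close> has modulus \<open>t > 1\<close>.\<close>
  have lt: "1 - \<zeta> * complex_of_real t \<noteq> 0"
  proof
    assume "1 - \<zeta> * complex_of_real t = 0"
    then have "cmod (\<zeta> * complex_of_real t) = 1" by simp
    then show False using l t by (simp add: norm_mult)
  qed
  have ker: "c = (\<lambda>_. 0)" if c: "c \<in> ell2 K" and z: "mat_vec K (Wm \<zeta>) c = (\<lambda>_. 0)" for c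
  proof -
    have cy: "c = (\<lambda>k. \<zeta> * yv c k)" using z by (auto simp: Wm_vec[OF c] fun_eq_iff)
    have "\<D> c = cscale \<zeta> (U (\<D> c))"
      by (subst cy) (simp add: synth_scale yv_ell2 c synth_yv)
    then have "norm (\<D> c) \<le> (t * \<rho>) * norm (\<D> c)"
      using U_norm[of "\<D> c"] l by (metis norm_cscale mult_1)
    then have "(1 - t * \<rho>) * norm (\<D> c) \<le> 0" by (simp add: algebra_simps)
    then have D0: "\<D> c = 0" using t by (auto simp: mult_le_0_iff)
    show ?thesis
    proof
      fix k
      have "c k = \<zeta> * (complex_of_real t * c k)" using fun_cong[OF cy, of k] yv_ker[OF c D0] by simp
      then have "(1 - \<zeta> * complex_of_real t) * c k = 0" by (simp add: algebra_simps)
      then show "c k = 0" using lt by simp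
    qed
  qed
  have inj: "c = d" if c: "c \<in> ell2 K" and d: "d \<in> ell2 K" and e: "mat_vec K (Wm \<zeta>) c = mat_vec K (Wm \<zeta>) d" for c d
    using ker[OF ell2_diff[OF c d]] e by (auto simp: two.mv_diff[OF Wm c d] fun_eq_iff)
  have surj: "\<exists>d\<in>ell2 K. mat_vec K (Wm \<zeta>) d = c" if c: "c \<in> ell2 K" for c
  proof -
    \<comment> \<open>The preimage is assembled from both components: \<open>g\<close> inverts the
      part in the range of analysis, the factor \<open>a\<close> the part in the kernel.\<close>
    obtain g where g: "g - cscale \<zeta> (U g) = \<S>i (\<D> c)" using scaled_U_solve[of \<zeta>] l by auto
    define a where "a = 1 / (1 - \<zeta> * complex_of_real t)"
    define d where "d = (\<lambda>k. \<C> g k + a * ker_part c k)"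
    have d: "d \<in> ell2 K" unfolding d_def by (intro ell2_add ell2_scale ker_part c analysis_ell2)
    have "mat_vec K (Wm \<zeta>) d = (\<lambda>k. mat_vec K (Wm \<zeta>) (\<C> g) k + a * mat_vec K (Wm \<zeta>) (ker_part c) k)"
      unfolding d_def
      by (simp add: two.mv_add[OF Wm] analysis_ell2 ell2_scale ker_part c mat_vec_scale)
    also have "\<dots> = (\<lambda>k. \<C> (g - cscale \<zeta> (U g)) k + a * (1 - \<zeta> * complex_of_real t) * ker_part c k)"
      by (simp add: Wm_vec analysis_ell2 yv_analysis analysis_diff analysis_cscale ker_part c yv_ker
          algebra_simps)
    also have "\<dots> = c" using lt by (simp add: g a_def ker_part_def)
    finally show ?thesis using d by blast
  qed
  show ?thesis unfolding bij_betw_def inj_on_def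
    using inj surj two.mv_lp[OF Wm] by blast
qed

text \<open>Chosen because inverse-closedness only asserts the existence of a left inverse;
  meaningful for \<open>cmod \<zeta> = 1\<close>.\<close>

definition Fm :: "complex \<Rightarrow> 'k matrix" where
  "Fm \<zeta> = (SOME F. F \<in> \<A> \<and> (\<forall>c\<in>ell2 K. mat_vec K F (mat_vec K (Wm \<zeta>) c) = c))"

lemma Fm:
  assumes "cmod \<zeta> = 1"
  shows "Fm \<zeta> \<in> \<A>" "c \<in> ell2 K \<Longrightarrow> mat_vec K (Fm \<zeta>) (\<lambda>k. c k - \<zeta> * yv c k) = c"
proof -
  have "\<exists>F. F \<in> \<A> \<and> (\<forall>c\<in>ell2 K. mat_vec K F (mat_vec K (Wm \<zeta>) c) = c)"
    using alg_inverse[OF Wm Wm_bij[OF assms]] by metis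
  then have "Fm \<zeta> \<in> \<A> \<and> (\<forall>c\<in>ell2 K. mat_vec K (Fm \<zeta>) (mat_vec K (Wm \<zeta>) c) = c)"
    unfolding Fm_def by (rule someI_ex)
  then show "Fm \<zeta> \<in> \<A>" "c \<in> ell2 K \<Longrightarrow> mat_vec K (Fm \<zeta>) (\<lambda>k. c k - \<zeta> * yv c k) = c"
    using Wm_vec by auto
qed

text \<open>\<open>Fm\<close> is specified as a left inverse only. Writing \<open>c\<close> as a
  value of \<open>Wm\<close> makes it usable from the other side.\<close>

lemma Fm_surj:
  assumes "cmod \<zeta> = 1" "c \<in> ell2 K"
  obtains d where "d \<in> ell2 K" "c = (\<lambda>k. d k - \<zeta> * yv d k)"
proof -
  have "c \<in> mat_vec K (Wm \<zeta>) ` ell2 K" using bij_betw_imp_surj_on[OF Wm_bij[OF assms(1)]] assms(2) by simp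
  then obtain d where d: "d \<in> ell2 K" "c = mat_vec K (Wm \<zeta>) d" by blast
  show ?thesis by (rule that[OF d(1)]) (simp add: d Wm_vec)
qed

text \<open>Write \<open>c = (1 - \<mu> Y) d\<close>, so that \<open>Fm \<mu>\<close> maps
  \<open>c\<close> to \<open>d\<close>. Then
  \<open>c = (1 - \<zeta> Y) d + (\<zeta> - \<mu>) Y d\<close>, and \<open>Fm \<zeta>\<close> is
  applied to both terms.\<close>

lemma resolvent:
  assumes l: "cmod \<zeta> = 1" and m: "cmod \<mu> = 1"
  shows "(\<lambda>k l. Fm \<zeta> k l - Fm \<mu> k l) = (\<lambda>k l. (\<zeta> - \<mu>) * mat_mult K (Fm \<zeta>) (mat_mult K Ym (Fm \<mu>)) k l)"
proof (rule mat_eqI)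
  let ?P = "mat_mult K (Fm \<zeta>) (mat_mult K Ym (Fm \<mu>))"
  have P: "?P \<in> \<A>" by (intro alg_mult Fm l m Ym)
  show "(\<lambda>k l. Fm \<zeta> k l - Fm \<mu> k l) \<in> \<A>" by (intro alg_diff Fm l m)
  show "(\<lambda>k l. (\<zeta> - \<mu>) * ?P k l) \<in> matrices K" by (intro alg_matrices alg_scale P)
  fix c assume c: "c \<in> ell2 K"
  obtain d where d: "d \<in> ell2 K" "c = (\<lambda>k. d k - \<mu> * yv d k)" using Fm_surj[OF m c] by blast
  have Fmc: "mat_vec K (Fm \<mu>) c = d" using Fm(2)[OF m d(1)] d(2) by simp
  have "c = (\<lambda>k. (d k - \<zeta> * yv d k) + (\<zeta> - \<mu>) * yv d k)" by (simp add: d(2) algebra_simps)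
  then have "mat_vec K (Fm \<zeta>) c = (\<lambda>k. d k + (\<zeta> - \<mu>) * mat_vec K (Fm \<zeta>) (yv d) k)"
    using two.mv_add[OF Fm(1)[OF l] ell2_diff[OF d(1) ell2_scale[OF yv_ell2[OF d(1)]]]
        ell2_scale[OF yv_ell2[OF d(1)]], of \<zeta> "\<zeta> - \<mu>"]
    by (simp add: Fm(2)[OF l d(1)] mat_vec_scale)
  moreover have "mat_vec K ?P c = mat_vec K (Fm \<zeta>) (yv d)"
    by (simp add: two.mv_mult[OF Fm(1)[OF l] alg_mult[OF Ym Fm(1)[OF m]] c]
        two.mv_mult[OF Ym Fm(1)[OF m] c] Fmc)
  ultimately show "mat_vec K (\<lambda>k l. Fm \<zeta> k l - Fm \<mu> k l) c = mat_vec K (\<lambda>k l. (\<zeta> - \<mu>) * ?P k l) c"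
    by (simp add: two.mv_mat_diff[OF Fm(1)[OF l] Fm(1)[OF m] c] mat_scale_vec Fmc)
qed

lemma resolvent_N:
  assumes l: "cmod \<zeta> = 1" and m: "cmod \<mu> = 1"
  shows "N (\<lambda>k l. Fm \<zeta> k l - Fm \<mu> k l) \<le> cmod (\<zeta> - \<mu>) * (N (Fm \<zeta>) * (N Ym * N (Fm \<mu>)))"
proof -
  note F = Fm(1)[OF l] Fm(1)[OF m]
  have "N (\<lambda>k l. Fm \<zeta> k l - Fm \<mu> k l) = cmod (\<zeta> - \<mu>) * N (mat_mult K (Fm \<zeta>) (mat_mult K Ym (Fm \<mu>)))"
    unfolding resolvent[OF l m] by (intro N_scale alg_mult F Ym)
  also have "\<dots> \<le> cmod (\<zeta> - \<mu>) * (N (Fm \<zeta>) * (N Ym * N (Fm \<mu>)))"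
  proof (rule mult_left_mono)
    show "N (mat_mult K (Fm \<zeta>) (mat_mult K Ym (Fm \<mu>))) \<le> N (Fm \<zeta>) * (N Ym * N (Fm \<mu>))"
      by (rule order_trans[OF N_mult[OF F(1) alg_mult[OF Ym F(2)]]])
        (intro mult_left_mono N_mult N_nonneg Ym F)
  qed simp
  finally show ?thesis .
qed

text \<open>
  The resolvent identity bounds the resolvent near each point of the circle, since its existence is
  already known; compactness makes the bound uniform.
\<close>

lemma Fm_bounded: "\<exists>M. \<forall>\<zeta>. cmod \<zeta> = 1 \<longrightarrow> N (Fm \<zeta>) \<le> M"
proof (rule ccontr)
  assume "\<not> ?thesis"
  then have "\<forall>n::nat. \<exists>\<zeta>. cmod \<zeta> = 1 \<and> N (Fm \<zeta>) > real n" by (metis not_le)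
  from choice[OF this] obtain s where s: "\<And>n. cmod (s n) = 1" "\<And>n. N (Fm (s n)) > real n" by blast
  have "seq_compact (sphere (0::complex) 1)" by (simp add: compact_imp_seq_compact)
  then obtain \<zeta> r where lam: "\<zeta> \<in> sphere 0 1" and r: "strict_mono r" and lim: "(s \<circ> r) \<longlonglongrightarrow> \<zeta>"
    by (rule seq_compactE[of _ s]) (use s(1) in auto)
  have l: "cmod \<zeta> = 1" using lam by simp
  \<comment> \<open>With \<open>x\<close> the norm at \<open>s (r n)\<close>, the resolvent identity
    gives \<open>x <= N (Fm \<zeta>) + |s (r n) - \<zeta>| b x\<close>. Once the factor of
    \<open>x\<close> is below 1/2 it is absorbed, and \<open>x <= 2 N (Fm \<zeta>)\<close>
    contradicts \<open>x > r n\<close> for large \<open>n\<close>.\<close>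
  define b where "b = N Ym * N (Fm \<zeta>)"
  have b: "0 \<le> b" unfolding b_def by (intro mult_nonneg_nonneg N_nonneg Ym Fm l)
  have "(\<lambda>n. cmod ((s \<circ> r) n - \<zeta>) * b) \<longlonglongrightarrow> 0"
    using tendsto_mult_right[OF tendsto_norm[OF LIM_zero[OF lim]], of b] by simp
  from order_tendstoD(2)[OF this, of "1 / 2"]
  have "eventually (\<lambda>n. cmod (s (r n) - \<zeta>) * b < 1 / 2) sequentially" by simp
  moreover have "eventually (\<lambda>n. n \<ge> nat \<lceil>2 * N (Fm \<zeta>)\<rceil>) sequentially" by (rule eventually_ge_at_top)
  ultimately obtain n where n: "cmod (s (r n) - \<zeta>) * b < 1 / 2" "n \<ge> nat \<lceil>2 * N (Fm \<zeta>)\<rceil>"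
    using eventually_happens'[OF sequentially_bot eventually_conj] by blast
  let ?x = "N (Fm (s (r n)))"
  have x0: "0 \<le> ?x" by (intro N_nonneg Fm s)
  have "?x \<le> N (Fm \<zeta>) + cmod (s (r n) - \<zeta>) * (?x * b)"
    using N_diff_lower[OF Fm(1)[OF s(1)] Fm(1)[OF l], of "r n"] resolvent_N[OF s(1) l, of "r n"]
    by (simp add: b_def)
  also have "cmod (s (r n) - \<zeta>) * (?x * b) = (cmod (s (r n) - \<zeta>) * b) * ?x" by simp
  also have "\<dots> \<le> 1 / 2 * ?x" using n x0 by (intro mult_right_mono) auto
  finally have "?x \<le> 2 * N (Fm \<zeta>)" by simp
  also have "\<dots> \<le> real n" using n(2) by linarith
  also have "\<dots> \<le> real (r n)" using seq_suble[OF r] by simp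
  finally show False using s(2)[of "r n"] by simp
qed

section \<open>Means of the resolvent over roots of unity\<close>

text \<open>
  The average of the resolvent over the circle by repeated bisection: \<open>zm n \<theta>\<close> is the mean of \<open>Fm\<close>
  over the \<open>2^n\<close>-th roots of \<open>cis \<theta>\<close>, which equals \<open>(1 - cis \<theta> Y^(2^n))^-1\<close>.
\<close>

primrec zm :: "nat \<Rightarrow> real \<Rightarrow> 'k matrix" where
  "zm 0 \<theta> = Fm (cis \<theta>)"
| "zm (Suc n) \<theta> = (\<lambda>k l. (1 / 2) * (zm n (\<theta> / 2) k l + zm n (\<theta> / 2 + pi) k l))"

lemma zm: "zm n \<theta> \<in> \<A>"
proof (induction n arbitrary: \<theta>)
  case (Suc n)
  then show ?case unfolding zm.simps by (intro alg_scale alg_add)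
qed (simp add: Fm)

text \<open>Each level halves the angles and hence the Lipschitz constant, while averaging two
  matrices does not increase it. At level 0 the constant comes from the resolvent identity and the
  uniform bound \<open>M\<close>.\<close>

lemma zm_lipschitz:
  obtains L where "0 \<le> L" "\<And>n \<theta> \<theta>'. N (\<lambda>k l. zm n \<theta> k l - zm n \<theta>' k l) \<le> L / 2 ^ n * \<bar>\<theta> - \<theta>'\<bar>"
proof -
  obtain M where M: "\<And>\<zeta>. cmod \<zeta> = 1 \<Longrightarrow> N (Fm \<zeta>) \<le> M" using Fm_bounded by blast
  have M0: "0 \<le> M" using M[of 1] N_nonneg[OF Fm(1), of 1] by simp
  define L where "L = M * (N Ym * M)"
  have L: "0 \<le> L" unfolding L_def by (intro mult_nonneg_nonneg M0 N_nonneg Ym)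
  have "N (\<lambda>k l. zm n \<theta> k l - zm n \<theta>' k l) \<le> L / 2 ^ n * \<bar>\<theta> - \<theta>'\<bar>" for n \<theta> \<theta>'
  proof (induction n arbitrary: \<theta> \<theta>')
    case 0
    have "N (\<lambda>k l. zm 0 \<theta> k l - zm 0 \<theta>' k l)
        \<le> cmod (cis \<theta> - cis \<theta>') * (N (Fm (cis \<theta>)) * (N Ym * N (Fm (cis \<theta>'))))"
      using resolvent_N[of "cis \<theta>" "cis \<theta>'"] by simp
    also have "\<dots> \<le> \<bar>\<theta> - \<theta>'\<bar> * L"
      unfolding L_def
      by (intro mult_mono norm_cis_diff_le M mult_nonneg_nonneg N_nonneg Ym Fm M0 order_refl) auto
    finally show ?case by (simp add: mult.commute)
  next
    case (Suc n)
    let ?d1 = "\<lambda>k l. zm n (\<theta> / 2) k l - zm n (\<theta>' / 2) k l"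
    let ?d2 = "\<lambda>k l. zm n (\<theta> / 2 + pi) k l - zm n (\<theta>' / 2 + pi) k l"
    have d: "?d1 \<in> \<A>" "?d2 \<in> \<A>" by (intro alg_diff zm)+
    have "(\<lambda>k l. zm (Suc n) \<theta> k l - zm (Suc n) \<theta>' k l) = (\<lambda>k l. (1 / 2) * (?d1 k l + ?d2 k l))"
      by (simp add: algebra_simps)
    then have "N (\<lambda>k l. zm (Suc n) \<theta> k l - zm (Suc n) \<theta>' k l) = 1 / 2 * N (\<lambda>k l. ?d1 k l + ?d2 k l)"
      using N_scale[OF alg_add[OF d], of "1 / 2"] by simp
    also have "\<dots> \<le> 1 / 2 * (N ?d1 + N ?d2)" using N_add[OF d] by simp
    also have "\<dots> \<le> 1 / 2 * (L / 2 ^ n * \<bar>\<theta> / 2 - \<theta>' / 2\<bar> + L / 2 ^ n * \<bar>(\<theta> / 2 + pi) - (\<theta>' / 2 + pi)\<bar>)"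
      by (intro mult_left_mono add_mono Suc.IH) auto
    also have "\<dots> = L / 2 ^ Suc n * \<bar>\<theta> - \<theta>'\<bar>"
    proof -
      have eq: "\<bar>\<theta> / 2 - \<theta>' / 2\<bar> = \<bar>\<theta> - \<theta>'\<bar> / 2" by (simp flip: diff_divide_distrib)
      have eq': "(\<theta> / 2 + pi) - (\<theta>' / 2 + pi) = \<theta> / 2 - \<theta>' / 2" by simp
      show ?thesis unfolding eq' eq by simp
    qed
    finally show ?case .
  qed
  with L that show ?thesis by blast
qed

text \<open>Refining the nodes replaces \<open>zm n 0\<close> by its mean with
  \<open>zm n pi\<close>. These are taken at angles \<open>pi\<close> apart, hence differ by at most
  \<open>L * pi / 2^n\<close>, and the steps are summable in the norm of the algebra.\<close>

lemma zm_limit: obtains Z where "Z \<in> \<A>" "\<And>k l. (\<lambda>n. zm n 0 k l) \<longlonglongrightarrow> Z k l"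
proof -
  obtain L where L: "0 \<le> L" and lip: "\<And>n \<theta> \<theta>'. N (\<lambda>k l. zm n \<theta> k l - zm n \<theta>' k l) \<le> L / 2 ^ n * \<bar>\<theta> - \<theta>'\<bar>"
    using zm_lipschitz by blast
  define b where "b = L * pi"
  have b: "0 \<le> b" using L by (simp add: b_def)
  have step: "N (\<lambda>k l. zm (Suc n) 0 k l - zm n 0 k l) \<le> b / 2 ^ n / 2" for n
  proof -
    have "(\<lambda>k l. zm (Suc n) 0 k l - zm n 0 k l) = (\<lambda>k l. (1 / 2) * (zm n pi k l - zm n 0 k l))"
      by (simp add: algebra_simps)
    then have "N (\<lambda>k l. zm (Suc n) 0 k l - zm n 0 k l) = 1 / 2 * N (\<lambda>k l. zm n pi k l - zm n 0 k l)"
      using N_scale[OF alg_diff[OF zm zm], of "1 / 2" n pi n 0] by simp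
    then show ?thesis using lip[of n pi 0] by (simp add: b_def)
  qed
  \<comment> \<open>The bound is a difference so that it telescopes: each step costs exactly
    \<open>b / 2^n - b / 2^(n+1)\<close>.\<close>
  have dist: "N (\<lambda>k l. zm (n + j) 0 k l - zm n 0 k l) \<le> b / 2 ^ n - b / 2 ^ (n + j)" for n j
  proof (induction j)
    case 0
    then show ?case using N_zero[OF alg_diff[OF zm zm], of n 0 n 0] by simp
  next
    case (Suc j)
    have "N (\<lambda>k l. zm (n + Suc j) 0 k l - zm n 0 k l)
        \<le> N (\<lambda>k l. zm (Suc (n + j)) 0 k l - zm (n + j) 0 k l) + N (\<lambda>k l. zm (n + j) 0 k l - zm n 0 k l)"
      using N_diff_triangle[of "zm (Suc (n + j)) 0" "zm (n + j) 0" "zm n 0", OF zm zm zm]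
      by (simp del: zm.simps)
    also have "\<dots> \<le> b / 2 ^ (n + j) / 2 + (b / 2 ^ n - b / 2 ^ (n + j))"
      by (intro add_mono step Suc.IH)
    finally show ?case by simp
  qed
  have le: "N (\<lambda>k l. zm m 0 k l - zm n 0 k l) \<le> b / 2 ^ n" if "n \<le> m" for m n
  proof -
    have "0 \<le> b / 2 ^ m" using b by simp
    then show ?thesis using dist[of n "m - n"] that by simp
  qed
  have "\<exists>M. \<forall>m\<ge>M. \<forall>n\<ge>M. N (\<lambda>k l. zm m 0 k l - zm n 0 k l) < e" if e: "0 < e" for e
  proof -
    have "(\<lambda>n. b / 2 ^ n) \<longlonglongrightarrow> 0" by (rule LIMSEQ_divide_realpow_zero) simp
    then have "eventually (\<lambda>n. b / 2 ^ n < e) sequentially" using e by (rule order_tendstoD)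
    then obtain M where M: "\<And>n. n \<ge> M \<Longrightarrow> b / 2 ^ n < e" by (auto simp: eventually_sequentially)
    have "N (\<lambda>k l. zm m 0 k l - zm n 0 k l) < e" if "m \<ge> M" "n \<ge> M" for m n
    proof (cases "n \<le> m")
      case True
      then show ?thesis using le[OF True] M[OF that(2)] by simp
    next
      case False
      then show ?thesis
        using le[of m n] M[OF that(1)] N_diff_sym[OF zm zm, of m 0 n 0] by simp
    qed
    then show ?thesis by blast
  qed
  then obtain Z where "Z \<in> \<A>" "(\<lambda>n. N (\<lambda>k l. zm n 0 k l - Z k l)) \<longlonglongrightarrow> 0"
    using alg_complete[of "\<lambda>n. zm n 0"] zm by blast
  with that alg_entry_tendsto[of "\<lambda>n. zm n 0"] zm show ?thesis by blast
qed

lemma yv_pow_ell2: "c \<in> ell2 K \<Longrightarrow> (yv ^^ m) c \<in> ell2 K"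
  by (induction m) (auto intro: yv_ell2)

lemma yv_pow_lincomb:
  assumes "c \<in> ell2 K" "d \<in> ell2 K"
  shows "(yv ^^ m) (\<lambda>k. c k + a * d k) = (\<lambda>k. (yv ^^ m) c k + a * (yv ^^ m) d k)"
proof (induction m)
  case (Suc m)
  have "(yv ^^ Suc m) (\<lambda>k. c k + a * d k) = yv (\<lambda>k. (yv ^^ m) c k + a * (yv ^^ m) d k)"
    using Suc by simp
  also have "\<dots> = (\<lambda>k. yv ((yv ^^ m) c) k + a * yv ((yv ^^ m) d) k)"
    using two.mv_add[OF Ym yv_pow_ell2[OF assms(1)] ell2_scale[OF yv_pow_ell2[OF assms(2)]]]
    by (simp add: mat_vec_scale)
  finally show ?case by simp
qed simp

text \<open>Partial fractions: for \<open>X = Y^(2^n)\<close> and \<open>m^2 = cis \<theta>\<close>,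
  the mean of \<open>1 / (1 - m X)\<close> and \<open>1 / (1 + m X)\<close> is
  \<open>1 / (1 - m^2 X^2)\<close>.\<close>

lemma zm_inverse:
  "c \<in> ell2 K \<Longrightarrow> mat_vec K (zm n \<theta>) (\<lambda>k. c k - cis \<theta> * (yv ^^ (2 ^ n)) c k) = c"
proof (induction n arbitrary: \<theta> c)
  case 0
  then show ?case using Fm(2)[of "cis \<theta>" c] by simp
next
  case (Suc n)
  let ?u = "yv ^^ (2 ^ n)"
  define m where "m = cis (\<theta> / 2)"
  have m2: "m * m = cis \<theta>" by (simp add: m_def cis_mult)
  have mp: "cis (\<theta> / 2 + pi) = - m" by (simp add: m_def flip: cis_mult)
  define e where "e = (\<lambda>k. c k - cis \<theta> * (yv ^^ (2 ^ Suc n)) c k)"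
  have c: "c \<in> ell2 K" by (rule Suc.prems)
  have u: "?u c \<in> ell2 K" "?u (?u c) \<in> ell2 K" by (intro yv_pow_ell2 c)+
  have uu: "?u (?u c) = (yv ^^ (2 ^ Suc n)) c" by (simp add: mult_2 funpow_add)
  have e: "e \<in> ell2 K" unfolding e_def by (intro ell2_diff ell2_scale yv_pow_ell2 c)
  have h: "(\<lambda>k. c k + a * ?u c k) \<in> ell2 K" for a by (intro ell2_add ell2_scale u c)
  \<comment> \<open>The factorization \<open>1 - a^2 X^2 = (1 - a X) (1 + a X)\<close> holds for
    both square roots \<open>m\<close> and \<open>-m\<close>, so the induction hypothesis returns
    \<open>(1 + a X) c\<close> in either case.\<close>
  have e_eq: "e = (\<lambda>k. (c k + a * ?u c k) - a * ?u (\<lambda>k. c k + a * ?u c k) k)" if "a * a = cis \<theta>" for a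
    unfolding yv_pow_lincomb[OF c u(1)] uu e_def using that by (simp add: algebra_simps flip: mult.assoc)
  have 1: "mat_vec K (zm n (\<theta> / 2)) e = (\<lambda>k. c k + m * ?u c k)"
    using Suc.IH[OF h, of "\<theta> / 2" m] e_eq[of m] m2 by (simp add: m_def)
  have 2: "mat_vec K (zm n (\<theta> / 2 + pi)) e = (\<lambda>k. c k + (- m) * ?u c k)"
    using Suc.IH[OF h, of "\<theta> / 2 + pi" "- m"] e_eq[of "- m"] m2 unfolding mp by simp
  have "mat_vec K (zm (Suc n) \<theta>) e
      = (\<lambda>k. (1 / 2) * (mat_vec K (zm n (\<theta> / 2)) e k + mat_vec K (zm n (\<theta> / 2 + pi)) e k))"
    unfolding zm.simps mat_scale_vec by (subst two.mv_mat_add[OF zm zm e]) simp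
  then show ?case unfolding 1 2 e_def[symmetric] by simp
qed

section \<open>Limits of the means on the kernel of synthesis and the range of analysis\<close>

lemma yv_pow_ker: "c \<in> ell2 K \<Longrightarrow> \<D> c = 0 \<Longrightarrow> (yv ^^ m) c = (\<lambda>k. complex_of_real (t ^ m) * c k)"
proof (induction m)
  case (Suc m)
  have "(yv ^^ Suc m) c = yv (\<lambda>k. complex_of_real (t ^ m) * c k)" using Suc by simp
  also have "\<dots> = (\<lambda>k. complex_of_real (t ^ m) * yv c k)" by (rule mat_vec_scale)
  finally show ?case using yv_ker[OF Suc.prems] by (simp add: mult_ac)
qed simp

lemma yv_pow_analysis: "(yv ^^ m) (\<C> f) = \<C> ((U ^^ m) f)"
  by (induction m) (auto simp: yv_analysis)

lemma U_pow_norm: "norm ((U ^^ m) f) \<le> (t * \<rho>) ^ m * norm f"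
proof (induction m)
  case (Suc m)
  have "norm ((U ^^ Suc m) f) \<le> (t * \<rho>) * norm ((U ^^ m) f)" using U_norm by simp
  also have "\<dots> \<le> (t * \<rho>) * ((t * \<rho>) ^ m * norm f)" by (intro mult_left_mono Suc t)
  finally show ?case by (simp add: mult.assoc)
qed simp

lemma U_pow_diff: "(U ^^ m) (f - g) = (U ^^ m) f - (U ^^ m) g"
  by (induction m) (auto simp: U_diff)

lemma two_pow_tendsto: "filterlim (\<lambda>n::nat. (2::nat) ^ n) sequentially sequentially"
  by (rule filterlim_subseq) (simp add: strict_mono_def)

text \<open>Here \<open>Y^(2^n)\<close> is the scalar \<open>t^(2^n)\<close>, so the mean acts as
  \<open>1 / (1 - t^(2^n))\<close>, which tends to 0 because \<open>t > 1\<close>.\<close>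

lemma zm_on_kernel:
  assumes c: "c \<in> ell2 K" "\<D> c = 0"
  shows "(\<lambda>n. mat_vec K (zm n 0) c k) \<longlonglongrightarrow> 0"
proof -
  have eq: "complex_of_real (1 - t ^ (2 ^ n)) * mat_vec K (zm n 0) c k = c k" for n
  proof -
    have "(\<lambda>k. c k - cis 0 * (yv ^^ (2 ^ n)) c k) = (\<lambda>k. complex_of_real (1 - t ^ (2 ^ n)) * c k)"
      by (simp add: yv_pow_ker[OF c] left_diff_distrib)
    then have "mat_vec K (zm n 0) (\<lambda>k. complex_of_real (1 - t ^ (2 ^ n)) * c k) = c"
      using zm_inverse[OF c(1), of n 0] by simp
    then show ?thesis unfolding mat_vec_scale by (rule fun_cong)
  qed
  have ne: "complex_of_real (1 - t ^ (2 ^ n)) \<noteq> 0" for n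
    using one_less_power[OF t(1), of "2 ^ n"] by (simp del: of_real_diff of_real_power)
  have "(\<lambda>n. inverse (t ^ (2 ^ n))) \<longlonglongrightarrow> 0"
    by (rule filterlim_compose[OF LIMSEQ_inverse_realpow_zero[OF t(1)] two_pow_tendsto])
  \<comment> \<open>Numerator and denominator of \<open>1 / (1 - t^(2^n))\<close> are divided by the
    diverging power, so that both have limits.\<close>
  then have "(\<lambda>n. inverse (t ^ (2 ^ n)) / (inverse (t ^ (2 ^ n)) - 1)) \<longlonglongrightarrow> 0 / (0 - 1)"
    by (intro tendsto_intros) auto
  moreover have "inverse (t ^ (2 ^ n)) / (inverse (t ^ (2 ^ n)) - 1) = inverse (1 - t ^ (2 ^ n))" for n
    using t(1) one_less_power[OF t(1), of "2 ^ n"] by (simp add: field_simps)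
  ultimately have "(\<lambda>n. inverse (1 - t ^ (2 ^ n))) \<longlonglongrightarrow> 0" by simp
  then have "(\<lambda>n. complex_of_real (inverse (1 - t ^ (2 ^ n))) * c k) \<longlonglongrightarrow> complex_of_real 0 * c k"
    by (intro tendsto_mult tendsto_of_real tendsto_const)
  moreover have "complex_of_real (inverse (1 - t ^ (2 ^ n))) * c k = mat_vec K (zm n 0) c k" for n
    using eq[of n] ne[of n] by (simp add: field_simps)
  ultimately show ?thesis by simp
qed

end

context localized_frame
begin

text \<open>If \<open>g - U^(2^n) g = f\<close>, the mean maps the coefficients of \<open>f\<close>
  to those of \<open>g\<close>. The error consists of the coefficients of \<open>U^(2^n) g\<close>,
  which decay like \<open>(t \<rho>)^(2^n)\<close>.\<close>

lemma zm_on_range: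
  shows "(\<lambda>n. mat_vec K (zm n 0) (\<C> f) k) \<longlonglongrightarrow> \<C> f k"
proof (cases "k \<in> K")
  case False
  then show ?thesis using alg_outside[OF zm] by (simp add: mat_vec_def analysis_def)
next
  case k: True
  let ?r = "t * \<rho>"
  have "norm (mat_vec K (zm n 0) (\<C> f) k - \<C> f k) \<le> ?r ^ (2 ^ n) * (norm f / (1 - ?r) * norm (\<psi> k))" for n
  proof -
    \<comment> \<open>The exponent is at least 1; this makes the bound on \<open>g\<close>
      independent of \<open>n\<close>.\<close>
    have rn: "?r ^ (2 ^ n) \<le> ?r"
      using power_decreasing[of 1 "2 ^ n" ?r] t by simp
    obtain g where g: "g - (U ^^ (2 ^ n)) g = f" "norm g \<le> norm f / (1 - ?r ^ (2 ^ n))"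
    proof (rule contraction_solve[of "U ^^ (2 ^ n)" "?r ^ (2 ^ n)" f])
      show "0 \<le> ?r ^ (2 ^ n)" using t by simp
      show "?r ^ (2 ^ n) < 1" using rn t by linarith
    qed (rule U_pow_diff U_pow_norm that; assumption)+
    have "norm f / (1 - ?r ^ (2 ^ n)) \<le> norm f / (1 - ?r)"
      using rn t by (intro divide_left_mono) auto
    then have ng: "norm g \<le> norm f / (1 - ?r)" using g(2) by linarith
    have "\<C> f = (\<lambda>k. \<C> g k - cis 0 * (yv ^^ (2 ^ n)) (\<C> g) k)"
      by (simp add: yv_pow_analysis analysis_diff flip: g(1))
    then have "mat_vec K (zm n 0) (\<C> f) = \<C> g" using zm_inverse[OF analysis_ell2, of n 0 g] by simp
    then have "mat_vec K (zm n 0) (\<C> f) k - \<C> f k = cinner ((U ^^ (2 ^ n)) g) (\<psi> k)"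
      using k by (simp add: analysis_def cinner_diff_left flip: g(1))
    also have "norm \<dots> \<le> norm ((U ^^ (2 ^ n)) g) * norm (\<psi> k)" by (rule cmod_cinner_le)
    also have "\<dots> \<le> (?r ^ (2 ^ n) * (norm f / (1 - ?r))) * norm (\<psi> k)"
      using U_pow_norm[of "2 ^ n" g] ng t
      by (intro mult_right_mono order_trans[OF U_pow_norm] mult_left_mono) auto
    finally show ?thesis by (simp add: mult.assoc)
  qed
  note bound = this
  have "(\<lambda>n. ?r ^ (2 ^ n) * (norm f / (1 - ?r) * norm (\<psi> k))) \<longlonglongrightarrow> 0"
    using filterlim_compose[OF LIMSEQ_realpow_zero[OF t(3,2)] two_pow_tendsto]
    by (intro tendsto_mult_left_zero)
  then have "(\<lambda>n. mat_vec K (zm n 0) (\<C> f) k - \<C> f k) \<longlonglongrightarrow> 0"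
    by (rule Lim_null_comparison[OF always_eventually, rotated]) (use bound in simp)
  then show ?thesis by (rule LIM_zero_cancel)
qed

lemma synth_unit_seq: "l \<in> K \<Longrightarrow> \<D> (unit_seq l) = \<psi> l"
  using synth_fin[OF unit_seq_fin[of l K]] by (simp add: unit_seq_def)

text \<open>A unit sequence splits into a part in the range of analysis, which the means preserve in
  the limit, and a part in the kernel, which they annihilate. So the limit has the columns of
  \<open>C S^-1 D\<close>, and that is the cross-Gram matrix.\<close>

lemma dual_gram: "cross_gram K \<psi>d \<psi> \<in> \<A>"
proof -
  obtain Z where Z: "Z \<in> \<A>" and lim: "\<And>k l. (\<lambda>n. zm n 0 k l) \<longlonglongrightarrow> Z k l" using zm_limit by blast
  have "Z = cross_gram K \<psi>d \<psi>"
  proof (intro ext)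
    fix k l
    show "Z k l = cross_gram K \<psi>d \<psi> k l"
    proof (cases "k \<in> K \<and> l \<in> K")
      case False
      then show ?thesis using alg_outside[OF Z] by (auto simp: cross_gram_def)
    next
      case True
      then have l: "l \<in> K" by simp
      let ?e = "unit_seq l :: 'k \<Rightarrow> complex"
      have e: "?e \<in> ell2 K" by (rule fin_seqs_ell2[OF unit_seq_fin[OF l]])
      have dec: "?e = (\<lambda>k. \<C> (\<S>i (\<psi> l)) k + ker_part ?e k)"
        by (simp add: ker_part_def synth_unit_seq[OF l])
      have "(\<lambda>n. mat_vec K (zm n 0) (\<C> (\<S>i (\<psi> l))) k + mat_vec K (zm n 0) (ker_part ?e) k) \<longlonglongrightarrow> \<C> (\<S>i (\<psi> l)) k + 0"
        by (intro tendsto_add zm_on_range zm_on_kernel ker_part e)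
      moreover have "mat_vec K (zm n 0) (\<C> (\<S>i (\<psi> l))) k + mat_vec K (zm n 0) (ker_part ?e) k = zm n 0 k l" for n
        using fun_cong[OF two.mv_add[OF zm analysis_ell2 ker_part(1)[OF e], of n 0 "\<S>i (\<psi> l)"], of k]
          mat_vec_unit_seq[OF l, of "zm n 0" k] by (simp flip: dec)
      ultimately have "(\<lambda>n. zm n 0 k l) \<longlonglongrightarrow> \<C> (\<S>i (\<psi> l)) k" by simp
      then have "Z k l = \<C> (\<S>i (\<psi> l)) k" by (rule LIMSEQ_unique[OF lim])
      then show ?thesis using True by (simp add: cross_gram_def analysis_def cinner_dual)
    qed
  qed
  with Z show ?thesis by simp
qed


text \<open>On sequences, \<open>G + 1 - P\<close> with \<open>P = C S^-1 D\<close> is inverted by \<open>Q + 1 - P\<close> with \<open>Q = C S^-2 D\<close>.\<close>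

lemma dual_dual_gram: "cross_gram K \<psi>d \<psi>d \<in> \<A>"
proof -
  let ?P = "cross_gram K \<psi>d \<psi>"
  \<comment> \<open>Adding \<open>1 - P\<close>, which is the identity on the kernel of synthesis
    and 0 on the range of analysis, removes the kernel of \<open>G\<close>, so that
    inverse-closedness applies.\<close>
  define X where "X = (\<lambda>k l. Gm k l + (mat_one K k l - ?P k l))"
  have X: "X \<in> \<A>" unfolding X_def by (intro alg_add alg_diff Gm alg_one dual_gram)
  have Xc: "mat_vec K X c = (\<lambda>k. \<C> (\<D> c) k + (c k - \<C> (\<S>i (\<D> c)) k))" if c: "c \<in> ell2 K" for c
    unfolding X_def
    by (subst two.mv_mat_add[OF Gm alg_diff[OF alg_one dual_gram] c],
        subst two.mv_mat_diff[OF alg_one dual_gram c])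
      (simp add: two.mv_one[OF c] mat_vec_gram_synth[OF c] analysis_dual)
  have X_analysis: "mat_vec K X (\<C> f) = \<C> (\<S> f)" for f
    using Xc[OF analysis_ell2] by (simp flip: S_def)
  have X_ker: "mat_vec K X c = c" if "c \<in> ell2 K" "\<D> c = 0" for c
    using Xc[OF that(1)] that(2) by (simp add: Si_zero analysis_def)
  have DX: "\<D> (mat_vec K X c) = \<S> (\<D> c)" if c: "c \<in> ell2 K" for c
  proof -
    have "mat_vec K X c = (\<lambda>k. \<C> (\<D> c) k + ker_part c k)" by (simp add: Xc c ker_part_def)
    then show ?thesis using ker_part[OF c] by (simp add: synth_add analysis_ell2 flip: S_def)
  qed
  have inj: "c = d" if c: "c \<in> ell2 K" and d: "d \<in> ell2 K" and e: "mat_vec K X c = mat_vec K X d" for c d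
  proof -
    have "\<S> (\<D> c) = \<S> (\<D> d)" using DX[OF c] DX[OF d] e by simp
    then have "\<D> c = \<D> d" by (rule S_inj)
    then have "\<D> (\<lambda>k. c k - d k) = 0" by (simp add: synth_diff c d)
    then have "mat_vec K X (\<lambda>k. c k - d k) = (\<lambda>k. c k - d k)" by (rule X_ker[OF ell2_diff[OF c d]])
    then have "\<And>k. c k - d k = 0" using e by (simp add: two.mv_diff[OF X c d] fun_eq_iff)
    then show ?thesis by (simp add: fun_eq_iff)
  qed
  have inv: "mat_vec K X (\<lambda>k. \<C> (\<S>i (\<S>i (\<D> c))) k + ker_part c k) = c" if c: "c \<in> ell2 K" for c
    unfolding two.mv_add[OF X analysis_ell2 ker_part(1)[OF c]] X_analysis X_ker[OF ker_part[OF c]]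
    by (simp add: ker_part_def)
  have mem: "(\<lambda>k. \<C> (\<S>i (\<S>i (\<D> c))) k + ker_part c k) \<in> ell2 K" if "c \<in> ell2 K" for c
    by (intro ell2_add analysis_ell2 ker_part that)
  have "ell2 K \<subseteq> mat_vec K X ` ell2 K"
  proof
    fix c assume c: "c \<in> ell2 K"
    show "c \<in> mat_vec K X ` ell2 K" using imageI[OF mem[OF c], of "mat_vec K X"] unfolding inv[OF c] .
  qed
  moreover have "mat_vec K X ` ell2 K \<subseteq> ell2 K" using two.mv_lp[OF X] by blast
  moreover have "inj_on (mat_vec K X) (ell2 K)" by (rule inj_onI) (rule inj)
  ultimately have "bij_betw (mat_vec K X) (ell2 K) (ell2 K)" unfolding bij_betw_def by blast
  then obtain F where F: "F \<in> \<A>" and Fi: "\<And>c. c \<in> ell2 K \<Longrightarrow> mat_vec K F (mat_vec K X c) = c"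
    by (rule alg_inverse[OF X]) blast
  \<comment> \<open>\<open>F\<close> is known as a left inverse only; as \<open>c\<close> is the
    image of this explicit sequence under \<open>X\<close>, \<open>F\<close> must return that
    sequence.\<close>
  have Fc: "mat_vec K F c = (\<lambda>k. \<C> (\<S>i (\<S>i (\<D> c))) k + ker_part c k)" if c: "c \<in> ell2 K" for c
    using Fi[OF mem[OF c]] unfolding inv[OF c] .
  have "(\<lambda>k l. F k l - (mat_one K k l - ?P k l)) = cross_gram K \<psi>d \<psi>d"
  proof (intro ext)
    fix k l
    show "F k l - (mat_one K k l - ?P k l) = cross_gram K \<psi>d \<psi>d k l"
    proof (cases "k \<in> K \<and> l \<in> K")
      case False
      then show ?thesis using alg_outside[OF F] by (auto simp: cross_gram_def mat_one_def)
    next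
      case True
      then have l: "l \<in> K" by simp
      have "F k l = \<C> (\<S>i (\<S>i (\<psi> l))) k + ker_part (unit_seq l) k"
        using Fc[OF fin_seqs_ell2[OF unit_seq_fin[OF l]]] mat_vec_unit_seq[OF l, of F k]
        by (simp add: synth_unit_seq[OF l])
      moreover have "ker_part (unit_seq l) k = (if k = l then 1 else 0) - \<C> (\<S>i (\<psi> l)) k"
        unfolding ker_part_def synth_unit_seq[OF l] by (simp add: unit_seq_def)
      ultimately show ?thesis
        using True by (simp add: analysis_def cross_gram_def cinner_dual mat_one_def
            dual_frame_def[of K \<psi> l])
    qed
  qed
  moreover have "(\<lambda>k l. F k l - (mat_one K k l - ?P k l)) \<in> \<A>"
    by (intro alg_diff F alg_one dual_gram)
  ultimately show ?thesis by simp
qed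

end

section \<open>Coorbit spaces\<close>

text \<open>Exhausts the countable set by an increasing sequence of finite sets. Elements of coorbit
  spaces are classes of sequences, so a net of all finite subsets would not serve.\<close>

definition initial_part :: "'k set \<Rightarrow> nat \<Rightarrow> 'k set" where
  "initial_part K n = {k \<in> K. to_nat_on K k < n}"

definition truncate :: "'k set \<Rightarrow> nat \<Rightarrow> ('k \<Rightarrow> complex) \<Rightarrow> 'k \<Rightarrow> complex" where
  "truncate K n c = (\<lambda>k. if k \<in> initial_part K n then c k else 0)"

lemma finite_initial_part:
  assumes "countable K"
  shows "finite (initial_part K n)"
proof (rule finite_imageD)
  show "finite (to_nat_on K ` initial_part K n)"
    by (rule finite_subset[of _ "{..<n}"]) (auto simp: initial_part_def)
  show "inj_on (to_nat_on K) (initial_part K n)"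
    by (rule inj_on_subset[OF inj_on_to_nat_on[OF assms]]) (auto simp: initial_part_def)
qed

lemma truncate_fin_seqs:
  assumes "countable K"
  shows "truncate K n c \<in> fin_seqs K"
proof -
  have "{k. truncate K n c k \<noteq> 0} \<subseteq> initial_part K n" by (auto simp: truncate_def)
  then show ?thesis
    using finite_subset[OF _ finite_initial_part[OF assms]] by (auto simp: fin_seqs_def initial_part_def)
qed

lemma truncate_tendsto:
  assumes "\<And>k. k \<notin> K \<Longrightarrow> c k = 0"
  shows "(\<lambda>n. truncate K n c k) \<longlonglongrightarrow> c k"
proof (rule tendsto_eventually)
  show "eventually (\<lambda>n. truncate K n c k = c k) sequentially"
    using eventually_gt_at_top[of "to_nat_on K k"]
    by eventually_elim (use assms in \<open>auto simp: truncate_def initial_part_def\<close>)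
qed

context weighted
begin

lemma truncate_lp:
  assumes "c \<in> lp K p w"
  shows "truncate K n c \<in> lp K p w" "lp_norm K p w (truncate K n c) \<le> lp_norm K p w c"
  by (rule lp_solid[OF assms]; simp add: truncate_def)+

lemma truncate_norm_tendsto:
  assumes K: "countable K" and c: "c \<in> lp K p w" and fin: "p \<noteq> \<infinity>"
  shows "(\<lambda>n. lp_norm K p w (\<lambda>k. c k - truncate K n c k)) \<longlonglongrightarrow> 0"
proof (rule LIMSEQ_I)
  fix e :: real assume e: "0 < e"
  obtain F0 where F0: "finite F0" "F0 \<subseteq> K"
    and le: "\<And>F. finite F \<Longrightarrow> F0 \<subseteq> F \<Longrightarrow> F \<subseteq> K \<Longrightarrow>
      lp_norm K p w (\<lambda>k. c k - (if k \<in> F then c k else 0)) \<le> e / 2"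
    using lp_section_tail[OF c fin, of "e / 2"] e by auto
  define n0 where "n0 = Suc (Max (insert 0 (to_nat_on K ` F0)))"
  have "F0 \<subseteq> initial_part K n" if "n \<ge> n0" for n
  proof
    fix k assume k: "k \<in> F0"
    have "to_nat_on K k \<le> Max (insert 0 (to_nat_on K ` F0))" using F0 k by (intro Max_ge) auto
    then have "to_nat_on K k < n" using that unfolding n0_def by linarith
    then show "k \<in> initial_part K n" using k F0 by (auto simp: initial_part_def)
  qed
  then have "lp_norm K p w (\<lambda>k. c k - truncate K n c k) \<le> e / 2" if "n \<ge> n0" for n
    unfolding truncate_def
    by (intro le finite_initial_part K) (use that in \<open>auto simp: initial_part_def\<close>)
  moreover have "0 \<le> lp_norm K p w (\<lambda>k. c k - truncate K n c k)" for n
    by (intro lp_norm_nonneg lp_diff c truncate_lp)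
  ultimately have "norm (lp_norm K p w (\<lambda>k. c k - truncate K n c k) - 0) < e" if "n \<ge> n0" for n
    using that e by (simp add: order_le_less_trans[of _ "e / 2"])
  then show "\<exists>n0. \<forall>n\<ge>n0. norm (lp_norm K p w (\<lambda>k. c k - truncate K n c k) - 0) < e" by blast
qed

lemma coord_tendsto:
  assumes c: "\<And>n. c n \<in> lp K p w" and lim: "(\<lambda>n. lp_norm K p w (c n)) \<longlonglongrightarrow> 0"
  shows "(\<lambda>n. c n k) \<longlonglongrightarrow> 0"
proof (cases "k \<in> K")
  case True
  have "norm (c n k) \<le> lp_norm K p w (c n) / w k" for n
    using lp_coord[OF c True, of n] w[OF True] by (simp add: field_simps)
  moreover have "(\<lambda>n. lp_norm K p w (c n) / w k) \<longlonglongrightarrow> 0"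
    by (rule tendsto_divide_zero[OF lim])
  ultimately show ?thesis
    by (intro Lim_null_comparison[of "\<lambda>n. c n k"] always_eventually) auto
qed (use lp_supp[OF c] in simp)

end

section \<open>Finitely supported sequences and the space \<open>H00\<close>\<close>

lemma fin_seqs_add: "c \<in> fin_seqs K \<Longrightarrow> d \<in> fin_seqs K \<Longrightarrow> (\<lambda>k. c k + d k) \<in> fin_seqs K"
  by (auto simp: fin_seqs_def intro: finite_subset[of _ "{k. c k \<noteq> 0} \<union> {k. d k \<noteq> 0}"])
    (metis (mono_tags, lifting) add_0 mem_Collect_eq subset_iff)

lemma fin_seqs_scale: "c \<in> fin_seqs K \<Longrightarrow> (\<lambda>k. a * c k) \<in> fin_seqs K"
  by (auto simp: fin_seqs_def intro: finite_subset[of _ "{k. c k \<noteq> 0}"])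

lemma fin_seqs_diff: "c \<in> fin_seqs K \<Longrightarrow> d \<in> fin_seqs K \<Longrightarrow> (\<lambda>k. c k - d k) \<in> fin_seqs K"
  using fin_seqs_add[OF _ fin_seqs_scale[of d K "-1"], of c] by simp

context bessel
begin

lemma H00_synth: "c \<in> fin_seqs K \<Longrightarrow> \<D> c \<in> H00 K \<psi>"
  by (simp add: H00_def)

lemma H00E:
  assumes "f \<in> H00 K \<psi>"
  obtains c where "c \<in> fin_seqs K" "f = \<D> c"
  using assms by (auto simp: H00_def)

lemma H00_add:
  assumes "f \<in> H00 K \<psi>" "g \<in> H00 K \<psi>"
  shows "f + g \<in> H00 K \<psi>"
proof -
  obtain c where c: "c \<in> fin_seqs K" "f = \<D> c" by (rule H00E[OF assms(1)])
  obtain d where d: "d \<in> fin_seqs K" "g = \<D> d" by (rule H00E[OF assms(2)])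
  show ?thesis
    using H00_synth[OF fin_seqs_add[OF c(1) d(1)]]
    by (simp add: synth_add fin_seqs_ell2 c d)
qed

lemma H00_cscale:
  assumes "f \<in> H00 K \<psi>"
  shows "cscale a f \<in> H00 K \<psi>"
proof -
  obtain c where c: "c \<in> fin_seqs K" "f = \<D> c" by (rule H00E[OF assms(1)])
  show ?thesis
    using H00_synth[OF fin_seqs_scale[OF c(1)]] by (simp add: synth_scale fin_seqs_ell2 c)
qed

end

section \<open>Identification of a coorbit space with sequences fixed by \<open>P\<close>\<close>

locale coorbit_space = localized_frame K \<A> N \<psi> B A + action K \<A> N p w
  for K :: "'k set" and \<A> N and \<psi> :: "'k \<Rightarrow> 'h::complex_hilbert" and B A p w +
  assumes bdd_inf: "\<And>X. X \<in> \<A> \<Longrightarrow> bounded_on_lp K \<infinity> w X" and count: "countable K"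
begin

abbreviation "\<C>d \<equiv> analysis K \<psi>d"
abbreviation "nrm \<equiv> lp_norm K p w"
abbreviation "Pm \<equiv> cross_gram K \<psi>d \<psi>"
abbreviation "seqs \<equiv> coorbit_seqs K \<psi> p w"

text \<open>The coefficients identify the coorbit space isometrically with this subspace of the sequence space.\<close>

definition coeffs :: "('k \<Rightarrow> complex) set" where
  "coeffs = {c \<in> lp K p w. mat_vec K Pm c = c}"

lemma coeffsD: "c \<in> coeffs \<Longrightarrow> c \<in> lp K p w" "c \<in> coeffs \<Longrightarrow> mat_vec K Pm c = c"
  by (simp_all add: coeffs_def)

text \<open>The formula of \<open>coorbit_coeff\<close> for a given representative, so that classes
  can be described without a choice.\<close>

definition clim :: "(nat \<Rightarrow> 'h) \<Rightarrow> 'k \<Rightarrow> complex" where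
  "clim f = (\<lambda>k. if k \<in> K then lim (\<lambda>n. cinner (f n) (\<psi>d k)) else 0)"

definition cls :: "('k \<Rightarrow> complex) \<Rightarrow> (nat \<Rightarrow> 'h) set" where
  "cls c = {f \<in> seqs. clim f = c}"

lemma dual_coeff_synth: "c \<in> fin_seqs K \<Longrightarrow> \<C>d (\<D> c) = mat_vec K Pm c"
  by (simp add: mat_vec_gram_synth fin_seqs_ell2)

lemma Pm_dual_coeff: "mat_vec K Pm (\<C>d f) = \<C>d f"
  by (rule mat_vec_gram_dual)

lemma H00_coeff_lp: "f \<in> H00 K \<psi> \<Longrightarrow> \<C>d f \<in> lp K p w"
  unfolding H00_def using mv_lp[OF dual_gram] fin_seqs_lp dual_coeff_synth by force

lemma clim_eqI:
  assumes "\<And>k. (\<lambda>n. \<C>d (f n) k) \<longlonglongrightarrow> c k"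
  shows "clim f = c"
proof
  fix k
  show "clim f k = c k"
  proof (cases "k \<in> K")
    case True
    then show ?thesis using limI[OF assms[of k]] by (simp add: clim_def analysis_def)
  next
    case False
    then have "(\<lambda>n. 0) \<longlonglongrightarrow> c k" using assms[of k] by (simp add: analysis_def)
    then have "c k = 0" using LIMSEQ_unique tendsto_const by blast
    then show ?thesis using False by (simp add: clim_def)
  qed
qed

lemma seqs_lp: "f \<in> seqs \<Longrightarrow> \<C>d (f n) \<in> lp K p w"
  using H00_coeff_lp by (cases "p = \<infinity>") (auto simp: coorbit_seqs_def)

lemma seqs_diff_le: "f \<in> seqs \<Longrightarrow> p \<noteq> \<infinity> \<Longrightarrow> 0 < e \<Longrightarrow>
    \<exists>M. \<forall>m\<ge>M. \<forall>n\<ge>M. nrm (\<lambda>k. \<C>d (f m) k - \<C>d (f n) k) < e"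
  by (auto simp: coorbit_seqs_def pre_norm_def analysis_diff)

lemma seqs_bounded:
  assumes f: "f \<in> seqs"
  obtains C where "\<And>n. nrm (\<C>d (f n)) \<le> C"
proof (cases "p = \<infinity>")
  case True
  then show ?thesis using f that by (auto simp: coorbit_seqs_def pre_norm_def)
next
  case False
  have "Cauchy (\<lambda>n. nrm (\<C>d (f n)))"
  proof (rule metric_CauchyI)
    fix e :: real assume "0 < e"
    then obtain M where M: "\<And>m n. m \<ge> M \<Longrightarrow> n \<ge> M \<Longrightarrow> nrm (\<lambda>k. \<C>d (f m) k - \<C>d (f n) k) < e"
      using seqs_diff_le[OF f False] by blast
    have "dist (nrm (\<C>d (f m))) (nrm (\<C>d (f n))) < e" if "m \<ge> M" "n \<ge> M" for m n
      using lp_norm_diff_ge[OF seqs_lp[OF f] seqs_lp[OF f], of m n] M[OF that]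
      by (simp add: dist_real_def)
    then show "\<exists>M. \<forall>m\<ge>M. \<forall>n\<ge>M. dist (nrm (\<C>d (f m))) (nrm (\<C>d (f n))) < e" by blast
  qed
  then have "Bseq (\<lambda>n. nrm (\<C>d (f n)))" by (rule Cauchy_Bseq)
  then obtain C where "\<And>n. norm (nrm (\<C>d (f n))) \<le> C" unfolding Bseq_def by blast
  then have "\<And>n. nrm (\<C>d (f n)) \<le> C" by (simp add: abs_le_iff)
  then show ?thesis by (rule that)
qed

lemma seqs_tendsto:
  assumes f: "f \<in> seqs"
  shows "(\<lambda>n. \<C>d (f n) k) \<longlonglongrightarrow> clim f k"
proof (cases "k \<in> K")
  case False
  then show ?thesis by (simp add: analysis_def clim_def)
next
  case k: True
  have "convergent (\<lambda>n. cinner (f n) (\<psi>d k))"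
  proof (cases "p = \<infinity>")
    case True
    then show ?thesis using f k by (auto simp: coorbit_seqs_def)
  next
    case False
    have "Cauchy (\<lambda>n. \<C>d (f n) k)"
    proof (rule metric_CauchyI)
      fix e :: real assume "0 < e"
      then have "0 < e * w k" using w[OF k] by simp
      then obtain M where M: "\<And>m n. m \<ge> M \<Longrightarrow> n \<ge> M \<Longrightarrow> nrm (\<lambda>k. \<C>d (f m) k - \<C>d (f n) k) < e * w k"
        using seqs_diff_le[OF f False] by blast
      have "dist (\<C>d (f m) k) (\<C>d (f n) k) < e" if "m \<ge> M" "n \<ge> M" for m n
      proof -
        have "w k * cmod (\<C>d (f m) k - \<C>d (f n) k) < w k * e"
          using lp_coord[OF lp_diff(1)[OF seqs_lp[OF f] seqs_lp[OF f]] k, of m n] M[OF that]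
          by (simp add: mult.commute)
        then show ?thesis using w[OF k] by (simp add: dist_norm)
      qed
      then show "\<exists>M. \<forall>m\<ge>M. \<forall>n\<ge>M. dist (\<C>d (f m) k) (\<C>d (f n) k) < e" by blast
    qed
    then show ?thesis using k by (simp add: analysis_def Cauchy_convergent_iff)
  qed
  then show ?thesis using k by (simp add: analysis_def clim_def convergent_LIMSEQ_iff)
qed

text \<open>In the Cauchy estimate \<open>n\<close> is fixed and \<open>m\<close> tends to infinity;
  \<open>lp_limit\<close> keeps the bound.\<close>

lemma seqs_norm_tendsto:
  assumes f: "f \<in> seqs" and fin: "p \<noteq> \<infinity>"
  shows "(\<lambda>n. nrm (\<lambda>k. \<C>d (f n) k - clim f k)) \<longlonglongrightarrow> 0"
proof (rule LIMSEQ_I)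
  fix e :: real assume e: "0 < e"
  obtain M where M: "\<And>m n. m \<ge> M \<Longrightarrow> n \<ge> M \<Longrightarrow> nrm (\<lambda>k. \<C>d (f m) k - \<C>d (f n) k) < e / 2"
    using seqs_diff_le[OF f fin, of "e / 2"] e by auto
  have "norm (nrm (\<lambda>k. \<C>d (f n) k - clim f k) - 0) < e" if n: "n \<ge> M" for n
  proof -
    note lim = lp_limit[of "\<lambda>m k. \<C>d (f n) k - \<C>d (f m) k" "\<lambda>k. \<C>d (f n) k - clim f k" sequentially "e / 2"]
    have ev: "eventually (\<lambda>m. (\<lambda>k. \<C>d (f n) k - \<C>d (f m) k) \<in> lp K p w
        \<and> nrm (\<lambda>k. \<C>d (f n) k - \<C>d (f m) k) \<le> e / 2) sequentially"
      using eventually_ge_at_top[of M]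
      by eventually_elim (use M[OF n] lp_diff(1)[OF seqs_lp[OF f] seqs_lp[OF f]] in \<open>auto intro: less_imp_le\<close>)
    have tl: "(\<lambda>m. \<C>d (f n) k - \<C>d (f m) k) \<longlonglongrightarrow> \<C>d (f n) k - clim f k" for k
      by (intro tendsto_diff tendsto_const seqs_tendsto f)
    have sp: "\<C>d (f n) k - clim f k = 0" if "k \<notin> K" for k
      using that by (simp add: analysis_def clim_def)
    have "nrm (\<lambda>k. \<C>d (f n) k - clim f k) \<le> e / 2"
      "0 \<le> nrm (\<lambda>k. \<C>d (f n) k - clim f k)"
      using lim[OF tl _ ev sp] lp_norm_nonneg by auto
    then show ?thesis using e by simp
  qed
  then show "\<exists>M. \<forall>n\<ge>M. norm (nrm (\<lambda>k. \<C>d (f n) k - clim f k) - 0) < e" by blast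
qed

text \<open>Every coefficient sequence of a vector is fixed by \<open>P\<close>, and
  \<open>P\<close> commutes with bounded pointwise limits.\<close>

lemma clim_coeffs:
  assumes f: "f \<in> seqs"
  shows "clim f \<in> coeffs"
proof -
  obtain C where C: "\<And>n. nrm (\<C>d (f n)) \<le> C" by (rule seqs_bounded[OF f]) blast
  have lp: "clim f \<in> lp K p w"
    by (rule lp_limit(1)[where C = C, OF seqs_tendsto[OF f] sequentially_bot])
      (auto simp: C seqs_lp[OF f] clim_def)
  have "mat_vec K Pm (clim f) = clim f"
  proof
    fix k
    have "(\<lambda>n. mat_vec K Pm (\<C>d (f n)) k) \<longlonglongrightarrow> mat_vec K Pm (clim f) k"
      by (rule mv_pointwise_limit[OF dual_gram bdd_inf[OF alg_abs[OF dual_gram]] seqs_lp[OF f] C seqs_tendsto[OF f]])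
    then show "mat_vec K Pm (clim f) k = clim f k"
      unfolding Pm_dual_coeff by (rule LIMSEQ_unique[OF _ seqs_tendsto[OF f]])
  qed
  with lp show ?thesis by (simp add: coeffs_def)
qed

text \<open>The synthesized truncations of \<open>c\<close> have coefficients
  \<open>P (truncate K n c)\<close>, which converge pointwise to \<open>P c = c\<close>. For
  \<open>p = \<infinity>\<close> their boundedness is enough; for finite \<open>p\<close>
  truncations converge in norm, and boundedness of \<open>P\<close> gives the Cauchy
  property.\<close>

lemma coeffs_attained:
  assumes c: "c \<in> coeffs"
  obtains f where "f \<in> seqs" "clim f = c"
proof -
  have lp: "c \<in> lp K p w" and P: "mat_vec K Pm c = c" using c by (auto simp: coeffs_def)
  define f where "f n = \<D> (truncate K n c)" for n
  have Cf: "\<C>d (f n) = mat_vec K Pm (truncate K n c)" for n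
    unfolding f_def by (intro dual_coeff_synth truncate_fin_seqs count)
  have Clp: "\<C>d (f n) \<in> lp K p w" for n unfolding Cf by (intro mv_lp dual_gram truncate_lp lp)
  obtain D where D: "0 \<le> D" "\<And>c. c \<in> lp K p w \<Longrightarrow> nrm (mat_vec K Pm c) \<le> D * nrm c"
    by (rule mv_bound[OF dual_gram]) blast
  have bd: "nrm (\<C>d (f n)) \<le> D * nrm c" for n
    unfolding Cf using D(2)[OF truncate_lp(1)[OF lp]] mult_left_mono[OF truncate_lp(2)[OF lp] D(1)]
    by (rule order_trans)
  have tl: "(\<lambda>n. \<C>d (f n) k) \<longlonglongrightarrow> c k" for k
    using mv_pointwise_limit[OF dual_gram bdd_inf[OF alg_abs[OF dual_gram]]
        truncate_lp(1)[OF lp] truncate_lp(2)[OF lp] truncate_tendsto[OF lp_supp[OF lp]], of k]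
    by (simp add: Cf P)
  have "f \<in> seqs"
  proof (cases "p = \<infinity>")
    case True
    have "convergent (\<lambda>n. cinner (f n) (\<psi>d k))" if "k \<in> K" for k
      using tl[of k] that by (auto simp: analysis_def convergent_def)
    then show ?thesis using True Clp bd by (auto simp: coorbit_seqs_def pre_norm_def)
  next
    case False
    have "\<exists>M. \<forall>m\<ge>M. \<forall>n\<ge>M. pre_norm K \<psi> p w (f m - f n) < e" if e: "0 < e" for e
    proof -
      have "(\<lambda>n. D * nrm (\<lambda>k. c k - truncate K n c k)) \<longlonglongrightarrow> D * 0"
        by (intro tendsto_mult tendsto_const truncate_norm_tendsto count lp False)
      then have "eventually (\<lambda>n. D * nrm (\<lambda>k. c k - truncate K n c k) < e / 2) sequentially"
        using e by (intro order_tendstoD(2)) auto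
      then obtain M where M: "\<And>n. n \<ge> M \<Longrightarrow> D * nrm (\<lambda>k. c k - truncate K n c k) < e / 2"
        by (auto simp: eventually_sequentially)
      have "pre_norm K \<psi> p w (f m - f n) < e" if "m \<ge> M" "n \<ge> M" for m n
      proof -
        let ?a = "\<lambda>m k. c k - truncate K m c k"
        have a: "?a m \<in> lp K p w" for m by (intro lp_diff lp truncate_lp)
        \<comment> \<open>Two truncations differ as their tails do, and only the tails are known to
          be small.\<close>
        have eq: "(\<lambda>k. truncate K m c k - truncate K n c k) = (\<lambda>k. ?a n k - ?a m k)" by simp
        have "\<C>d (f m - f n) = mat_vec K Pm (\<lambda>k. ?a n k - ?a m k)"
          unfolding analysis_diff Cf eq[symmetric]
          by (simp add: mv_diff[OF dual_gram truncate_lp(1)[OF lp] truncate_lp(1)[OF lp]])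
        then have "pre_norm K \<psi> p w (f m - f n) \<le> D * nrm (\<lambda>k. ?a n k - ?a m k)"
          unfolding pre_norm_def using D(2)[OF lp_diff(1)[OF a a]] by simp
        also have "\<dots> \<le> D * (nrm (?a n) + nrm (?a m))"
          by (intro mult_left_mono lp_diff a D)
        also have "\<dots> < e" using M[OF that(1)] M[OF that(2)] by (simp add: distrib_left)
        finally show ?thesis .
      qed
      then show ?thesis by blast
    qed
    moreover have "f n \<in> H00 K \<psi>" for n unfolding f_def by (intro H00_synth truncate_fin_seqs count)
    ultimately show ?thesis using False by (simp add: coorbit_seqs_def)
  qed
  then show ?thesis using that clim_eqI[OF tl] by blast
qed

text \<open>For \<open>p = \<infinity>\<close> the relation speaks of pointwise limits from the
  outset. For finite \<open>p\<close>, representatives converge in norm to their limits, so a null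
  difference and equal limits are the same.\<close>

lemma rel_iff:
  "(f, g) \<in> coorbit_rel K \<psi> p w \<longleftrightarrow> f \<in> seqs \<and> g \<in> seqs \<and> clim f = clim g"
proof (cases "f \<in> seqs \<and> g \<in> seqs")
  case False
  then show ?thesis by (auto simp: coorbit_rel_def)
next
  case True
  then have f: "f \<in> seqs" and g: "g \<in> seqs" by auto
  have d: "(\<lambda>n. \<C>d (f n - g n) k) \<longlonglongrightarrow> clim f k - clim g k" for k
    unfolding analysis_diff by (intro tendsto_diff seqs_tendsto f g)
  have dlp: "\<C>d (f n - g n) \<in> lp K p w" for n
    unfolding analysis_diff by (intro lp_diff seqs_lp f g)
  have eqI: "clim f = clim g" if z: "\<And>k. k \<in> K \<Longrightarrow> (\<lambda>n. \<C>d (f n - g n) k) \<longlonglongrightarrow> 0"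
  proof
    fix k
    show "clim f k = clim g k"
    proof (cases "k \<in> K")
      case True
      show ?thesis using LIMSEQ_unique[OF d z[OF True]] by simp
    qed (simp add: clim_def)
  qed
  show ?thesis
  proof (cases "p = \<infinity>")
    case True
    have "(\<forall>k\<in>K. (\<lambda>n. cinner (f n - g n) (\<psi>d k)) \<longlonglongrightarrow> 0) \<longleftrightarrow> clim f = clim g"
    proof
      assume "\<forall>k\<in>K. (\<lambda>n. cinner (f n - g n) (\<psi>d k)) \<longlonglongrightarrow> 0"
      then show "clim f = clim g" by (intro eqI) (simp add: analysis_def)
    next
      assume "clim f = clim g"
      then have z: "(\<lambda>n. \<C>d (f n - g n) k) \<longlonglongrightarrow> 0" for k using d[of k] by simp
      show "\<forall>k\<in>K. (\<lambda>n. cinner (f n - g n) (\<psi>d k)) \<longlonglongrightarrow> 0"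
      proof
        fix k assume "k \<in> K"
        then show "(\<lambda>n. cinner (f n - g n) (\<psi>d k)) \<longlonglongrightarrow> 0" using z[of k] by (simp add: analysis_def)
      qed
    qed
    then show ?thesis using True f g by (simp add: coorbit_rel_def)
  next
    case False
    have "(\<lambda>n. pre_norm K \<psi> p w (f n - g n)) \<longlonglongrightarrow> 0 \<longleftrightarrow> clim f = clim g"
    proof
      assume z: "(\<lambda>n. pre_norm K \<psi> p w (f n - g n)) \<longlonglongrightarrow> 0"
      show "clim f = clim g"
        by (rule eqI) (rule coord_tendsto[OF dlp z[unfolded pre_norm_def]])
    next
      assume e: "clim f = clim g"
      have clp: "clim g \<in> lp K p w" using clim_coeffs[OF g] by (simp add: coeffs_def)
      let ?a = "\<lambda>n k. \<C>d (f n) k - clim g k" and ?b = "\<lambda>n k. \<C>d (g n) k - clim g k"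
      have a: "?a n \<in> lp K p w" and b: "?b n \<in> lp K p w" for n by (intro lp_diff seqs_lp f g clp)+
      have le: "pre_norm K \<psi> p w (f n - g n) \<le> nrm (?a n) + nrm (?b n)" for n
        using lp_diff(2)[OF a[of n] b[of n]] by (simp add: pre_norm_def analysis_diff)
      have lim: "(\<lambda>n. nrm (?a n) + nrm (?b n)) \<longlonglongrightarrow> 0 + 0"
        using seqs_norm_tendsto[OF f False] seqs_norm_tendsto[OF g False] unfolding e
        by (rule tendsto_add)
      show "(\<lambda>n. pre_norm K \<psi> p w (f n - g n)) \<longlonglongrightarrow> 0"
      proof (rule tendsto_sandwich[OF _ _ tendsto_const])
        show "\<forall>\<^sub>F n in sequentially. 0 \<le> pre_norm K \<psi> p w (f n - g n)"
          unfolding pre_norm_def by (intro always_eventually allI lp_norm_nonneg dlp)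
        show "\<forall>\<^sub>F n in sequentially. pre_norm K \<psi> p w (f n - g n) \<le> nrm (?a n) + nrm (?b n)"
          by (intro always_eventually allI le)
        show "(\<lambda>n. nrm (?a n) + nrm (?b n)) \<longlonglongrightarrow> 0" using lim by simp
      qed
    qed
    then show ?thesis using False f g by (simp add: coorbit_rel_def)
  qed
qed

lemma rel_image: "f \<in> seqs \<Longrightarrow> coorbit_rel K \<psi> p w `` {f} = cls (clim f)"
  by (auto simp: rel_iff cls_def)

lemma coorbit_eq: "coorbit K \<psi> p w = cls ` coeffs"
proof
  show "coorbit K \<psi> p w \<subseteq> cls ` coeffs"
    unfolding coorbit_def by (auto elim!: quotientE simp: rel_image intro!: imageI clim_coeffs)
  show "cls ` coeffs \<subseteq> coorbit K \<psi> p w"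
  proof
    fix X assume "X \<in> cls ` coeffs"
    then obtain c where c: "c \<in> coeffs" "X = cls c" by blast
    obtain f where "f \<in> seqs" "clim f = c" by (rule coeffs_attained[OF c(1)])
    then show "X \<in> coorbit K \<psi> p w"
      unfolding coorbit_def c(2) using quotientI[of f seqs] rel_image[of f] by metis
  qed
qed

text \<open>\<open>coorbit_coeff\<close> and \<open>coorbit_norm\<close> choose a representative;
  the choice is harmless because the limit is constant on a class.\<close>

lemma some_cls:
  assumes "c \<in> coeffs"
  shows "(SOME f. f \<in> cls c) \<in> seqs" "clim (SOME f. f \<in> cls c) = c"
proof -
  obtain f where "f \<in> cls c" using coeffs_attained[OF assms] unfolding cls_def by blast
  then have "(SOME f. f \<in> cls c) \<in> cls c" by (rule someI[of "\<lambda>f. f \<in> cls c"])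
  then show "(SOME f. f \<in> cls c) \<in> seqs" "clim (SOME f. f \<in> cls c) = c" by (auto simp: cls_def)
qed

lemma coeff_cls: "c \<in> coeffs \<Longrightarrow> coorbit_coeff K \<psi> (cls c) = c"
  using some_cls(2)[of c] by (simp add: coorbit_coeff_def clim_def)

lemma norm_cls:
  assumes c: "c \<in> coeffs"
  shows "coorbit_norm K \<psi> p w (cls c) = nrm c"
proof (cases "p = \<infinity>")
  case True
  then show ?thesis using coeff_cls[OF c] by (simp add: coorbit_norm_def)
next
  case False
  let ?f = "SOME f. f \<in> cls c"
  have clp: "c \<in> lp K p w" using c by (simp add: coeffs_def)
  note f = some_cls[OF c]
  have z: "(\<lambda>n. nrm (\<lambda>k. \<C>d (?f n) k - c k)) \<longlonglongrightarrow> 0"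
    using seqs_norm_tendsto[OF f(1) False] unfolding f(2) .
  have "(\<lambda>n. nrm (\<C>d (?f n)) - nrm c) \<longlonglongrightarrow> 0"
    by (rule Lim_null_comparison[OF always_eventually z])
      (use lp_norm_diff_ge[OF seqs_lp[OF f(1)] clp] in simp)
  then have "(\<lambda>n. nrm (\<C>d (?f n))) \<longlonglongrightarrow> nrm c" by (rule LIM_zero_cancel)
  then show ?thesis using False by (simp add: coorbit_norm_def pre_norm_def limI)
qed

section \<open>Vector space operations on classes\<close>

lemma coeffs_add: "c \<in> coeffs \<Longrightarrow> d \<in> coeffs \<Longrightarrow> (\<lambda>k. c k + d k) \<in> coeffs"
  by (simp add: coeffs_def lp_add mv_add[OF dual_gram])

lemma coeffs_scale: "c \<in> coeffs \<Longrightarrow> (\<lambda>k. a * c k) \<in> coeffs"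
  by (simp add: coeffs_def lp_scale mat_vec_scale)

lemma seqs_add:
  assumes f: "f \<in> seqs" and g: "g \<in> seqs"
  shows "(\<lambda>n. f n + g n) \<in> seqs" "clim (\<lambda>n. f n + g n) = (\<lambda>k. clim f k + clim g k)"
proof -
  have tl: "(\<lambda>n. \<C>d (f n + g n) k) \<longlonglongrightarrow> clim f k + clim g k" for k
    unfolding analysis_add by (intro tendsto_add seqs_tendsto f g)
  then show "clim (\<lambda>n. f n + g n) = (\<lambda>k. clim f k + clim g k)" by (rule clim_eqI)
  show "(\<lambda>n. f n + g n) \<in> seqs"
  proof (cases "p = \<infinity>")
    case True
    obtain C where C: "\<And>n. nrm (\<C>d (f n)) \<le> C" by (rule seqs_bounded[OF f]) blast
    obtain D where D: "\<And>n. nrm (\<C>d (g n)) \<le> D" by (rule seqs_bounded[OF g]) blast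
    have "nrm (\<C>d (f n + g n)) \<le> C + D" for n
      unfolding analysis_add
      using lp_add(2)[OF seqs_lp[OF f] seqs_lp[OF g], of n n] C[of n] D[of n] by linarith
    moreover have "\<C>d (f n + g n) \<in> lp K p w" for n
      unfolding analysis_add by (intro lp_add seqs_lp f g)
    moreover have "convergent (\<lambda>n. cinner (f n + g n) (\<psi>d k))" if "k \<in> K" for k
      using tl[of k] that by (auto simp: analysis_def convergent_def)
    ultimately show ?thesis using True by (auto simp: coorbit_seqs_def pre_norm_def)
  next
    case False
    have "\<exists>M. \<forall>m\<ge>M. \<forall>n\<ge>M. pre_norm K \<psi> p w ((f m + g m) - (f n + g n)) < e" if e: "0 < e" for e
    proof -
      obtain M where M: "\<And>m n. m \<ge> M \<Longrightarrow> n \<ge> M \<Longrightarrow> nrm (\<lambda>k. \<C>d (f m) k - \<C>d (f n) k) < e / 2"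
        using seqs_diff_le[OF f False, of "e / 2"] e by auto
      obtain M' where M': "\<And>m n. m \<ge> M' \<Longrightarrow> n \<ge> M' \<Longrightarrow> nrm (\<lambda>k. \<C>d (g m) k - \<C>d (g n) k) < e / 2"
        using seqs_diff_le[OF g False, of "e / 2"] e by auto
      have "pre_norm K \<psi> p w ((f m + g m) - (f n + g n)) < e"
        if "m \<ge> max M M'" "n \<ge> max M M'" for m n
      proof -
        have eq: "(f m + g m) - (f n + g n) = (f m - f n) + (g m - g n)" by simp
        have "pre_norm K \<psi> p w ((f m + g m) - (f n + g n))
            \<le> nrm (\<lambda>k. \<C>d (f m) k - \<C>d (f n) k) + nrm (\<lambda>k. \<C>d (g m) k - \<C>d (g n) k)"
          unfolding eq pre_norm_def analysis_add analysis_diff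
          by (intro lp_add lp_diff seqs_lp f g)
        also have "\<dots> < e" using M[of m n] M'[of m n] that by simp
        finally show ?thesis .
      qed
      then show ?thesis by blast
    qed
    moreover have "f n + g n \<in> H00 K \<psi>" for n
      using f g False by (intro H00_add) (auto simp: coorbit_seqs_def)
    ultimately show ?thesis using False by (simp add: coorbit_seqs_def)
  qed
qed

lemma seqs_cscale:
  assumes f: "f \<in> seqs"
  shows "(\<lambda>n. cscale a (f n)) \<in> seqs" "clim (\<lambda>n. cscale a (f n)) = (\<lambda>k. a * clim f k)"
proof -
  have tl: "(\<lambda>n. \<C>d (cscale a (f n)) k) \<longlonglongrightarrow> a * clim f k" for k
    unfolding analysis_cscale by (intro tendsto_mult tendsto_const seqs_tendsto f)
  then show "clim (\<lambda>n. cscale a (f n)) = (\<lambda>k. a * clim f k)" by (rule clim_eqI)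
  show "(\<lambda>n. cscale a (f n)) \<in> seqs"
  proof (cases "p = \<infinity>")
    case True
    obtain C where C: "\<And>n. nrm (\<C>d (f n)) \<le> C" by (rule seqs_bounded[OF f]) blast
    have "nrm (\<C>d (cscale a (f n))) \<le> cmod a * C" for n
      unfolding analysis_cscale
      using lp_scale(2)[OF seqs_lp[OF f], of a n] mult_left_mono[OF C[of n], of "cmod a"]
      by simp
    moreover have "\<C>d (cscale a (f n)) \<in> lp K p w" for n
      unfolding analysis_cscale by (intro lp_scale seqs_lp f)
    moreover have "convergent (\<lambda>n. cinner (cscale a (f n)) (\<psi>d k))" if "k \<in> K" for k
      using tl[of k] that by (auto simp: analysis_def convergent_def)
    ultimately show ?thesis using True by (auto simp: coorbit_seqs_def pre_norm_def)
  next
    case False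
    have "\<exists>M. \<forall>m\<ge>M. \<forall>n\<ge>M. pre_norm K \<psi> p w (cscale a (f m) - cscale a (f n)) < e" if e: "0 < e" for e
    proof -
      \<comment> \<open>The summand 1 covers \<open>a = 0\<close>.\<close>
      have e': "0 < e / (cmod a + 1)" using e by (simp add: add_nonneg_pos)
      obtain M where M: "\<And>m n. m \<ge> M \<Longrightarrow> n \<ge> M \<Longrightarrow>
          nrm (\<lambda>k. \<C>d (f m) k - \<C>d (f n) k) < e / (cmod a + 1)"
        using seqs_diff_le[OF f False e'] by blast
      have "pre_norm K \<psi> p w (cscale a (f m) - cscale a (f n)) < e" if "m \<ge> M" "n \<ge> M" for m n
      proof -
        let ?x = "nrm (\<lambda>k. \<C>d (f m) k - \<C>d (f n) k)"
        have "pre_norm K \<psi> p w (cscale a (f m) - cscale a (f n)) \<le> cmod a * ?x"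
          unfolding cscale_diff_right[symmetric] pre_norm_def analysis_cscale analysis_diff
          by (intro lp_scale lp_diff seqs_lp f)
        also have "\<dots> \<le> (cmod a + 1) * ?x"
          by (intro mult_right_mono lp_norm_nonneg lp_diff seqs_lp f) simp
        also have "\<dots> < e"
        proof -
          have "0 < cmod a + 1" by (simp add: add_nonneg_pos)
          then show ?thesis using M[OF that] by (simp add: pos_less_divide_eq mult.commute)
        qed
        finally show ?thesis .
      qed
      then show ?thesis by blast
    qed
    moreover have "cscale a (f n) \<in> H00 K \<psi>" for n
      using f False by (intro H00_cscale) (auto simp: coorbit_seqs_def)
    ultimately show ?thesis using False by (simp add: coorbit_seqs_def)
  qed
qed

text \<open>All pairs of representatives yield the same class, so the union in
  \<open>coorbit_add\<close> collapses; non-emptiness of the classes keeps it from being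
  empty.\<close>

lemma add_cls:
  assumes c: "c \<in> coeffs" and d: "d \<in> coeffs"
  shows "coorbit_add K \<psi> p w (cls c) (cls d) = cls (\<lambda>k. c k + d k)"
proof -
  have "coorbit_rel K \<psi> p w `` {\<lambda>n. f n + g n} = cls (\<lambda>k. c k + d k)" if "f \<in> cls c" "g \<in> cls d" for f g
    using rel_image[OF seqs_add(1)] seqs_add(2) that by (auto simp: cls_def)
  moreover have "cls c \<noteq> {}" "cls d \<noteq> {}"
    using coeffs_attained[OF c] coeffs_attained[OF d] unfolding cls_def by blast+
  ultimately show ?thesis unfolding coorbit_add_def by simp
qed

lemma scale_cls:
  assumes c: "c \<in> coeffs"
  shows "coorbit_scale K \<psi> p w a (cls c) = cls (\<lambda>k. a * c k)"
proof -
  have "coorbit_rel K \<psi> p w `` {\<lambda>n. cscale a (f n)} = cls (\<lambda>k. a * c k)" if "f \<in> cls c" for f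
    using rel_image[OF seqs_cscale(1)] seqs_cscale(2) that by (auto simp: cls_def)
  moreover have "cls c \<noteq> {}"
    using coeffs_attained[OF c] unfolding cls_def by blast
  ultimately show ?thesis unfolding coorbit_scale_def by simp
qed

lemma embed_H00:
  assumes f: "f \<in> H00 K \<psi>"
  shows "\<C>d f \<in> coeffs" "coorbit_embed K \<psi> p w f = cls (\<C>d f)"
proof -
  show "\<C>d f \<in> coeffs" using H00_coeff_lp[OF f] Pm_dual_coeff by (simp add: coeffs_def)
  have "(\<lambda>_. f) \<in> seqs"
    using H00_coeff_lp[OF f] f by (auto simp: coorbit_seqs_def pre_norm_def analysis_diff convergent_const)
  moreover have "clim (\<lambda>_. f) = \<C>d f" by (rule clim_eqI) simp
  ultimately show "coorbit_embed K \<psi> p w f = cls (\<C>d f)"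
    unfolding coorbit_embed_def using rel_image by metis
qed

end

section \<open>Operators with bounded matrices\<close>

lemma admissible_action:
  assumes "solid_spectral_algebra K \<A> N" "admissible K \<A> w" "1 \<le> p"
  shows "action K \<A> N p w"
  using assms
  by (auto simp: admissible_def intro!: action.intro spectral_algebra.intro weighted.intro action_axioms.intro)

section \<open>Cross-Gram matrices of two frames and their duals\<close>

locale localized_pair = Psi: localized_frame K \<A> N \<psi> B A + Phi: localized_frame K \<A> N \<phi> B' A'
  for K :: "'k set" and \<A> N and \<psi> \<phi> :: "'k \<Rightarrow> 'h::complex_hilbert" and B A B' A' +
  assumes mutual: "loc_rel K \<A> \<phi> \<psi>"
begin

abbreviation "Rm \<equiv> cross_gram K (dual_frame K \<psi>) (dual_frame K \<phi>)"
abbreviation "Gx \<equiv> cross_gram K \<phi> \<psi>"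
abbreviation "Pm \<equiv> cross_gram K (dual_frame K \<psi>) \<psi>"

lemma Gx: "Gx \<in> \<A>" using mutual by (simp add: loc_rel_def)

text \<open>The adjoint of \<open>Gx\<close> is the Gram matrix of \<open>\<psi>\<close> against
  \<open>\<phi>\<close>. Multiplying it on the right by the Gram matrix of the dual of
  \<open>\<phi>\<close> and then on the left by that of the dual of \<open>\<psi>\<close> replaces
  both frames by their duals.\<close>

lemma Rm: "Rm \<in> \<A>"
proof -
  have "mat_adj Gx = cross_gram K \<psi> \<phi>"
    by (auto simp: mat_adj_def cross_gram_def fun_eq_iff intro: cinner_commute[symmetric])
  then have "cross_gram K \<psi> \<phi> \<in> \<A>" using Psi.alg_adj[OF Gx] by simp
  then have "cross_gram K \<psi> (dual_frame K \<phi>) \<in> \<A>"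
    using Psi.alg_mult[OF _ Phi.dual_dual_gram] Phi.mat_mult_gram_dual[of \<psi> "dual_frame K \<phi>"] by metis
  then show ?thesis
    using Psi.alg_mult[OF Psi.dual_dual_gram] Psi.mat_mult_gram_dual'[of "dual_frame K \<psi>" "dual_frame K \<phi>"]
    by metis
qed

text \<open>Hence \<open>Rm\<close> undoes \<open>Gx\<close> on sequences fixed by \<open>P\<close>,
  and by the next lemma all its values are fixed by \<open>P\<close>.\<close>

lemma Rm_Gx: "mat_mult K Rm Gx = Pm" by (rule Phi.mat_mult_gram_dual')

lemma Pm_Rm: "mat_mult K Pm Rm = Rm" by (rule Psi.mat_mult_gram_dual)

end

text \<open>The bracket matrix is bounded for all exponents at once: the extension acts on ell^p,
  but the comparison in \<open>Op_dual_coeff\<close> takes place in ell^1.\<close>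

locale matrix_bounded_operator = localized_pair K \<A> N \<psi> \<phi> B A B' A'
  for K :: "'k set" and \<A> N and \<psi> \<phi> :: "'k \<Rightarrow> 'h::complex_hilbert" and B A B' A' +
  fixes w :: "'k \<Rightarrow> real" and T :: "'h \<Rightarrow> (nat \<Rightarrow> 'h) set"
  assumes count: "countable K" and adm: "admissible K \<A> w" and adm1: "admissible K \<A> (\<lambda>_. 1)"
    and lin: "linear_H00_Hinf K \<psi> w T" and cont: "continuous_H00_Hinf K \<A> \<psi> w T"
    and schur: "\<And>p. 1 \<le> p \<Longrightarrow> bounded_on_lp K p (\<lambda>_. 1)
      (\<lambda>k l. if k \<in> K \<and> l \<in> K then coorbit_pairing K \<psi> (T (\<psi> l)) (\<phi> k) else 0)"
begin

abbreviation "\<psi>d \<equiv> dual_frame K \<psi>"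

lemma coorbit_spaceI:
  assumes v: "admissible K \<A> v" and p: "1 \<le> p"
  shows "coorbit_space K \<A> N \<psi> B A p v"
proof -
  interpret action K \<A> N p v by (rule admissible_action[OF Psi.ssa v p])
  show ?thesis
    by unfold_locales (use v count in \<open>auto simp: admissible_def\<close>)
qed

sublocale Ci: coorbit_space K \<A> N \<psi> B A \<infinity> w
  by (rule coorbit_spaceI[OF adm]) simp

definition Mm :: "'k matrix" where
  "Mm = (\<lambda>k l. if k \<in> K \<and> l \<in> K then coorbit_pairing K \<psi> (T (\<psi> l)) (\<phi> k) else 0)"

lemma Mm_matrices: "Mm \<in> matrices K"
  by (auto simp: Mm_def matrices_def)

definition \<gamma> :: "'h \<Rightarrow> 'k \<Rightarrow> complex" where "\<gamma> f = coorbit_coeff K \<psi> (T f)"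

lemma T_cls:
  assumes "f \<in> H00 K \<psi>"
  shows "\<gamma> f \<in> Ci.coeffs" "T f = Ci.cls (\<gamma> f)"
proof -
  have "T f \<in> Ci.cls ` Ci.coeffs"
    using lin assms unfolding linear_H00_Hinf_def Ci.coorbit_eq by simp
  then obtain c where c: "c \<in> Ci.coeffs" "T f = Ci.cls c" by blast
  have "\<gamma> f = c" unfolding \<gamma>_def c(2) by (rule Ci.coeff_cls[OF c(1)])
  with c show "\<gamma> f \<in> Ci.coeffs" "T f = Ci.cls (\<gamma> f)" by blast+
qed

lemma \<gamma>_lp: "f \<in> H00 K \<psi> \<Longrightarrow> \<gamma> f \<in> lp K \<infinity> w"
  by (rule Ci.coeffsD(1)[OF T_cls(1)])

lemma \<gamma>_add:
  assumes f: "f \<in> H00 K \<psi>" and g: "g \<in> H00 K \<psi>"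
  shows "\<gamma> (f + g) = (\<lambda>k. \<gamma> f k + \<gamma> g k)"
proof -
  have "T (f + g) = coorbit_add K \<psi> \<infinity> w (T f) (T g)"
    using lin f g unfolding linear_H00_Hinf_def by simp
  also have "\<dots> = Ci.cls (\<lambda>k. \<gamma> f k + \<gamma> g k)"
    using Ci.add_cls[OF T_cls(1)[OF f] T_cls(1)[OF g]] T_cls(2)[OF f] T_cls(2)[OF g] by simp
  finally show ?thesis
    using Ci.coeff_cls[OF Ci.coeffs_add[OF T_cls(1)[OF f] T_cls(1)[OF g]]] by (simp add: \<gamma>_def)
qed

lemma \<gamma>_cscale:
  assumes f: "f \<in> H00 K \<psi>"
  shows "\<gamma> (cscale a f) = (\<lambda>k. a * \<gamma> f k)"
proof -
  have "T (cscale a f) = coorbit_scale K \<psi> \<infinity> w a (T f)"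
    using lin f unfolding linear_H00_Hinf_def by simp
  also have "\<dots> = Ci.cls (\<lambda>k. a * \<gamma> f k)"
    using Ci.scale_cls[OF T_cls(1)[OF f]] T_cls(2)[OF f] by simp
  finally show ?thesis
    using Ci.coeff_cls[OF Ci.coeffs_scale[OF T_cls(1)[OF f]]] by (simp add: \<gamma>_def)
qed

text \<open>The brackets of \<open>T f\<close> with all \<open>\<phi> k\<close>: expanding the
  pairing gives a row of \<open>Gx\<close> applied to the coefficients.\<close>

definition \<mu> :: "'h \<Rightarrow> 'k \<Rightarrow> complex" where "\<mu> f = mat_vec K Gx (\<gamma> f)"

text \<open>\<open>Rm\<close> times \<open>Gx\<close> is \<open>P\<close>, which fixes the
  coefficients of every element of the coorbit space.\<close>

lemma \<gamma>_eq: "f \<in> H00 K \<psi> \<Longrightarrow> \<gamma> f = mat_vec K Rm (\<mu> f)"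
  using Ci.coeffsD(2)[OF T_cls(1)[of f]] Ci.mv_mult[OF Rm Gx \<gamma>_lp[of f]]
  unfolding \<mu>_def Rm_Gx by simp

lemma unit_H00: "l \<in> K \<Longrightarrow> \<psi> l \<in> H00 K \<psi>"
  using Psi.H00_synth[OF unit_seq_fin[of l K]] by (simp add: Psi.synth_unit_seq)

lemma \<mu>_unit: "l \<in> K \<Longrightarrow> \<mu> (\<psi> l) k = Mm k l"
  by (auto simp: \<mu>_def Mm_def \<gamma>_def mat_vec_def coorbit_pairing_def cross_gram_def analysis_def
      cinner_commute[of "\<phi> k"] mult.commute intro!: infsum_cong)

lemma zero_H00: "0 \<in> H00 K \<psi>"
  using Psi.H00_synth[of "\<lambda>_. 0"] by (simp add: synthesis_def fin_seqs_def)

lemma \<mu>_sum: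
  assumes "finite F" "F \<subseteq> K"
  shows "(\<Sum>l\<in>F. cscale (c l) (\<psi> l)) \<in> H00 K \<psi> \<and>
    \<mu> (\<Sum>l\<in>F. cscale (c l) (\<psi> l)) k = (\<Sum>l\<in>F. Mm k l * c l)"
  using assms
proof (induction F rule: finite_induct)
  case empty
  have "\<gamma> 0 = (\<lambda>_. 0)" using \<gamma>_cscale[OF zero_H00, of 0] by simp
  then show ?case using zero_H00 by (simp add: \<mu>_def mat_vec_def)
next
  case (insert l F)
  let ?s = "\<Sum>l\<in>F. cscale (c l) (\<psi> l)"
  have s: "?s \<in> H00 K \<psi>" and IH: "\<mu> ?s k = (\<Sum>l\<in>F. Mm k l * c l)" using insert by auto
  have l: "l \<in> K" using insert by simp
  have cl: "cscale (c l) (\<psi> l) \<in> H00 K \<psi>" by (intro Psi.H00_cscale unit_H00 l)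
  have "\<mu> (cscale (c l) (\<psi> l) + ?s) k = c l * \<mu> (\<psi> l) k + \<mu> ?s k"
    unfolding \<mu>_def \<gamma>_add[OF cl s] Ci.mv_add[OF Gx \<gamma>_lp[OF cl] \<gamma>_lp[OF s]]
    unfolding \<gamma>_cscale[OF unit_H00[OF l]] mat_vec_scale ..
  then show ?case
    using insert.hyps Psi.H00_add[OF cl s] by (simp add: IH \<mu>_unit[OF l] mult.commute)
qed

lemma \<mu>_synth:
  assumes c: "c \<in> fin_seqs K"
  shows "\<mu> (synthesis K \<psi> c) = mat_vec K Mm c"
proof
  fix k
  have F: "finite {l. c l \<noteq> 0}" "{l. c l \<noteq> 0} \<subseteq> K" using c by (auto simp: fin_seqs_def)
  have "mat_vec K Mm c k = (\<Sum>\<^sub>\<infinity>l\<in>{l. c l \<noteq> 0}. Mm k l * c l)"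
    unfolding mat_vec_def using F by (intro infsum_cong_neutral) auto
  also have "\<dots> = (\<Sum>l\<in>{l. c l \<noteq> 0}. Mm k l * c l)" using F by simp
  finally show "\<mu> (synthesis K \<psi> c) k = mat_vec K Mm c k"
    using \<mu>_sum[OF F, of c k] by (simp add: Psi.synth_fin[OF c])
qed

section \<open>The operator \<open>R M\<close> on sequences and its agreement with
  \<open>T\<close>\<close>

definition Op :: "('k \<Rightarrow> complex) \<Rightarrow> 'k \<Rightarrow> complex" where
  "Op c = mat_vec K Rm (mat_vec K Mm c)"

lemma \<gamma>_synth: "c \<in> fin_seqs K \<Longrightarrow> \<gamma> (synthesis K \<psi> c) = Op c"
  by (simp add: \<gamma>_eq Psi.H00_synth \<mu>_synth Op_def)

lemma Op_scale: "Op (\<lambda>k. a * c k) = (\<lambda>k. a * Op c k)"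
  by (simp add: Op_def mat_vec_scale)

lemma Mm_bounded: "1 \<le> p \<Longrightarrow> bounded_on_lp K p (\<lambda>_. 1) Mm"
  unfolding Mm_def by (rule schur)

lemma Op_add:
  assumes p: "1 \<le> p" and c: "c \<in> lp K p (\<lambda>_. 1)" and d: "d \<in> lp K p (\<lambda>_. 1)"
  shows "Op (\<lambda>k. c k + d k) = (\<lambda>k. Op c k + Op d k)"
proof -
  interpret action K \<A> N p "\<lambda>_. 1" by (rule admissible_action[OF Psi.ssa adm1 p])
  note b = Mm_bounded[OF p]
  show ?thesis
    unfolding Op_def bounded_mat_vec_add[OF b Mm_matrices c d]
    by (rule mv_add[OF Rm bounded_on_lpD(1)[OF b c] bounded_on_lpD(1)[OF b d]])
qed

lemma Op_diff:
  assumes p: "1 \<le> p" and c: "c \<in> lp K p (\<lambda>_. 1)" and d: "d \<in> lp K p (\<lambda>_. 1)"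
  shows "Op (\<lambda>k. c k - d k) = (\<lambda>k. Op c k - Op d k)"
proof -
  interpret action K \<A> N p "\<lambda>_. 1" by (rule admissible_action[OF Psi.ssa adm1 p])
  show ?thesis using Op_add[OF p c lp_scale(1)[OF d, of "-1"]] Op_scale[of "-1" d] by simp
qed

lemma Op_lp:
  assumes p: "1 \<le> p" and c: "c \<in> lp K p (\<lambda>_. 1)"
  shows "Op c \<in> lp K p (\<lambda>_. 1)" "mat_vec K Pm (Op c) = Op c"
proof -
  interpret action K \<A> N p "\<lambda>_. 1" by (rule admissible_action[OF Psi.ssa adm1 p])
  have M: "mat_vec K Mm c \<in> lp K p (\<lambda>_. 1)" by (rule bounded_on_lpD(1)[OF Mm_bounded[OF p] c])
  show "Op c \<in> lp K p (\<lambda>_. 1)" unfolding Op_def by (rule mv_lp[OF Rm M])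
  show "mat_vec K Pm (Op c) = Op c"
    unfolding Op_def using mv_mult[OF Psi.dual_gram Rm M] by (simp add: Pm_Rm)
qed

lemma Op_bound:
  assumes p: "1 \<le> p"
  obtains C where "0 \<le> C" "\<And>c. c \<in> lp K p (\<lambda>_. 1) \<Longrightarrow> lp_norm K p (\<lambda>_. 1) (Op c) \<le> C * lp_norm K p (\<lambda>_. 1) c"
proof -
  interpret action K \<A> N p "\<lambda>_. 1" by (rule admissible_action[OF Psi.ssa adm1 p])
  obtain C where C: "0 \<le> C" "\<And>c. c \<in> lp K p (\<lambda>_. 1) \<Longrightarrow>
      lp_norm K p (\<lambda>_. 1) (mat_vec K Rm c) \<le> C * lp_norm K p (\<lambda>_. 1) c"
    by (rule mv_bound[OF Rm]) blast
  obtain D where D: "0 \<le> D" "\<And>c. c \<in> lp K p (\<lambda>_. 1) \<Longrightarrow>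
      lp_norm K p (\<lambda>_. 1) (mat_vec K Mm c) \<le> D * lp_norm K p (\<lambda>_. 1) c"
    by (rule bounded_on_lpE[OF Mm_bounded[OF p]]) blast
  have "lp_norm K p (\<lambda>_. 1) (Op c) \<le> C * D * lp_norm K p (\<lambda>_. 1) c" if c: "c \<in> lp K p (\<lambda>_. 1)" for c
  proof -
    have "lp_norm K p (\<lambda>_. 1) (Op c) \<le> C * lp_norm K p (\<lambda>_. 1) (mat_vec K Mm c)"
      unfolding Op_def by (rule C(2)[OF bounded_on_lpD(1)[OF Mm_bounded[OF p] c]])
    also have "\<dots> \<le> C * (D * lp_norm K p (\<lambda>_. 1) c)" by (intro mult_left_mono D C c)
    finally show ?thesis by (simp add: mult.assoc)
  qed
  then show ?thesis using that[of "C * D"] C D by simp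
qed

text \<open>
  A vector of \<open>H00\<close> is the synthesis both of a finite \<open>c\<close> and of the infinite \<open>P c\<close>. The truncations
  of \<open>P c\<close> converge in \<open>\<ell>\<^sup>1\<close> for every admissible weight, so by the continuity of \<open>T\<close> the operator
  takes the same value on both.
\<close>

lemma Op_dual_coeff:
  assumes c: "c \<in> fin_seqs K"
  shows "Op (mat_vec K Pm c) = Op c"
proof -
  obtain q v C0 where q: "1 \<le> q" and v: "admissible K \<A> v"
    and C0: "\<And>f. f \<in> H00 K \<psi> \<Longrightarrow> coorbit_norm K \<psi> \<infinity> w (T f) \<le> C0 * pre_norm K \<psi> q v f"
    using cont unfolding continuous_H00_Hinf_def by blast
  interpret q: action K \<A> N q v by (rule admissible_action[OF Psi.ssa v q])
  interpret v1: action K \<A> N 1 v by (rule admissible_action[OF Psi.ssa v order_refl])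
  interpret u1: action K \<A> N 1 "\<lambda>_. 1" by (rule admissible_action[OF Psi.ssa adm1 order_refl])
  define a where "a = mat_vec K Pm c"
  have av: "a \<in> lp K 1 v" and au: "a \<in> lp K 1 (\<lambda>_. 1)"
    unfolding a_def using v1.fin_seqs_lp u1.fin_seqs_lp c
    by (auto intro!: v1.mv_lp u1.mv_lp Psi.dual_gram)
  have cu: "c \<in> lp K 1 (\<lambda>_. 1)" using u1.fin_seqs_lp c by blast
  \<comment> \<open>Both sequences subtract the same truncation of \<open>a = P c\<close>, from
    \<open>a\<close> and from \<open>c\<close>. \<open>e n\<close> is finitely supported, so
    \<open>T\<close> sees it; \<open>r n\<close> is a tail, so it is small.\<close>
  define r where "r n = (\<lambda>k. a k - truncate K n a k)" for n
  define e where "e n = (\<lambda>k. c k - truncate K n a k)" for n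
  have tf: "truncate K n a \<in> fin_seqs K" for n by (rule truncate_fin_seqs[OF count])
  have ef: "e n \<in> fin_seqs K" for n unfolding e_def by (intro fin_seqs_diff c tf)
  have rv: "r n \<in> lp K 1 v" and ru: "r n \<in> lp K 1 (\<lambda>_. 1)" for n
    unfolding r_def by (intro v1.lp_diff v1.truncate_lp u1.lp_diff u1.truncate_lp av au)+
  have one: "(1::ennreal) \<noteq> \<infinity>" by simp
  have rv0: "(\<lambda>n. lp_norm K 1 v (r n)) \<longlonglongrightarrow> 0"
    unfolding r_def by (rule v1.truncate_norm_tendsto[OF count av one])
  have ru0: "(\<lambda>n. lp_norm K 1 (\<lambda>_. 1) (r n)) \<longlonglongrightarrow> 0"
    unfolding r_def by (rule u1.truncate_norm_tendsto[OF count au one])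
  have aq: "mat_vec K Pm a = a"
    using v1.mv_mult[OF Psi.dual_gram Psi.dual_gram, of c] v1.fin_seqs_lp c
    by (auto simp: a_def Psi.mat_mult_gram_dual)
  \<comment> \<open>As \<open>P\<close> fixes \<open>a\<close> and maps \<open>c\<close> to
    \<open>a\<close>, the vector synthesized from \<open>e n\<close> has the coefficients
    \<open>P (r n)\<close> and is therefore small in the norm for which \<open>T\<close> is
    continuous.\<close>
  have Pe: "mat_vec K Pm (e n) = mat_vec K Pm (r n)" for n
    unfolding e_def r_def
    using v1.mv_diff[OF Psi.dual_gram _ v1.truncate_lp(1)[OF av]] av v1.fin_seqs_lp c
    by (auto simp: aq simp flip: a_def)
  obtain D where D: "0 \<le> D" "\<And>c. c \<in> lp K q v \<Longrightarrow> lp_norm K q v (mat_vec K Pm c) \<le> D * lp_norm K q v c"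
    by (rule q.mv_bound[OF Psi.dual_gram]) blast
  have eH: "synthesis K \<psi> (e n) \<in> H00 K \<psi>" for n by (rule Psi.H00_synth[OF ef])
  have le: "lp_norm K \<infinity> w (Op (e n)) \<le> \<bar>C0\<bar> * (D * lp_norm K 1 v (r n))" for n
  proof -
    have pn: "pre_norm K \<psi> q v (synthesis K \<psi> (e n)) = lp_norm K q v (mat_vec K Pm (r n))"
      by (simp add: pre_norm_def Psi.mat_vec_gram_synth[OF fin_seqs_ell2[OF ef], symmetric] Pe)
    have rq: "r n \<in> lp K q v" "lp_norm K q v (r n) \<le> lp_norm K 1 v (r n)" using q.lp_of_l1[OF rv] by auto
    have "lp_norm K \<infinity> w (Op (e n)) = coorbit_norm K \<psi> \<infinity> w (T (synthesis K \<psi> (e n)))"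
      using Ci.norm_cls[OF T_cls(1)[OF eH]] T_cls(2)[OF eH, of n] \<gamma>_synth[OF ef] by simp
    also have "\<dots> \<le> C0 * lp_norm K q v (mat_vec K Pm (r n))" using C0[OF eH, of n] by (simp add: pn)
    also have "\<dots> \<le> \<bar>C0\<bar> * lp_norm K q v (mat_vec K Pm (r n))"
      by (intro mult_right_mono lp_norm_nonneg q.mv_lp Psi.dual_gram rq) simp
    also have "\<dots> \<le> \<bar>C0\<bar> * (D * lp_norm K q v (r n))"
      by (intro mult_left_mono D rq) simp
    also have "\<dots> \<le> \<bar>C0\<bar> * (D * lp_norm K 1 v (r n))"
      by (intro mult_left_mono D rq) simp
    finally show ?thesis .
  qed
  have e_lp: "Op (e n) \<in> lp K \<infinity> w" for n using \<gamma>_lp[OF eH] \<gamma>_synth[OF ef] by simp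
  have "(\<lambda>n. \<bar>C0\<bar> * (D * lp_norm K 1 v (r n))) \<longlonglongrightarrow> \<bar>C0\<bar> * (D * 0)"
    by (intro tendsto_mult tendsto_const rv0)
  then have "(\<lambda>n. \<bar>C0\<bar> * (D * lp_norm K 1 v (r n))) \<longlonglongrightarrow> 0" by simp
  then have e0: "(\<lambda>n. lp_norm K \<infinity> w (Op (e n))) \<longlonglongrightarrow> 0"
    by (rule Lim_null_comparison[OF always_eventually, rotated])
      (use le lp_norm_nonneg[OF e_lp] in simp)
  obtain E where E: "0 \<le> E" "\<And>c. c \<in> lp K 1 (\<lambda>_. 1) \<Longrightarrow>
      lp_norm K 1 (\<lambda>_. 1) (Op c) \<le> E * lp_norm K 1 (\<lambda>_. 1) c"
    by (rule Op_bound[OF order_refl]) blast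
  have "(\<lambda>n. E * lp_norm K 1 (\<lambda>_. 1) (r n)) \<longlonglongrightarrow> 0"
    using tendsto_mult_right[OF ru0, of E] by (simp add: mult.commute)
  then have r0: "(\<lambda>n. lp_norm K 1 (\<lambda>_. 1) (Op (r n))) \<longlonglongrightarrow> 0"
    by (rule Lim_null_comparison[OF always_eventually, rotated])
      (use E(2)[OF ru] lp_norm_nonneg[OF Op_lp(1)[OF order_refl ru]] in simp)
  \<comment> \<open>The left side is independent of \<open>n\<close>. On the right, the first term
    tends to 0 in the weighted ell^\<infinity> by continuity of \<open>T\<close>, the second in
    ell^1 by boundedness of \<open>Op\<close>; coordinates are common to both.\<close>
  have diff: "Op c k - Op a k = Op (e n) k - Op (r n) k" for n k
    unfolding e_def r_def
    by (simp add: Op_diff[OF order_refl cu u1.truncate_lp(1)[OF au]]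
        Op_diff[OF order_refl au u1.truncate_lp(1)[OF au]])
  have "Op c k - Op a k = 0" for k
  proof -
    have "(\<lambda>n. Op (e n) k - Op (r n) k) \<longlonglongrightarrow> 0 - 0"
      by (intro tendsto_diff Ci.coord_tendsto[OF e_lp e0] u1.coord_tendsto[OF Op_lp(1)[OF order_refl ru] r0])
    then have "(\<lambda>n. Op c k - Op a k) \<longlonglongrightarrow> 0" by (simp add: diff[symmetric])
    then show ?thesis by (simp add: LIMSEQ_const_iff)
  qed
  then show ?thesis by (auto simp: a_def fun_eq_iff)
qed

text \<open>Through \<open>Cp.cls\<close> the operator \<open>Op\<close> on fixed sequences becomes
  an operator on classes. The class of \<open>f\<close> in \<open>H00\<close> carries the
  coefficients \<open>P c\<close> while \<open>T f\<close> has the coefficients \<open>Op c\<close>;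
  \<open>Op_dual_coeff\<close> closes this gap.\<close>

lemma extends:
  assumes p: "1 \<le> p"
  shows "extends_to_bounded_Hp K \<psi> p T"
proof -
  interpret Cp: coorbit_space K \<A> N \<psi> B A p "\<lambda>_. 1" by (rule coorbit_spaceI[OF adm1 p])
  define S where "S X = Cp.cls (Op (coorbit_coeff K \<psi> X))" for X
  have Op_coeffs: "Op c \<in> Cp.coeffs" if "c \<in> Cp.coeffs" for c
    using Op_lp[OF p] that by (simp add: Cp.coeffs_def)
  have clp: "c \<in> lp K p (\<lambda>_. 1)" if "c \<in> Cp.coeffs" for c using that by (simp add: Cp.coeffs_def)
  have S_cls: "S (Cp.cls c) = Cp.cls (Op c)" if "c \<in> Cp.coeffs" for c
    by (simp add: S_def Cp.coeff_cls[OF that])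
  obtain C where C: "\<And>c. c \<in> lp K p (\<lambda>_. 1) \<Longrightarrow>
      lp_norm K p (\<lambda>_. 1) (Op c) \<le> C * lp_norm K p (\<lambda>_. 1) c"
    by (rule Op_bound[OF p]) blast
  have "bounded_operator_Hp K \<psi> p (\<lambda>_. 1) S"
    unfolding bounded_operator_Hp_def Cp.coorbit_eq
  proof (intro conjI ballI allI)
    fix X assume "X \<in> Cp.cls ` Cp.coeffs"
    then obtain c where c: "c \<in> Cp.coeffs" "X = Cp.cls c" by blast
    show "S X \<in> Cp.cls ` Cp.coeffs" using Op_coeffs[OF c(1)] by (simp add: c S_cls)
    show "S (coorbit_scale K \<psi> p (\<lambda>_. 1) a X) = coorbit_scale K \<psi> p (\<lambda>_. 1) a (S X)" for a
      unfolding c(2) Cp.scale_cls[OF c(1)] S_cls[OF c(1)] S_cls[OF Cp.coeffs_scale[OF c(1)]]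
        Cp.scale_cls[OF Op_coeffs[OF c(1)]] Op_scale ..
  next
    fix X Y assume "X \<in> Cp.cls ` Cp.coeffs" "Y \<in> Cp.cls ` Cp.coeffs"
    then obtain c d where c: "c \<in> Cp.coeffs" "X = Cp.cls c" and d: "d \<in> Cp.coeffs" "Y = Cp.cls d" by blast
    show "S (coorbit_add K \<psi> p (\<lambda>_. 1) X Y) = coorbit_add K \<psi> p (\<lambda>_. 1) (S X) (S Y)"
      unfolding c(2) d(2) Cp.add_cls[OF c(1) d(1)] S_cls[OF c(1)] S_cls[OF d(1)]
        S_cls[OF Cp.coeffs_add[OF c(1) d(1)]] Cp.add_cls[OF Op_coeffs[OF c(1)] Op_coeffs[OF d(1)]]
        Op_add[OF p clp[OF c(1)] clp[OF d(1)]] ..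
  next
    show "\<exists>C. \<forall>X\<in>Cp.cls ` Cp.coeffs.
        coorbit_norm K \<psi> p (\<lambda>_. 1) (S X) \<le> C * coorbit_norm K \<psi> p (\<lambda>_. 1) X"
      using C by (intro exI[of _ C]) (auto simp: S_cls Cp.norm_cls Op_coeffs clp)
  qed
  moreover have "coorbit_coeff K \<psi> (S (coorbit_embed K \<psi> p (\<lambda>_. 1) f)) = coorbit_coeff K \<psi> (T f)"
    if f: "f \<in> H00 K \<psi>" for f
  proof -
    obtain c where c: "c \<in> fin_seqs K" "f = synthesis K \<psi> c" by (rule Psi.H00E[OF f])
    note e = Cp.embed_H00[OF f]
    have "coorbit_coeff K \<psi> (S (coorbit_embed K \<psi> p (\<lambda>_. 1) f)) = Op (analysis K \<psi>d f)"
      unfolding e(2) S_cls[OF e(1)] by (rule Cp.coeff_cls[OF Op_coeffs[OF e(1)]])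
    also have "\<dots> = Op c" unfolding c(2) Cp.dual_coeff_synth[OF c(1)] by (rule Op_dual_coeff[OF c(1)])
    also have "\<dots> = coorbit_coeff K \<psi> (T f)" using \<gamma>_synth[OF c(1)] by (simp add: \<gamma>_def c(2))
    finally show ?thesis .
  qed
  ultimately show ?thesis unfolding extends_to_bounded_Hp_def by blast
qed

end

theorem corollary3:
  fixes K :: "(real ^ 'd) set"
    and \<A> :: "(real ^ 'd) matrix set"
    and N :: "(real ^ 'd) matrix \<Rightarrow> real"
    and \<psi> \<phi> :: "real ^ 'd \<Rightarrow> 'h::{complex_hilbert, second_countable_topology}"
    and p :: ennreal
    and w :: "real ^ 'd \<Rightarrow> real"
    and T :: "'h \<Rightarrow> (nat \<Rightarrow> 'h) set"
  assumes "countable K" and "uniform_discrete K"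
    and "solid_spectral_algebra K \<A> N"
    and "is_frame K \<psi>" and "is_frame K \<phi>"
    and "localized K \<A> \<psi>" and "localized K \<A> \<phi>"
    and "loc_rel K \<A> \<phi> \<psi>"
    and "1 \<le> p"
    and "admissible K \<A> w" and "admissible K \<A> (\<lambda>_. 1)"
    and "linear_H00_Hinf K \<psi> w T"
    and "continuous_H00_Hinf K \<A> \<psi> w T"
    and "\<exists>C. \<forall>k\<in>K. (\<lambda>l. cmod (coorbit_pairing K \<psi> (T (\<psi> l)) (\<phi> k))) summable_on K \<and>
           (\<Sum>\<^sub>\<infinity>l\<in>K. cmod (coorbit_pairing K \<psi> (T (\<psi> l)) (\<phi> k))) \<le> C"
    and "\<exists>C. \<forall>l\<in>K. (\<lambda>k. cmod (coorbit_pairing K \<psi> (T (\<psi> l)) (\<phi> k))) summable_on K \<and>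
           (\<Sum>\<^sub>\<infinity>k\<in>K. cmod (coorbit_pairing K \<psi> (T (\<psi> l)) (\<phi> k))) \<le> C"
  shows "extends_to_bounded_Hp K \<psi> p T"
proof -
  let ?m = "\<lambda>k l. cmod (coorbit_pairing K \<psi> (T (\<psi> l)) (\<phi> k))"
  let ?M = "\<lambda>k l. if k \<in> K \<and> l \<in> K then coorbit_pairing K \<psi> (T (\<psi> l)) (\<phi> k) else 0"
  obtain C where C: "\<And>k. k \<in> K \<Longrightarrow> ?m k summable_on K" "\<And>k. k \<in> K \<Longrightarrow> (\<Sum>\<^sub>\<infinity>l\<in>K. ?m k l) \<le> C"
    using assms(14) by blast
  obtain C' where C': "\<And>l. l \<in> K \<Longrightarrow> (\<lambda>k. ?m k l) summable_on K"
      "\<And>l. l \<in> K \<Longrightarrow> (\<Sum>\<^sub>\<infinity>k\<in>K. ?m k l) \<le> C'"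
    using assms(15) by blast
  \<comment> \<open>One constant for rows and columns; the 1 makes it positive, as Schur's test
    demands.\<close>
  define D where "D = max 1 (max C C')"
  have rows: "(\<Sum>l\<in>F. cmod (?M k l)) \<le> D" if k: "k \<in> K" and F: "finite F" "F \<subseteq> K" for k F
  proof -
    have "(\<Sum>l\<in>F. cmod (?M k l)) = (\<Sum>l\<in>F. ?m k l)" using k F by (intro sum.cong) auto
    also have "\<dots> \<le> (\<Sum>\<^sub>\<infinity>l\<in>K. ?m k l)" using F by (intro finite_sum_le_infsum C k) auto
    also have "\<dots> \<le> D" using C(2)[OF k] by (simp add: D_def)
    finally show ?thesis .
  qed
  have cols: "(\<Sum>k\<in>F. cmod (?M k l)) \<le> D" if l: "l \<in> K" and F: "finite F" "F \<subseteq> K" for l F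
  proof -
    have "(\<Sum>k\<in>F. cmod (?M k l)) = (\<Sum>k\<in>F. ?m k l)" using l F by (intro sum.cong) auto
    also have "\<dots> \<le> (\<Sum>\<^sub>\<infinity>k\<in>K. ?m k l)" using F by (intro finite_sum_le_infsum C' l) auto
    also have "\<dots> \<le> D" using C'(2)[OF l] by (simp add: D_def)
    finally show ?thesis .
  qed
  have schur: "bounded_on_lp K q (\<lambda>_. 1) ?M" if "1 \<le> q" for q
    by (rule schur_test[OF _ rows cols _ that]) (auto simp: D_def matrices_def)
  obtain B A where "frame K \<psi> B A" using is_frameE[OF assms(4)] by blast
  then interpret Psi: localized_frame K \<A> N \<psi> B A
    by (intro localized_frame.intro spectral_algebra.intro localized_frame_axioms.intro assms)
  obtain B' A' where "frame K \<phi> B' A'" using is_frameE[OF assms(5)] by blast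
  then interpret Phi: localized_frame K \<A> N \<phi> B' A'
    by (intro localized_frame.intro spectral_algebra.intro localized_frame_axioms.intro assms)
  interpret matrix_bounded_operator K \<A> N \<psi> \<phi> B A B' A' w T
    by unfold_locales (fact assms schur)+
  show ?thesis by (rule extends[OF assms(9)])
qed

end
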